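(* Let $\Omega\subset\mathbb{R}^N$, $N\geq 3$, be a bounded open set with smooth boundary, let $p\in\left(1,\frac{N}{N-2}\right)$, and let $(\alpha_n,\lambda_n,v_n)$, $n\in\mathbb{N}$, be such that $\alpha_n\in\mathbb{R}$, $\lambda_n>0$, $v_n\in C^{2,\beta}(\overline\Omega)$ for some $\beta\in(0,1)$, and \[ \begin{cases} -\Delta v_n=\mu_n[v_n-1]_+^p & \text{in } \Omega,\\ v_n=0 & \text{on } \partial\Omega,\\ \mu_n:=\lambda_n|\alpha_n|^{p-1}\to+\infty & \text{as } n\to+\infty,\\ \int_\Omega |\alpha_n|^p[v_n-1]_+^p\,dx=1. \end{cases} \] Assume that there is $C_0>0$ such that $\mu_n^{N/2}\int_\Omega[v_n-1]_+^p\,dx\leq C_0$ for all $n$, and assume moreover that either $\Omega$ is convex, or there is $C_1>0$ such that $\mu_n^{N/2}\int_\Omega[v_n-1]_+^{p+1}\,dx\leq C_1$ for all $n$. Let $\Sigma$ be the spike set of $(v_n)$. Then $\Sigma\subset\Omega$, i.e. there are no spike points on $\partial\Omega$.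
   Context: Notation: $[t]_+=\max\{t,0\}$, $\epsilon_n^2:=\mu_n^{-1}$, $B_r(x)$ is the open ball of radius $r$ centered at $x$. The spike set of $(v_n)$ is the largest set $\Sigma\subset\overline\Omega$ such that for every $z\in\Sigma$ there exist points $x_n\in\Omega$ with $x_n\to z$ and constants $\sigma_z>0$, $M_z>0$ such that: $v_n(x_n)\geq1+\sigma_z$ for all $n$; $\epsilon_n=o(\mathrm{dist}(x_n,\partial\Omega))$ as $n\to\infty$; and $\mu_n^{N/2}\int_{B_r(z)\cap\Omega}[v_n-1]_+^p\,dx\le M_z$ for all $r>0$. *)

theory Defs
  imports "HOL-Analysis.Analysis" "HOL-Library.Landau_Symbols"
begin

definition partial :: "'n::finite \<Rightarrow> (real^'n \<Rightarrow> real) \<Rightarrow> real^'n \<Rightarrow> real" where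
  "partial i f x = deriv (\<lambda>t. f (x + t *\<^sub>R axis i 1)) 0"

fun Ck_on :: "nat \<Rightarrow> (real^'n::finite) set \<Rightarrow> (real^'n \<Rightarrow> real) \<Rightarrow> bool" where
  "Ck_on 0 U f = continuous_on U f"
| "Ck_on (Suc k) U f = ((\<forall>x\<in>U. f differentiable (at x)) \<and> (\<forall>i. Ck_on k U (partial i f)))"

definition smooth_on :: "(real^'n::finite) set \<Rightarrow> (real^'n \<Rightarrow> real) \<Rightarrow> bool" where
  "smooth_on U f \<longleftrightarrow> (\<forall>k. Ck_on k U f)"

definition smooth_boundary :: "(real^'n::finite) set \<Rightarrow> bool" where
  "smooth_boundary \<Omega> \<longleftrightarrow>
     (\<forall>z\<in>frontier \<Omega>. \<exists>r>0. \<exists>\<phi>. smooth_on (ball z r) \<phi> \<and>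
        (\<forall>x\<in>ball z r. \<exists>i. partial i \<phi> x \<noteq> 0) \<and>
        \<Omega> \<inter> ball z r = {x\<in>ball z r. \<phi> x < 0})"

definition holder_on :: "real \<Rightarrow> (real^'n::finite) set \<Rightarrow> (real^'n \<Rightarrow> real) \<Rightarrow> bool" where
  "holder_on \<beta> S g \<longleftrightarrow> (\<exists>C. \<forall>x\<in>S. \<forall>y\<in>S. \<bar>g x - g y\<bar> \<le> C * dist x y powr \<beta>)"

text \<open>v in C^{2,beta}(closure Omega): C^2 in Omega, v and its derivatives up to order 2
  uniformly beta-Hoelder on Omega (hence bounded and extending continuously to the closure),
  and v continuous on the closure.\<close>
definition C2_holder :: "real \<Rightarrow> (real^'n::finite) set \<Rightarrow> (real^'n \<Rightarrow> real) \<Rightarrow> bool" where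
  "C2_holder \<beta> \<Omega> v \<longleftrightarrow> Ck_on 2 \<Omega> v \<and> continuous_on (closure \<Omega>) v \<and>
     holder_on \<beta> \<Omega> v \<and> (\<forall>i. holder_on \<beta> \<Omega> (partial i v)) \<and>
     (\<forall>i j. holder_on \<beta> \<Omega> (partial j (partial i v)))"

definition laplacian :: "(real^'n::finite \<Rightarrow> real) \<Rightarrow> real^'n \<Rightarrow> real" where
  "laplacian f x = (\<Sum>i\<in>UNIV. partial i (partial i f) x)"

definition pospart :: "real \<Rightarrow> real" where
  "pospart t = max t 0"

definition spike_set :: "(real^'n::finite) set \<Rightarrow> real \<Rightarrow> (nat \<Rightarrow> real) \<Rightarrow> (nat \<Rightarrow> real^'n \<Rightarrow> real) \<Rightarrow> (real^'n) set" where
  "spike_set \<Omega> p \<mu> v = {z \<in> closure \<Omega>. \<exists>x \<sigma> M.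
      (\<forall>n. x n \<in> \<Omega>) \<and> x \<longlonglongrightarrow> z \<and> \<sigma> > 0 \<and> M > 0 \<and>
      (\<forall>n. v n (x n) \<ge> 1 + \<sigma>) \<and>
      (\<lambda>n. 1 / sqrt (\<mu> n)) \<in> o(\<lambda>n. infdist (x n) (frontier \<Omega>)) \<and>
      (\<forall>n. \<forall>r>0. \<mu> n powr (real CARD('n) / 2) *
          integral (ball z r \<inter> \<Omega>) (\<lambda>y. pospart (v n y - 1) powr p) \<le> M)}"

end

theory Submission
  imports Defs
begin

text \<open>
  Write \<open>N\<close> for the dimension, \<open>\<epsilon> = \<mu>\<^bsup>-1/2\<^esup>\<close> and \<open>f = \<mu> [u - 1]\<^sub>+\<^bsup>p\<^esup>\<close>, so that the mass of \<open>f\<close> is at most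
  \<open>C\<^sub>0 \<epsilon>\<^bsup>N-2\<^esup>\<close>. Comparing \<open>u\<close> with the Newtonian potential of \<open>f\<close> and using
  \<open>p < N/(N-2)\<close>, the mass bound yields a uniform bound for \<open>u\<close> and forces \<open>{u > 1}\<close> to lie in boundedly many balls
  of radius comparable to \<open>\<epsilon>\<close>, each of mass comparable to \<open>\<epsilon>\<^bsup>N-2\<^esup>\<close>.

  Suppose that there is a spike at distance \<open>d\<close> from the boundary, \<open>\<epsilon> \<ll> d \<ll> 1\<close>. By the pigeonhole principle some
  scale \<open>\<rho> = A\<^bsup>j\<^esup> d\<close>, with \<open>j \<ge> 1\<close> bounded, has an annulus around the spike on which \<open>u \<le> 1\<close>. There \<open>u\<close> is
  harmonic and of size \<open>\<epsilon>\<^bsup>N-2\<^esup> \<rho>\<^bsup>2-N\<^esup>\<close>, so by Caccioppoli the stress tensor of \<open>u\<close> exerts on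
  the annulus a force at most of order \<open>\<epsilon>\<^bsup>2N-4\<^esup> \<rho>\<^bsup>1-N\<^esup>\<close>. The Pohozaev identity for a translation \<open>e\<close>
  transversal to the boundary balances it against the integral of \<open>\<bar>\<nabla>u\<bar>\<^sup>2 \<partial>\<^sub>e u\<close> over the boundary, which
  has a sign. The flux of \<open>\<nabla>u\<close> through the part of the boundary at distance of order \<open>d\<close> from the spike is at
  least of order \<open>\<epsilon>\<^bsup>N-2\<^esup>\<close> (test with a bump that is subharmonic in the domain), so by Cauchy-Schwarz the
  boundary force is at least of order \<open>\<epsilon>\<^bsup>2N-4\<^esup> d\<^bsup>1-N\<^esup>\<close>: a contradiction when \<open>A\<close> is large.

  Boundary integrals never occur: the boundary is replaced by a truncation of \<open>u\<close> at small positive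
  levels, and all identities are integrals of divergences of compactly supported fields.
\<close>

section \<open>Integration by parts\<close>

text \<open>The two forces are the same expression at the scales \<open>d\<close> and
  \<open>\<rho>\<close>, because a boundary patch of size \<open>d\<close> has area of order
  \<open>d ^ (N - 1)\<close>; their quotient is \<open>A ^ (j * (N - 1))\<close>. The separation
  \<open>A\<close> may be taken as large as desired because the number \<open>K\<close> of scales to
  be tried depends on \<open>C0\<close> and on the mass of one concentration point, not on
  \<open>A\<close>. That the spike is far from the boundary in units of \<epsilon> keeps a fixed
  share of mass within distance \<open>d / 8\<close> of it, where the test bump is bounded below;
  that \<open>d\<close> tends to 0 leaves room in one boundary chart for all scales up to
  \<open>A ^ K * d\<close>. The annulus may meet the boundary, so interior gradient estimates do not
  suffice there; Caccioppoli's inequality holds across the boundary since u vanishes on it. The sign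
  of the boundary force, and its lower bound in terms of the flux, need a uniform angle between e
  and the boundary: this is the role of the cone of directions around e.\<close>

definition bdd_cont :: "'a::topological_space set \<Rightarrow> ('a \<Rightarrow> 'b::real_normed_vector) \<Rightarrow> bool" where
  "bdd_cont S q \<longleftrightarrow> continuous_on S q \<and> bounded (q ` S)"

lemma bdd_contD: "bdd_cont S q \<Longrightarrow> continuous_on S q" "bdd_cont S q \<Longrightarrow> bounded (q ` S)"
  by (auto simp: bdd_cont_def)

lemma bdd_cont_const: "bdd_cont S (\<lambda>x. c)"
  by (auto simp: bdd_cont_def bounded_iff)

lemma bdd_cont_add: "bdd_cont S f \<Longrightarrow> bdd_cont S g \<Longrightarrow> bdd_cont S (\<lambda>x. f x + g x)"
  unfolding bdd_cont_def by (auto intro: continuous_on_add bounded_plus_comp)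

lemma bdd_cont_minus: "bdd_cont S f \<Longrightarrow> bdd_cont S (\<lambda>x. - f x)"
  unfolding bdd_cont_def by (auto intro: continuous_on_minus simp: bounded_iff)

lemma bdd_cont_diff: "bdd_cont S f \<Longrightarrow> bdd_cont S g \<Longrightarrow> bdd_cont S (\<lambda>x. f x - g x)"
  unfolding bdd_cont_def by (auto intro: continuous_on_diff bounded_minus_comp)

lemma bdd_cont_bilinear:
  assumes "bounded_bilinear h" "bdd_cont S f" "bdd_cont S g"
  shows "bdd_cont S (\<lambda>x. h (f x) (g x))"
proof -
  interpret bounded_bilinear h by fact
  obtain K where K: "K > 0" "\<And>a b. norm (h a b) \<le> norm a * norm b * K"
    using pos_bounded by blast
  obtain A where A: "\<And>x. x \<in> S \<Longrightarrow> norm (f x) \<le> A"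
    using assms(2) by (auto simp: bdd_cont_def bounded_iff)
  obtain B where B: "\<And>x. x \<in> S \<Longrightarrow> norm (g x) \<le> B"
    using assms(3) by (auto simp: bdd_cont_def bounded_iff)
  have "norm (h (f x) (g x)) \<le> \<bar>A\<bar> * \<bar>B\<bar> * K" if "x \<in> S" for x
  proof -
    have "norm (f x) * norm (g x) \<le> \<bar>A\<bar> * \<bar>B\<bar>"
      using A[OF that] B[OF that] by (intro mult_mono) (auto intro: order_trans)
    then show ?thesis
      using K(2)[of "f x" "g x"] K(1) by (meson mult_right_mono less_imp_le order_trans)
  qed
  then have "bounded ((\<lambda>x. h (f x) (g x)) ` S)"
    by (auto simp: bounded_iff)
  moreover have "continuous_on S (\<lambda>x. h (f x) (g x))"
    using assms unfolding bdd_cont_def by (intro continuous_on) auto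
  ultimately show ?thesis by (simp add: bdd_cont_def)
qed

lemmas bdd_cont_mult = bdd_cont_bilinear[OF bounded_bilinear_mult]
lemmas bdd_cont_scaleR = bdd_cont_bilinear[OF bounded_bilinear_scaleR]
lemmas bdd_cont_inner = bdd_cont_bilinear[OF bounded_bilinear_inner]

lemma bdd_cont_norm: "bdd_cont S f \<Longrightarrow> bdd_cont S (\<lambda>x. norm (f x))"
  unfolding bdd_cont_def by (auto intro: continuous_on_norm simp: bounded_iff)

lemma bdd_cont_power: "bdd_cont S f \<Longrightarrow> bdd_cont S (\<lambda>x. (f x :: 'b::real_normed_algebra_1) ^ k)"
  by (induction k) (simp_all add: bdd_cont_const bdd_cont_mult)

lemma bdd_cont_compose:
  fixes Y :: "'b::{real_normed_vector,heine_borel} \<Rightarrow> 'c::real_normed_vector"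
  assumes "bdd_cont S f" "continuous_on UNIV Y"
  shows "bdd_cont S (\<lambda>x. Y (f x))"
proof -
  have "compact (closure (f ` S))"
    using assms(1) by (simp add: bdd_cont_def compact_closure)
  then have "compact (Y ` closure (f ` S))"
    using assms(2) continuous_on_subset by (intro compact_continuous_image) auto
  then have "bounded ((\<lambda>x. Y (f x)) ` S)"
    by (rule bounded_subset[OF compact_imp_bounded]) (metis closure_subset image_image image_mono)
  moreover have "continuous_on S (\<lambda>x. Y (f x))"
    using assms unfolding bdd_cont_def by (intro continuous_on_compose2[OF assms(2)]) auto
  ultimately show ?thesis by (simp add: bdd_cont_def)
qed

lemma bdd_cont_subset: "bdd_cont S f \<Longrightarrow> T \<subseteq> S \<Longrightarrow> bdd_cont T f"
  unfolding bdd_cont_def by (meson bounded_subset continuous_on_subset image_mono)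

lemma bdd_cont_continuous_UNIV:
  fixes f :: "'a::{real_normed_vector,heine_borel} \<Rightarrow> 'b::real_normed_vector"
  shows "continuous_on UNIV f \<Longrightarrow> bounded S \<Longrightarrow> bdd_cont S f"
  using bdd_cont_compose[of S "\<lambda>x. x" f]
  by (auto simp: bdd_cont_def)

lemma bdd_cont_cong: "(\<And>x. x \<in> S \<Longrightarrow> f x = g x) \<Longrightarrow> bdd_cont S f = bdd_cont S g"
  unfolding bdd_cont_def using continuous_on_cong image_cong by (metis (no_types, lifting))

text \<open>A Hessian is continuous in the open set, but nothing bounds it near the frontier;
  boundedness of a truncated integrand comes from the compact set that carries it.\<close>

lemma bdd_cont_compact_support:
  assumes "continuous_on S q" "compact K" "K \<subseteq> S" "\<And>x. x \<in> S - K \<Longrightarrow> q x = 0"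
  shows "bdd_cont S q"
proof -
  have "compact (q ` K)"
    using assms by (intro compact_continuous_image) (auto intro: continuous_on_subset)
  then have "bounded (insert 0 (q ` K))" by (simp add: compact_imp_bounded)
  then have "bounded (q ` S)" by (rule bounded_subset) (use assms in auto)
  then show ?thesis using assms by (simp add: bdd_cont_def)
qed

lemmas bdd_cont_intros = bdd_cont_const bdd_cont_add bdd_cont_minus bdd_cont_diff bdd_cont_mult
  bdd_cont_scaleR bdd_cont_inner bdd_cont_norm bdd_cont_power

text \<open>The reason for working with \<open>bdd_cont\<close>: the class is closed under sums and
  products, so integrability of the composite integrands below reduces to applying its introduction
  rules.\<close>

lemma bdd_cont_integrable:
  fixes q :: "'a::euclidean_space \<Rightarrow> 'b::euclidean_space"
  assumes "bdd_cont S q" "open S" "bounded S"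
  shows "q integrable_on S"
proof -
  obtain B where B: "\<And>x. x \<in> S \<Longrightarrow> norm (q x) \<le> B"
    using assms(1) by (auto simp: bdd_cont_def bounded_iff)
  have S: "S \<in> lmeasurable"
    using assms by (simp add: lmeasurable_open)
  have "q absolutely_integrable_on S"
  proof (rule measurable_bounded_by_integrable_imp_absolutely_integrable[of _ _ "\<lambda>_. B"])
    show "q \<in> borel_measurable (lebesgue_on S)"
      using assms by (intro continuous_imp_measurable_on_sets_lebesgue) (auto simp: bdd_cont_def)
    show "S \<in> sets lebesgue" using S by auto
    show "(\<lambda>_. B) integrable_on S" using S by (rule integrable_on_const)
  qed (use B in auto)
  then show ?thesis by (rule set_lebesgue_integral_eq_integral)
qed

section \<open>The divergence theorem for compactly supported fields\<close>

lemma gderiv_along: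
  assumes "GDERIV f (x + t *\<^sub>R b) :> D"
  shows "((\<lambda>t. f (x + t *\<^sub>R b)) has_real_derivative (D \<bullet> b)) (at t)"
proof -
  have 1: "((\<lambda>t. x + t *\<^sub>R b) has_derivative (\<lambda>h. h *\<^sub>R b)) (at t)"
    by (auto intro!: derivative_eq_intros)
  have "((\<lambda>t. f (x + t *\<^sub>R b)) has_derivative (\<lambda>h. (h *\<^sub>R b) \<bullet> D)) (at t)"
    using has_derivative_compose[OF 1 assms[unfolded gderiv_def]] by simp
  then show ?thesis
    unfolding has_field_derivative_def by (rule has_derivative_eq_rhs) (auto simp: inner_commute)
qed

lemma gderiv_continuous: "GDERIV f x :> D \<Longrightarrow> isCont f x"
  unfolding gderiv_def by (rule has_derivative_continuous)

lemma gderiv_mvt: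
  assumes "\<And>s. 0 \<le> s \<Longrightarrow> s \<le> t \<Longrightarrow> GDERIV f (x + s *\<^sub>R b) :> G (x + s *\<^sub>R b)" "0 < t"
  obtains s where "0 < s" "s < t" "f (x + t *\<^sub>R b) - f x = t * (G (x + s *\<^sub>R b) \<bullet> b)"
proof -
  have "\<exists>z>0. z < t \<and> f (x + t *\<^sub>R b) - f (x + 0 *\<^sub>R b) = (t - 0) * (G (x + z *\<^sub>R b) \<bullet> b)"
    by (rule MVT2) (use assms in \<open>auto intro: gderiv_along\<close>)
  then show ?thesis using that by auto
qed

lemma integral_translation_UNIV:
  fixes q :: "'a::euclidean_space \<Rightarrow> real"
  assumes "continuous_on UNIV q" "\<And>x. norm x > B \<Longrightarrow> q x = 0"
  shows "(\<lambda>x. q (x + c)) integrable_on UNIV" "integral UNIV (\<lambda>x. q (x + c)) = integral UNIV q"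
proof -
  obtain a where a: "cball (0::'a) \<bar>B\<bar> \<subseteq> cbox (-a) a"
    using bounded_subset_cbox_symmetric bounded_cball by metis
  have z: "q x = 0" if "x \<notin> cbox (-a) a" for x
  proof (rule assms(2), rule ccontr)
    assume "\<not> B < norm x"
    then have "x \<in> cball 0 \<bar>B\<bar>" by simp
    then show False using that a by blast
  qed
  have qi: "(q has_integral integral UNIV q) (cbox (-a) a)"
  proof -
    have *: "(q has_integral integral (cbox (-a) a) q) (cbox (-a) a)"
      using assms(1) continuous_on_subset by (intro integrable_integral integrable_continuous) blast
    moreover have "(q has_integral integral (cbox (-a) a) q) UNIV"
      using * by (rule has_integral_on_superset) (use z in auto)
    then have "integral UNIV q = integral (cbox (-a) a) q" by (rule integral_unique)
    ultimately show ?thesis by (simp only:)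
  qed
  have "((\<lambda>x. q (1 *\<^sub>R x + c)) has_integral (1 / \<bar>1\<bar> ^ DIM('a)) *\<^sub>R integral UNIV q)
      ((\<lambda>x. (1 / 1) *\<^sub>R x + - ((1 / 1) *\<^sub>R c)) ` cbox (-a) a)"
    using has_integral_affinity[OF qi, of 1 c] by simp
  then have "((\<lambda>x. q (x + c)) has_integral integral UNIV q) ((\<lambda>x. x - c) ` cbox (-a) a)"
    by simp
  then have *: "((\<lambda>x. q (x + c)) has_integral integral UNIV q) UNIV"
  proof (rule has_integral_on_superset)
    show "q (x + c) = 0" if "x \<notin> (\<lambda>x. x - c) ` cbox (-a) a" for x
      using z[of "x + c"] that by (metis add_diff_cancel_right' image_eqI)
  qed auto
  show "(\<lambda>x. q (x + c)) integrable_on UNIV" "integral UNIV (\<lambda>x. q (x + c)) = integral UNIV q"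
    using has_integral_integrable[OF *] integral_unique[OF *] .
qed

text \<open>Difference quotients have integral 0 by translation invariance. The mean value theorem
  bounds them by the supremum of \<open>Q\<close>, and dominated convergence passes to the
  derivative.\<close>

lemma integral_directional_derivative:
  fixes q :: "'a::euclidean_space \<Rightarrow> real"
  assumes q: "continuous_on UNIV q" and Q: "continuous_on UNIV Q"
    and der: "\<And>x t. ((\<lambda>t. q (x + t *\<^sub>R b)) has_real_derivative Q (x + t *\<^sub>R b)) (at t)"
    and supp: "\<And>x. norm x > B \<Longrightarrow> q x = 0" and Qsupp: "\<And>x. norm x > B \<Longrightarrow> Q x = 0"
  shows "integral UNIV Q = 0"
proof -
  define e where "e k = 1 / real (Suc k)" for k
  have e: "e k > 0" "e k \<le> 1" for k by (auto simp: e_def)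
  have e0: "e \<longlonglongrightarrow> 0" unfolding e_def by (rule LIMSEQ_Suc, rule lim_1_over_n)
  define s where "s k x = (q (x + e k *\<^sub>R b) - q x) / e k" for k x
  have "bdd_cont (ball 0 (\<bar>B\<bar> + 1)) Q"
    using Q by (rule bdd_cont_continuous_UNIV) simp
  then obtain M where M: "\<And>x. norm x < \<bar>B\<bar> + 1 \<Longrightarrow> \<bar>Q x\<bar> \<le> M"
    unfolding bdd_cont_def bounded_iff by fastforce
  have M': "\<bar>Q x\<bar> \<le> \<bar>M\<bar>" for x
    using M[of x] Qsupp[of x] by (cases "norm x < \<bar>B\<bar> + 1") auto
  \<comment> \<open>Translates by \<open>e k *\<^sub>R b\<close> move the support by at most
    \<open>norm b\<close>, since \<open>e k\<close> is at most 1. One ball therefore carries all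
    quotients.\<close>
  define R where "R = \<bar>B\<bar> + norm b + 1"
  define h where "h x = (if x \<in> cball (0::'a) R then \<bar>M\<bar> else 0)" for x
  have hi: "h integrable_on UNIV"
    unfolding h_def integrable_restrict_UNIV by (rule integrable_on_const) simp
  have qt: "(\<lambda>x. q (x + c)) integrable_on UNIV" "integral UNIV (\<lambda>x. q (x + c)) = integral UNIV q" for c
    using integral_translation_UNIV[OF q supp] by auto
  have q0: "q integrable_on UNIV" using qt(1)[of 0] by simp
  have si: "s k integrable_on UNIV" for k
    unfolding s_def by (intro integrable_on_divide integrable_diff qt q0)
  have s0: "integral UNIV (s k) = 0" for k
  proof -
    have "integral UNIV (\<lambda>x. q (x + e k *\<^sub>R b) - q x) = 0"
      by (subst integral_diff[OF qt(1) q0]) (simp add: qt(2))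
    then show ?thesis unfolding s_def by (simp only: integral_divide)
  qed
  have sb: "norm (s k x) \<le> h x" for k x
  proof (cases "x \<in> cball 0 R")
    case True
    have "\<exists>z>0. z < e k \<and> q (x + e k *\<^sub>R b) - q (x + 0 *\<^sub>R b) = (e k - 0) * Q (x + z *\<^sub>R b)"
      by (rule MVT2) (use der e in auto)
    then obtain z where "q (x + e k *\<^sub>R b) - q x = e k * Q (x + z *\<^sub>R b)" by auto
    then have "s k x = Q (x + z *\<^sub>R b)" using e(1)[of k] by (simp add: s_def)
    then show ?thesis using M' True by (simp add: h_def)
  next
    case False
    then have n: "norm x > R" by simp
    have "norm (e k *\<^sub>R b) \<le> norm b"
      using e[of k] by (simp add: mult_left_le_one_le)
    then have "norm (x + e k *\<^sub>R b) \<ge> norm x - norm b"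
      using norm_triangle_ineq2[of x "- (e k *\<^sub>R b)"] by simp
    then have "q (x + e k *\<^sub>R b) = 0" "q x = 0"
      using n norm_ge_zero[of b] abs_ge_self[of B] unfolding R_def by (intro supp; linarith)+
    then show ?thesis by (simp add: s_def h_def)
  qed
  have conv: "(\<lambda>k. s k x) \<longlonglongrightarrow> Q x" for x
  proof -
    have "((\<lambda>t. (q (x + t *\<^sub>R b) - q x) / t) \<longlongrightarrow> Q x) (at 0)"
      using der[of x 0] by (simp add: DERIV_def)
    moreover have "filterlim e (at 0) sequentially"
      using e0 e(1) by (auto simp: filterlim_at less_imp_neq intro!: always_eventually) (metis less_irrefl)
    ultimately show ?thesis unfolding s_def by (rule filterlim_compose)
  qed
  have "(\<lambda>k. integral UNIV (s k)) \<longlonglongrightarrow> integral UNIV Q"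
    by (rule dominated_convergence(2)[OF si hi sb conv])
  then show ?thesis by (simp add: s0 LIMSEQ_const_iff)
qed

text \<open>The extension of \<open>W\<close> by 0 is differentiable everywhere because the open
  sets \<open>S\<close> and \<open>- K\<close> cover the space. Each diagonal entry of its
  derivative is then a directional derivative of a compactly supported function.\<close>

theorem divergence_theorem_compact_support:
  fixes W :: "'a::euclidean_space \<Rightarrow> 'a"
  assumes S: "open S" and K: "compact K" "K \<subseteq> S"
    and der: "\<And>x. x \<in> S \<Longrightarrow> (W has_derivative W' x) (at x)"
    and cont: "\<And>b. b \<in> Basis \<Longrightarrow> continuous_on S (\<lambda>x. W' x b)"
    and supp: "\<And>x. x \<in> S - K \<Longrightarrow> W x = 0"
  shows "bdd_cont S (\<lambda>x. \<Sum>b\<in>Basis. W' x b \<bullet> b)"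
    and "integral S (\<lambda>x. \<Sum>b\<in>Basis. W' x b \<bullet> b) = 0"
proof -
  have oSK: "open (S - K)" using S K by (simp add: open_Diff compact_imp_closed)
  have W'0: "W' x h = 0" if "x \<in> S - K" for x h
  proof -
    have "((\<lambda>x. 0) has_derivative W' x) (at x)"
      by (rule has_derivative_transform_within_open[OF der oSK]) (use that supp in auto)
    then have "W' x = (\<lambda>h. 0)" by (rule has_derivative_unique) simp
    then show ?thesis by simp
  qed
  define V where "V x = (if x \<in> S then W x else 0)" for x
  define V' where "V' x = (if x \<in> S then W' x else (\<lambda>h. 0))" for x
  have V'0: "V' x h = 0" and V0: "V x = 0" if "x \<notin> K" for x h
    using that W'0 supp by (auto simp: V'_def V_def)
  have oK: "open (- K)" using K by (simp add: compact_imp_closed open_Compl)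
  have V: "(V has_derivative V' x) (at x)" for x
  proof (cases "x \<in> S")
    case True
    have "(V has_derivative W' x) (at x)"
      by (rule has_derivative_transform_within_open[OF der S]) (use True in \<open>auto simp: V_def\<close>)
    then show ?thesis using True by (simp add: V'_def)
  next
    case False
    have "(V has_derivative (\<lambda>h. 0)) (at x)"
      by (rule has_derivative_transform_within_open[OF has_derivative_const oK])
         (use False K V0 in auto)
    then show ?thesis using False by (simp add: V'_def)
  qed
  have V'c: "continuous_on UNIV (\<lambda>x. V' x b)" if "b \<in> Basis" for b
  proof -
    have "continuous_on S (\<lambda>x. V' x b)"
      using cont[OF that] by (rule continuous_on_cong[THEN iffD1, rotated 2]) (auto simp: V'_def)
    moreover have "continuous_on (- K) (\<lambda>x. V' x b)"
      by (rule continuous_on_cong[THEN iffD1, OF refl _ continuous_on_const[of _ 0]])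
         (simp add: V'0)
    ultimately have "continuous_on (S \<union> - K) (\<lambda>x. V' x b)"
      by (rule continuous_on_open_Un[OF S oK])
    moreover have "S \<union> - K = UNIV" using K by auto
    ultimately show ?thesis by simp
  qed
  obtain B where B: "\<And>x. x \<in> K \<Longrightarrow> norm x \<le> B"
    using compact_imp_bounded[OF K(1)] by (auto simp: bounded_iff)
  have b0: "integral UNIV (\<lambda>x. V' x b \<bullet> b) = 0" if b: "b \<in> Basis" for b
  proof (rule integral_directional_derivative[where q = "\<lambda>x. V x \<bullet> b" and B = B and b = b])
    show "continuous_on UNIV (\<lambda>x. V x \<bullet> b)"
      using V has_derivative_continuous
      by (intro continuous_on_inner continuous_at_imp_continuous_on ballI continuous_on_const) blast+
    show "continuous_on UNIV (\<lambda>x. V' x b \<bullet> b)"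
      by (intro continuous_on_inner V'c b continuous_on_const)
    show "((\<lambda>t. V (x + t *\<^sub>R b) \<bullet> b) has_real_derivative V' (x + t *\<^sub>R b) b \<bullet> b) (at t)" for x t
    proof -
      have 1: "((\<lambda>t. x + t *\<^sub>R b) has_derivative (\<lambda>h. h *\<^sub>R b)) (at t)"
        by (auto intro!: derivative_eq_intros)
      have "((\<lambda>t. V (x + t *\<^sub>R b) \<bullet> b) has_derivative (\<lambda>h. V' (x + t *\<^sub>R b) (h *\<^sub>R b) \<bullet> b)) (at t)"
        using has_derivative_compose[OF 1 V] by (auto intro!: derivative_eq_intros)
      moreover have "V' (x + t *\<^sub>R b) (h *\<^sub>R b) = h *\<^sub>R V' (x + t *\<^sub>R b) b" for h
        using V has_derivative_linear linear_cmul by blast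
      ultimately show ?thesis by (simp add: has_field_derivative_def mult_commute_abs)
    qed
    show "V x \<bullet> b = 0" "V' x b \<bullet> b = 0" if "norm x > B" for x
    proof -
      have "x \<notin> K" using that B[of x] by auto
      then show "V x \<bullet> b = 0" "V' x b \<bullet> b = 0" by (simp_all add: V0 V'0)
    qed
  qed
  have sumc: "continuous_on UNIV (\<lambda>x. \<Sum>b\<in>Basis. V' x b \<bullet> b)"
    by (intro continuous_on_sum continuous_on_inner V'c continuous_on_const)
  have eq: "(\<Sum>b\<in>Basis. V' x b \<bullet> b) = (\<Sum>b\<in>Basis. W' x b \<bullet> b)" if "x \<in> S" for x
    using that by (simp add: V'_def)
  have "bdd_cont S (\<lambda>x. \<Sum>b\<in>Basis. V' x b \<bullet> b)"
    by (rule bdd_cont_compact_support[OF continuous_on_subset[OF sumc] K]) (simp_all add: V'0)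
  then show "bdd_cont S (\<lambda>x. \<Sum>b\<in>Basis. W' x b \<bullet> b)"
    using bdd_cont_cong[OF eq, of S "\<lambda>x. x"] by simp
  have Vi: "(\<lambda>x. V' x b \<bullet> b) integrable_on UNIV" if b: "b \<in> Basis" for b
  proof -
    have "continuous_on UNIV (\<lambda>x. V' x b \<bullet> b)"
      by (intro continuous_on_inner V'c b continuous_on_const)
    moreover have "V' x b \<bullet> b = 0" if "norm x > B" for x
    proof -
      have "x \<notin> K" using that B[of x] by auto
      then show ?thesis by (simp add: V'0)
    qed
    ultimately show ?thesis
      using integral_translation_UNIV(1)[of "\<lambda>x. V' x b \<bullet> b" B 0] by simp
  qed
  have "integral S (\<lambda>x. \<Sum>b\<in>Basis. W' x b \<bullet> b) = integral UNIV (\<lambda>x. if x \<in> S then \<Sum>b\<in>Basis. W' x b \<bullet> b else 0)"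
    by (simp add: integral_restrict_UNIV)
  also have "\<dots> = integral UNIV (\<lambda>x. \<Sum>b\<in>Basis. V' x b \<bullet> b)"
    by (rule integral_cong) (auto simp: V'_def)
  also have "\<dots> = 0"
    using b0 Vi by (subst integral_sum) auto
  finally show "integral S (\<lambda>x. \<Sum>b\<in>Basis. W' x b \<bullet> b) = 0" .
qed

section \<open>Divergence identities with a scalar weight\<close>

text \<open>The left side is the trace of a rank-one map; such maps arise from the product rule
  whenever a divergence is computed.\<close>

lemma trace_rank_one: "(\<Sum>b\<in>Basis. ((a::'a::euclidean_space) \<bullet> b) *\<^sub>R c \<bullet> b) = a \<bullet> c"
  by (subst euclidean_inner) (simp add: inner_commute)

text \<open>The form in which the divergence theorem is applied below. Compact support is asked of
  the product alone, so that the truncation may sit in the weight while \<open>V\<close> is a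
  gradient or a constant.\<close>

lemma integral_scalar_times_field:
  fixes V :: "'a::euclidean_space \<Rightarrow> 'a"
  assumes S: "open S" and K: "compact K" "K \<subseteq> S"
    and \<omega>: "\<And>x. x \<in> S \<Longrightarrow> GDERIV \<omega> x :> P x" "continuous_on S P"
    and V: "\<And>x. x \<in> S \<Longrightarrow> (V has_derivative D x) (at x)" "\<And>h. continuous_on S (\<lambda>x. D x h)"
    and supp: "\<And>x. x \<in> S - K \<Longrightarrow> \<omega> x *\<^sub>R V x = 0"
  shows "bdd_cont S (\<lambda>x. P x \<bullet> V x + \<omega> x * (\<Sum>b\<in>Basis. D x b \<bullet> b))"
    and "integral S (\<lambda>x. P x \<bullet> V x + \<omega> x * (\<Sum>b\<in>Basis. D x b \<bullet> b)) = 0"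
proof -
  define W' where "W' x h = \<omega> x *\<^sub>R D x h + (h \<bullet> P x) *\<^sub>R V x" for x h
  have \<omega>c: "continuous_on S \<omega>"
    using \<omega>(1) gderiv_continuous continuous_at_imp_continuous_on by blast
  have Vc: "continuous_on S V"
    using V(1) has_derivative_continuous continuous_at_imp_continuous_on by blast
  have der: "((\<lambda>x. \<omega> x *\<^sub>R V x) has_derivative W' x) (at x)" if "x \<in> S" for x
    unfolding W'_def
    using has_derivative_scaleR[OF \<omega>(1)[OF that, unfolded gderiv_def] V(1)[OF that]] by simp
  have cont: "continuous_on S (\<lambda>x. W' x h)" for h
    unfolding W'_def by (intro continuous_intros \<omega>c Vc \<omega>(2) V(2))
  have tr: "(\<Sum>b\<in>Basis. W' x b \<bullet> b) = P x \<bullet> V x + \<omega> x * (\<Sum>b\<in>Basis. D x b \<bullet> b)" for x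
    using trace_rank_one[of "P x" "V x"]
    by (simp add: W'_def inner_add_left sum.distrib sum_distrib_left inner_commute[of _ "P x"])
  show "bdd_cont S (\<lambda>x. P x \<bullet> V x + \<omega> x * (\<Sum>b\<in>Basis. D x b \<bullet> b))"
    "integral S (\<lambda>x. P x \<bullet> V x + \<omega> x * (\<Sum>b\<in>Basis. D x b \<bullet> b)) = 0"
    using divergence_theorem_compact_support[OF S K der cont supp] by (simp_all only: tr)
qed

text \<open>\<open>V\<close> is the row of the stress tensor of a function with gradient
  \<open>G\<close> in direction \<open>e\<close>. By symmetry of the Hessian the two mixed terms of
  its divergence cancel, leaving the Laplacian times the derivative along \<open>e\<close>: the
  localized Pohozaev identity for a translation.\<close>

lemma integral_stress_energy:
  fixes G :: "'a::euclidean_space \<Rightarrow> 'a"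
  assumes S: "open S" and K: "compact K" "K \<subseteq> S"
    and \<omega>: "\<And>x. x \<in> S \<Longrightarrow> GDERIV \<omega> x :> P x" "continuous_on S P"
    and G: "\<And>x. x \<in> S \<Longrightarrow> (G has_derivative D x) (at x)" "\<And>h. continuous_on S (\<lambda>x. D x h)"
    and sym: "\<And>x a b. x \<in> S \<Longrightarrow> D x a \<bullet> b = D x b \<bullet> a"
    and supp: "\<And>x. x \<in> S - K \<Longrightarrow> \<omega> x = 0"
  shows "bdd_cont S (\<lambda>x. (P x \<bullet> G x) * (G x \<bullet> e) - (G x \<bullet> G x) * (P x \<bullet> e) / 2
            + \<omega> x * (\<Sum>b\<in>Basis. D x b \<bullet> b) * (G x \<bullet> e))"
    and "integral S (\<lambda>x. (P x \<bullet> G x) * (G x \<bullet> e) - (G x \<bullet> G x) * (P x \<bullet> e) / 2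
            + \<omega> x * (\<Sum>b\<in>Basis. D x b \<bullet> b) * (G x \<bullet> e)) = 0"
proof -
  define V where "V x = (G x \<bullet> e) *\<^sub>R G x - (G x \<bullet> G x / 2) *\<^sub>R e" for x
  define DV where "DV x h = (G x \<bullet> e) *\<^sub>R D x h + (D x h \<bullet> e) *\<^sub>R G x - (D x h \<bullet> G x) *\<^sub>R e" for x h
  have Gc: "continuous_on S G"
    using G(1) has_derivative_continuous continuous_at_imp_continuous_on by blast
  have der: "(V has_derivative DV x) (at x)" if "x \<in> S" for x
    unfolding V_def DV_def
    by (rule has_derivative_eq_rhs, (rule derivative_intros G that)+)
       (auto simp: inner_commute algebra_simps)
  have cont: "continuous_on S (\<lambda>x. DV x h)" for h
    unfolding DV_def by (intro continuous_intros Gc G(2))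
  have tr: "(\<Sum>b\<in>Basis. DV x b \<bullet> b) = (\<Sum>b\<in>Basis. D x b \<bullet> b) * (G x \<bullet> e)" if "x \<in> S" for x
  proof -
    have "(\<Sum>b\<in>Basis. (D x b \<bullet> e) *\<^sub>R G x \<bullet> b) = D x e \<bullet> G x"
      using trace_rank_one[of "D x e" "G x"] sym[OF that] by simp
    moreover have "(\<Sum>b\<in>Basis. (D x b \<bullet> G x) *\<^sub>R e \<bullet> b) = D x e \<bullet> G x"
      using trace_rank_one[of "D x (G x)" "e"] sym[OF that] by simp
    ultimately show ?thesis
      by (simp add: DV_def inner_add_left inner_diff_left sum.distrib sum_subtractf)
         (simp add: sum_distrib_left mult.commute)
  qed
  have eq: "P x \<bullet> V x + \<omega> x * (\<Sum>b\<in>Basis. DV x b \<bullet> b) =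
      (P x \<bullet> G x) * (G x \<bullet> e) - (G x \<bullet> G x) * (P x \<bullet> e) / 2
            + \<omega> x * (\<Sum>b\<in>Basis. D x b \<bullet> b) * (G x \<bullet> e)" if "x \<in> S" for x
    by (simp add: tr[OF that] V_def inner_diff_right)
  note * = integral_scalar_times_field[OF S K \<omega> der cont]
  show "bdd_cont S (\<lambda>x. (P x \<bullet> G x) * (G x \<bullet> e) - (G x \<bullet> G x) * (P x \<bullet> e) / 2
            + \<omega> x * (\<Sum>b\<in>Basis. D x b \<bullet> b) * (G x \<bullet> e))"
    by (subst bdd_cont_cong[OF eq, symmetric]) (assumption | rule *(1) | simp add: supp)+
  show "integral S (\<lambda>x. (P x \<bullet> G x) * (G x \<bullet> e) - (G x \<bullet> G x) * (P x \<bullet> e) / 2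
            + \<omega> x * (\<Sum>b\<in>Basis. D x b \<bullet> b) * (G x \<bullet> e)) = 0"
    by (subst integral_cong[OF eq, symmetric]) (assumption | rule *(2) | simp add: supp)+
qed

section \<open>Truncation\<close>

lemma pospart_simps [simp]: "0 \<le> t \<Longrightarrow> pospart t = t" "t \<le> 0 \<Longrightarrow> pospart t = 0" "0 \<le> pospart t"
  by (auto simp: pospart_def)

lemma continuous_on_pospart [continuous_intros]:
  "continuous_on S f \<Longrightarrow> continuous_on S (\<lambda>x. pospart (f x))"
  unfolding pospart_def by (intro continuous_intros)

text \<open>The delicate point is 0: there the difference quotient is at most
  \<open>\<bar>h\<bar> powr (a - 1)\<close>, which tends to 0 because \<open>1 < a\<close>.\<close>

lemma pospart_powr_deriv:
  assumes a: "1 < a"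
  shows "((\<lambda>t. pospart t powr a) has_real_derivative a * pospart t powr (a - 1)) (at t)"
proof -
  consider "t > 0" | "t < 0" | "t = 0" by linarith
  then show ?thesis
  proof cases
    case 1
    have "((\<lambda>t. t powr a) has_real_derivative a * t powr (a - 1)) (at t)"
      using 1 by (auto intro!: derivative_eq_intros)
    then have "((\<lambda>t. pospart t powr a) has_real_derivative a * t powr (a - 1)) (at t)"
      by (rule has_field_derivative_transform_within_open[of _ _ _ "{0<..}"]) (use 1 in auto)
    then show ?thesis using 1 by simp
  next
    case 2
    have "((\<lambda>t::real. 0) has_real_derivative 0) (at t)" by simp
    then have "((\<lambda>t. pospart t powr a) has_real_derivative 0) (at t)"
      by (rule has_field_derivative_transform_within_open[of _ _ _ "{..<0}"]) (use 2 in auto)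
    then show ?thesis using 2 by simp
  next
    case 3
    have "((\<lambda>h::real. \<bar>h\<bar> powr (a - 1)) \<longlongrightarrow> 0) (at 0)"
      using a by (intro tendsto_zero_powrI[of _ _ "\<lambda>_. a - 1" "a - 1"]) (auto intro!: tendsto_eq_intros)
    then have "((\<lambda>h. (pospart (0 + h) powr a - pospart 0 powr a) / h) \<longlongrightarrow> 0) (at 0)"
    proof (rule Lim_null_comparison[rotated])
      have "norm ((pospart (0 + h) powr a - pospart 0 powr a) / h) \<le> \<bar>h\<bar> powr (a - 1)" if "h \<noteq> 0" for h
      proof (cases "h > 0")
        case False
        then have "pospart (0 + h) = 0" by simp
        then show ?thesis by (simp add: pospart_def)
      qed (simp add: powr_diff)
      then show "\<forall>\<^sub>F h in at 0. norm ((pospart (0 + h) powr a - pospart 0 powr a) / h) \<le> \<bar>h\<bar> powr (a - 1)"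
        by (auto simp: eventually_at_filter)
    qed
    then show ?thesis using 3 by (simp add: DERIV_def)
  qed
qed

lemma pospart_power_deriv:
  "((\<lambda>t. pospart t ^ Suc (Suc k)) has_real_derivative real (Suc (Suc k)) * pospart t ^ Suc k) (at t)"
proof -
  have eq: "pospart s powr real (Suc n) = pospart s ^ Suc n" for s n
    by (cases "pospart s > 0") (auto simp: powr_realpow pospart_def simp del: of_nat_Suc)
  have "((\<lambda>t. pospart t powr real (Suc (Suc k))) has_real_derivative
      real (Suc (Suc k)) * pospart t powr (real (Suc (Suc k)) - 1)) (at t)"
    by (rule pospart_powr_deriv) simp
  then show ?thesis unfolding eq using eq[of t k] by simp
qed

lemmas pospart_power_deriv' [derivative_intros] =
  pospart_power_deriv[THEN DERIV_chain2]

text \<open>The \<open>C\<^sup>1\<close> quadratic spline rising from 0 to 1 with knots 0, 1/2 and 1.\<close>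

definition step :: "real \<Rightarrow> real" where
  "step t = 2 * (pospart t ^ 2 - 2 * pospart (t - 1/2) ^ 2 + pospart (t - 1) ^ 2)"
definition step' :: "real \<Rightarrow> real" where
  "step' t = 4 * (pospart t - 2 * pospart (t - 1/2) + pospart (t - 1))"
definition stepint :: "real \<Rightarrow> real" where
  "stepint t = 2 / 3 * (pospart t ^ 3 - 2 * pospart (t - 1/2) ^ 3 + pospart (t - 1) ^ 3)"

lemma step_deriv: "(step has_real_derivative step' t) (at t)"
proof -
  have e: "(2::nat) = Suc (Suc 0)" by simp
  show ?thesis
    unfolding step_def[abs_def] step'_def e
    by (rule derivative_eq_intros refl | simp)+
qed

lemma stepint_deriv: "(stepint has_real_derivative step t) (at t)"
proof -
  have e: "(3::nat) = Suc (Suc 1)" "(2::nat) = Suc 1" by simp_all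
  show ?thesis
    unfolding stepint_def[abs_def] step_def e
    by (rule derivative_eq_intros refl | simp)+
qed

lemma step'_nonneg: "0 \<le> step' t" and step'_le: "step' t \<le> 2"
  by (simp_all add: step'_def pospart_def max_def)

lemma step'_0: "t \<le> 0 \<Longrightarrow> step' t = 0" and step'_1: "t \<ge> 1 \<Longrightarrow> step' t = 0"
  by (auto simp: step'_def)

lemma continuous_step': "continuous_on UNIV step'"
  unfolding step'_def[abs_def] by (intro continuous_intros)

lemma continuous_step: "continuous_on UNIV step"
  using step_deriv DERIV_isCont continuous_at_imp_continuous_on by blast

lemma mono_step: "s \<le> t \<Longrightarrow> step s \<le> step t"
  using DERIV_nonneg_imp_nondecreasing[of s t step] step_deriv step'_nonneg by blast

lemma step_0: "t \<le> 0 \<Longrightarrow> step t = 0"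
  by (simp add: step_def)

lemma step_1: "t \<ge> 1 \<Longrightarrow> step t = 1"
  by (simp add: step_def power2_eq_square algebra_simps)

lemma step_nonneg: "0 \<le> step t"
  using mono_step[of "min t 0" t] step_0[of "min t 0"] by simp

lemma step_le_1: "step t \<le> 1"
  using mono_step[of t "max t 1"] step_1[of "max t 1"] by simp

lemma mono_stepint: "s \<le> t \<Longrightarrow> stepint s \<le> stepint t"
  using DERIV_nonneg_imp_nondecreasing[of s t stepint] stepint_deriv step_nonneg by blast

lemma stepint_0: "t \<le> 0 \<Longrightarrow> stepint t = 0"
  by (simp add: stepint_def)

lemma stepint_nonneg: "0 \<le> stepint t"
  using mono_stepint[of "min t 0" t] stepint_0[of "min t 0"] by simp

text \<open>The spline is symmetric about the point (1/2, 1/2), so its integral over the unit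
  interval is 1/2 and \<open>stepint t = t - 1/2\<close> from 1 on.\<close>

lemma stepint_ge: "t - 1 \<le> stepint t"
proof (cases "t \<ge> 1")
  case True
  then have "stepint t = t - 1/2"
    by (simp add: stepint_def power3_eq_cube algebra_simps)
  then show ?thesis by simp
qed (use stepint_nonneg[of t] in linarith)

text \<open>\<open>trunc d\<close> is a smoothed indicator of the positive numbers that vanishes up
  to \<open>d\<close> and equals 1 from \<open>2 * d\<close> on. Composed with a function that is
  nonpositive on the frontier it has compact support in the open set. \<open>truncint d\<close> is
  the matching approximation of the positive part.\<close>

definition trunc' :: "real \<Rightarrow> real \<Rightarrow> real" where "trunc' d t = step' ((t - d) / d) / d"
definition trunc :: "real \<Rightarrow> real \<Rightarrow> real" where "trunc d t = step ((t - d) / d)"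
definition truncint :: "real \<Rightarrow> real \<Rightarrow> real" where "truncint d t = d * stepint ((t - d) / d)"

context
  fixes d :: real
  assumes d: "0 < d"
begin

lemma trunc_deriv: "(trunc d has_real_derivative trunc' d t) (at t)"
proof -
  have "((\<lambda>t. (t - d) / d) has_real_derivative 1 / d) (at t)"
    using d by (auto intro!: derivative_eq_intros)
  from DERIV_chain2[OF step_deriv this] show ?thesis
    by (simp add: trunc_def[abs_def] trunc'_def)
qed

lemma truncint_deriv: "(truncint d has_real_derivative trunc d t) (at t)"
proof -
  have "((\<lambda>t. (t - d) / d) has_real_derivative 1 / d) (at t)"
    using d by (auto intro!: derivative_eq_intros)
  from DERIV_cmult[OF DERIV_chain2[OF stepint_deriv this], of d] show ?thesis
    using d by (simp add: truncint_def[abs_def] trunc_def)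
qed

lemma trunc'_nonneg: "0 \<le> trunc' d t"
  using d step'_nonneg by (simp add: trunc'_def)

lemma trunc'_eq_0: "t \<ge> 2 * d \<Longrightarrow> trunc' d t = 0" "t \<le> d \<Longrightarrow> trunc' d t = 0"
  using d step'_1[of "(t - d) / d"] step'_0[of "(t - d) / d"] by (simp_all add: trunc'_def field_simps)

lemma trunc_0: "t \<le> d \<Longrightarrow> trunc d t = 0" and trunc_1: "t \<ge> 2 * d \<Longrightarrow> trunc d t = 1"
  using d step_1[of "(t - d) / d"] step_0[of "(t - d) / d"] by (simp_all add: trunc_def field_simps)

lemma trunc_bounds: "0 \<le> trunc d t" "trunc d t \<le> 1"
  by (simp_all add: trunc_def step_nonneg step_le_1)

lemma truncint_0: "t \<le> d \<Longrightarrow> truncint d t = 0"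
  using d by (simp add: truncint_def stepint_0 divide_nonpos_pos)

lemma truncint_nonneg: "0 \<le> truncint d t"
  using d stepint_nonneg by (simp add: truncint_def)

lemma truncint_ge: "t - 2 * d \<le> truncint d t"
proof -
  have "d * ((t - d) / d - 1) \<le> d * stepint ((t - d) / d)"
    using d stepint_ge by (intro mult_left_mono) auto
  moreover have "d * ((t - d) / d - 1) = t - 2 * d"
    using d by (simp add: field_simps)
  ultimately show ?thesis by (simp add: truncint_def)
qed

lemma continuous_trunc': "continuous_on UNIV (trunc' d)"
  unfolding trunc'_def[abs_def] using d
  by (intro continuous_intros continuous_on_compose2[OF continuous_step']) auto

lemma continuous_trunc: "continuous_on UNIV (trunc d)"
  using trunc_deriv DERIV_isCont continuous_at_imp_continuous_on by blast

lemma continuous_truncint: "continuous_on UNIV (truncint d)"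
  using truncint_deriv DERIV_isCont continuous_at_imp_continuous_on by blast

end

section \<open>Functions of class C^2 and Green's identity for truncations\<close>

lemma compact_superlevel:
  fixes w :: "'a::euclidean_space \<Rightarrow> real"
  assumes "open S" "bounded S" "continuous_on (closure S) w" "\<And>x. x \<in> frontier S \<Longrightarrow> w x < d"
  shows "compact {x\<in>closure S. d \<le> w x}" "{x\<in>closure S. d \<le> w x} \<subseteq> S"
proof -
  have "closed {x\<in>closure S. d \<le> w x}"
    using continuous_on_closed_Collect_le[OF continuous_on_const assms(3)] by simp
  then have "compact (closure S \<inter> {x\<in>closure S. d \<le> w x})"
    using assms(2) by (intro compact_Int_closed) (simp add: compact_closure)
  then show "compact {x\<in>closure S. d \<le> w x}"
    by (simp add: Int_def)
  show "{x\<in>closure S. d \<le> w x} \<subseteq> S"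
    using assms(1,4) by (force simp: frontier_def interior_open)
qed

lemma bdd_cont_closure:
  fixes w :: "'a::euclidean_space \<Rightarrow> real"
  assumes "bounded S" "continuous_on (closure S) w"
  shows "bdd_cont S w"
proof -
  have "bounded (w ` closure S)"
    using assms by (intro compact_imp_bounded compact_continuous_image) (auto simp: compact_closure)
  then have "bounded (w ` S)"
    by (rule bounded_subset) (use closure_subset in blast)
  then show ?thesis
    unfolding bdd_cont_def using assms(2) closure_subset continuous_on_subset by blast
qed

text \<open>Gradient and Hessian are parameters, so that explicit radial functions and solutions of
  the equation fall under the same lemmas. \<open>D x\<close> is the Hessian as a linear map and
  \<open>lap\<close> its trace.\<close>

locale C2_fun =
  fixes S :: "'a::euclidean_space set" and w :: "'a \<Rightarrow> real" and G :: "'a \<Rightarrow> 'a" and D :: "'a \<Rightarrow> 'a \<Rightarrow> 'a"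
  assumes grad: "\<And>x. x \<in> S \<Longrightarrow> GDERIV w x :> G x"
    and hess: "\<And>x. x \<in> S \<Longrightarrow> (G has_derivative D x) (at x)"
    and hess_cont: "\<And>h. continuous_on S (\<lambda>x. D x h)"
begin

definition lap :: "'a \<Rightarrow> real" where "lap x = (\<Sum>b\<in>Basis. D x b \<bullet> b)"

lemma continuous_grad: "continuous_on S G"
  using hess has_derivative_continuous continuous_at_imp_continuous_on by blast

lemma continuous: "continuous_on S w"
  using grad gderiv_continuous continuous_at_imp_continuous_on by blast

lemma continuous_lap: "continuous_on S lap"
  unfolding lap_def[abs_def] by (intro continuous_intros hess_cont)

end

lemma C2_fun_minus: "C2_fun S w G D \<Longrightarrow> C2_fun S (\<lambda>x. - w x) (\<lambda>x. - G x) (\<lambda>x h. - D x h)"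
  unfolding C2_fun_def by (auto intro!: GDERIV_minus derivative_intros continuous_intros)

lemma GDERIV_comp: "GDERIV f x :> df \<Longrightarrow> (g has_real_derivative dg) (at (f x)) \<Longrightarrow> dg *\<^sub>R df = d \<Longrightarrow> GDERIV (\<lambda>x. g (f x)) x :> d"
  using GDERIV_DERIV_compose by blast

text \<open>This is Green's second identity for \<open>truncint d\<close> composed with
  \<open>w\<close> and \<psi>: the Laplacian of that composition is
  \<open>trunc' d (w x) * (G x \<bullet> G x) + trunc d (w x) * lap x\<close>. The boundary terms
  are absent because the composition has compact support.\<close>

lemma truncated_energy_identity:
  fixes w :: "'a::euclidean_space \<Rightarrow> real"
  assumes S: "open S" "bounded S" and d: "0 < d"
    and w: "C2_fun S w G D" "continuous_on (closure S) w" "\<And>x. x \<in> frontier S \<Longrightarrow> w x \<le> 0"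
    and \<psi>: "C2_fun S \<psi> P DP"
  shows "bdd_cont S (\<lambda>x. trunc' d (w x) * \<psi> x * (G x \<bullet> G x))" (is "bdd_cont S ?A")
    and "bdd_cont S (\<lambda>x. trunc d (w x) * \<psi> x * - C2_fun.lap D x)" (is "bdd_cont S ?B")
    and "bdd_cont S (\<lambda>x. truncint d (w x) * C2_fun.lap DP x)" (is "bdd_cont S ?C")
    and "integral S (\<lambda>x. trunc' d (w x) * \<psi> x * (G x \<bullet> G x)) =
      integral S (\<lambda>x. trunc d (w x) * \<psi> x * - C2_fun.lap D x)
      + integral S (\<lambda>x. truncint d (w x) * C2_fun.lap DP x)"
proof -
  interpret w: C2_fun S w G D by fact
  interpret \<psi>: C2_fun S \<psi> P DP by fact
  define K where "K = {x\<in>closure S. d \<le> w x}"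
  have K: "compact K" "K \<subseteq> S"
    using compact_superlevel[OF S w(2), of d] w(3) d by (fastforce simp: K_def)+
  have off: "w x \<le> d" if "x \<in> S - K" for x
    using that closure_subset by (force simp: K_def)
  note cc = continuous_on_compose2[OF continuous_trunc[OF d] w.continuous]
    continuous_on_compose2[OF continuous_trunc'[OF d] w.continuous]
    continuous_on_compose2[OF continuous_truncint[OF d] w.continuous]
    w.continuous \<psi>.continuous w.continuous_grad \<psi>.continuous_grad w.continuous_lap \<psi>.continuous_lap
  note bc = bdd_cont_compact_support[OF _ K]
  note off0 = trunc_0[OF d off] trunc'_eq_0(2)[OF d off] truncint_0[OF d off]
  show A: "bdd_cont S ?A"
    by (rule bc) (auto intro!: continuous_intros cc simp: off0)
  show B: "bdd_cont S ?B"
    by (rule bc) (auto intro!: continuous_intros cc simp: off0)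
  show C: "bdd_cont S ?C"
    by (rule bc) (auto intro!: continuous_intros cc simp: off0)
  \<comment> \<open>The cross term shared by the identities for
    \<open>trunc d (w x) * \<psi> x\<close> times \<open>G\<close> and for
    \<open>truncint d (w x)\<close> times \<open>P\<close>; it cancels in their difference.\<close>
  define E where "E x = trunc d (w x) * (P x \<bullet> G x)" for x
  have E: "bdd_cont S E"
    unfolding E_def by (rule bc) (auto intro!: continuous_intros cc simp: off0)
  note int = bdd_cont_integrable[OF _ S]
  have 1: "integral S (\<lambda>x. (trunc d (w x) *\<^sub>R P x + \<psi> x *\<^sub>R (trunc' d (w x) *\<^sub>R G x)) \<bullet> G x
      + (trunc d (w x) * \<psi> x) * (\<Sum>b\<in>Basis. D x b \<bullet> b)) = 0"
    by (rule integral_scalar_times_field(2)[OF S(1) K _ _ w.hess w.hess_cont])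
       (auto intro!: GDERIV_subst[OF GDERIV_mult[OF GDERIV_comp[OF w.grad trunc_deriv[OF d] refl] \<psi>.grad]]
         continuous_intros cc simp: off0)
  have 2: "integral S (\<lambda>x. (trunc d (w x) *\<^sub>R G x) \<bullet> P x + truncint d (w x) * (\<Sum>b\<in>Basis. DP x b \<bullet> b)) = 0"
    by (rule integral_scalar_times_field(2)[OF S(1) K _ _ \<psi>.hess \<psi>.hess_cont])
       (auto intro!: GDERIV_comp[OF w.grad truncint_deriv[OF d]] continuous_intros cc simp: off0)
  have "integral S (\<lambda>x. ?A x - ?B x + E x) = 0"
    by (rule trans[OF integral_cong 1]) (simp add: E_def w.lap_def algebra_simps)
  moreover have "integral S (\<lambda>x. ?A x - ?B x + E x) = integral S ?A - integral S ?B + integral S E"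
    by (subst integral_add[OF int[OF bdd_cont_diff[OF A B]] int[OF E]],
        subst integral_diff[OF int[OF A] int[OF B]]) (rule refl)
  moreover have "integral S (\<lambda>x. ?C x + E x) = 0"
    by (rule trans[OF integral_cong 2]) (simp add: E_def \<psi>.lap_def algebra_simps inner_commute)
  moreover have "integral S (\<lambda>x. ?C x + E x) = integral S ?C + integral S E"
    using C E by (simp add: integral_add int)
  ultimately show "integral S ?A = integral S ?B + integral S ?C" by linarith
qed

section \<open>The Newtonian potential\<close>

lemma integral_const_ball: "integral (ball (a::'a::euclidean_space) r) (\<lambda>x. c::real) = c * measure lborel (ball a r)"
proof -
  have "((\<lambda>x. 1::real) has_integral measure lborel (ball a r)) (ball a r)"
    using has_integral_measure_lborel[of "ball a r"] emeasure_bounded_finite[of "ball a r"] by simp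
  from has_integral_mult_right[OF this, of c] show ?thesis by (simp add: integral_unique)
qed

lemma integral_ge_ball:
  fixes g :: "'a::euclidean_space \<Rightarrow> real"
  assumes "bdd_cont S g" "open S" "bounded S" "\<And>x. x \<in> S \<Longrightarrow> 0 \<le> g x"
    and "ball a r \<subseteq> S" "\<And>x. x \<in> ball a r \<Longrightarrow> c \<le> g x"
  shows "c * measure lborel (ball a r) \<le> integral S g"
proof -
  have "c * measure lborel (ball a r) = integral (ball a r) (\<lambda>x. c)"
    by (simp add: integral_const_ball)
  also have "\<dots> \<le> integral (ball a r) g"
    by (intro integral_le integrable_on_const bdd_cont_integrable[OF bdd_cont_subset[OF assms(1)]])
       (use assms in auto)
  also have "\<dots> \<le> integral S g"
    by (intro integral_subset_le bdd_cont_integrable[OF bdd_cont_subset[OF assms(1)]])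
       (use assms in auto)
  finally show ?thesis .
qed

lemma measure_ball_power:
  fixes a :: "'a::euclidean_space"
  assumes "0 \<le> r"
  shows "measure lborel (ball a r) = r ^ DIM('a) * measure lborel (ball (0::'a) 1)"
  using content_ball_conv_unit_ball[OF assms, of a] by simp

lemma integral_le_ball:
  fixes g :: "'a::euclidean_space \<Rightarrow> real"
  assumes "bdd_cont S g" "open S" "bounded S" "0 \<le> r" "0 \<le> c"
    and "\<And>x. x \<in> S \<Longrightarrow> x \<notin> ball a r \<Longrightarrow> g x \<le> 0" "\<And>x. x \<in> S \<Longrightarrow> x \<in> ball a r \<Longrightarrow> g x \<le> c"
  shows "integral S g \<le> c * (r ^ DIM('a) * measure lborel (ball (0::'a) 1))"
proof -
  have ci: "(\<lambda>x. c) integrable_on (ball a r \<inter> S)"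
    using assms(3) by (intro integrable_on_const bounded_set_imp_lmeasurable) (use assms(2) in \<open>auto intro: bounded_Int\<close>)
  have "integral S g \<le> integral S (\<lambda>x. if x \<in> ball a r then c else 0)"
    by (intro integral_le bdd_cont_integrable[OF assms(1-3)] integrable_restrict_Int[THEN iffD2, OF ci])
       (use assms(6,7) in auto)
  also have "\<dots> = integral (ball a r \<inter> S) (\<lambda>x. c)"
    by (rule integral_restrict_Int)
  also have "\<dots> \<le> integral (ball a r) (\<lambda>x. c)"
    by (rule integral_subset_le[OF _ ci]) (use assms(5) in \<open>auto intro: integrable_on_const\<close>)
  also have "\<dots> = c * (r ^ DIM('a) * measure lborel (ball (0::'a) 1))"
    by (simp add: integral_const_ball measure_ball_power[OF assms(4)])
  finally show ?thesis .
qed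

section \<open>Radial functions, the regularized kernel and cutoffs\<close>

text \<open>Radial functions are written as functions of the squared distance, so that the centre is
  no special point; the factors 2 and 4 here and in \<open>radial_hess\<close> come from the chain
  rule.\<close>

definition radial_grad :: "(real \<Rightarrow> real) \<Rightarrow> 'a::real_inner \<Rightarrow> 'a \<Rightarrow> 'a" where
  "radial_grad g' a x = (2 * g' ((x - a) \<bullet> (x - a))) *\<^sub>R (x - a)"

definition radial_hess :: "(real \<Rightarrow> real) \<Rightarrow> (real \<Rightarrow> real) \<Rightarrow> 'a::real_inner \<Rightarrow> 'a \<Rightarrow> 'a \<Rightarrow> 'a" where
  "radial_hess g' g'' a x h = (2 * g' ((x - a) \<bullet> (x - a))) *\<^sub>R h
     + (4 * g'' ((x - a) \<bullet> (x - a)) * ((x - a) \<bullet> h)) *\<^sub>R (x - a)"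

lemma GDERIV_sqdist: "GDERIV (\<lambda>x. (x - a) \<bullet> (x - a)) x :> 2 *\<^sub>R (x - a)"
  unfolding gderiv_def by (auto intro!: derivative_eq_intros simp: inner_commute algebra_simps)

lemma GDERIV_radial:
  assumes "(g has_real_derivative g' ((x - a) \<bullet> (x - a))) (at ((x - a) \<bullet> (x - a)))"
  shows "GDERIV (\<lambda>x. g ((x - a) \<bullet> (x - a))) x :> radial_grad g' a x"
  by (rule GDERIV_comp[OF GDERIV_sqdist assms]) (simp add: radial_grad_def)

lemma C2_fun_radial:
  fixes a :: "'a::euclidean_space" and g g' g'' :: "real \<Rightarrow> real"
  assumes g: "\<And>t. 0 \<le> t \<Longrightarrow> (g has_real_derivative g' t) (at t)"
    "\<And>t. 0 \<le> t \<Longrightarrow> (g' has_real_derivative g'' t) (at t)" "continuous_on {0..} g''"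
  shows "C2_fun S (\<lambda>x. g ((x - a) \<bullet> (x - a))) (radial_grad g' a) (radial_hess g' g'' a)"
    and "C2_fun.lap (radial_hess g' g'' a) x
      = 2 * real DIM('a) * g' ((x - a) \<bullet> (x - a)) + 4 * ((x - a) \<bullet> (x - a)) * g'' ((x - a) \<bullet> (x - a))"
proof -
  have g'c: "continuous_on {0..} g'"
    using g(2) DERIV_isCont continuous_at_imp_continuous_on by (metis atLeast_iff)
  show C2: "C2_fun S (\<lambda>x. g ((x - a) \<bullet> (x - a))) (radial_grad g' a) (radial_hess g' g'' a)"
  proof
    show "GDERIV (\<lambda>x. g ((x - a) \<bullet> (x - a))) x :> radial_grad g' a x" for x
      by (rule GDERIV_radial) (simp add: g(1))
    show "(radial_grad g' a has_derivative radial_hess g' g'' a x) (at x)" for x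
    proof -
      have "GDERIV (\<lambda>x. g' ((x - a) \<bullet> (x - a))) x :> (2 * g'' ((x - a) \<bullet> (x - a))) *\<^sub>R (x - a)"
        by (rule GDERIV_comp[OF GDERIV_sqdist g(2)]) auto
      then show ?thesis
        unfolding radial_grad_def[abs_def] radial_hess_def gderiv_def
        by (auto intro!: derivative_eq_intros simp: inner_commute algebra_simps)
    qed
    show "continuous_on S (\<lambda>x. radial_hess g' g'' a x h)" for h
      unfolding radial_hess_def
      by (intro continuous_intros continuous_on_compose2[OF g(3)] continuous_on_compose2[OF g'c]) auto
  qed
  interpret C2_fun S "\<lambda>x. g ((x - a) \<bullet> (x - a))" "radial_grad g' a" "radial_hess g' g'' a" by fact
  have "(\<Sum>b\<in>Basis. ((x - a) \<bullet> b) *\<^sub>R (x - a) \<bullet> b) = (x - a) \<bullet> (x - a)"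
    by (rule trace_rank_one)
  then show "lap x = 2 * real DIM('a) * g' ((x - a) \<bullet> (x - a))
      + 4 * ((x - a) \<bullet> (x - a)) * g'' ((x - a) \<bullet> (x - a))"
    by (simp add: lap_def radial_hess_def inner_add_left sum.distrib mult.assoc flip: sum_distrib_left)
qed

text \<open>The Newtonian kernel, regularized at scale \<open>s\<close> so that it is smooth at its pole; it stays superharmonic.\<close>

definition newton_exp :: "'a::euclidean_space itself \<Rightarrow> real" where
  "newton_exp _ = (real DIM('a) - 2) / 2"

definition newton :: "real \<Rightarrow> 'a::euclidean_space \<Rightarrow> 'a \<Rightarrow> real" where
  "newton s a x = ((x - a) \<bullet> (x - a) + s\<^sup>2) powr - newton_exp TYPE('a)"

definition newton_grad :: "real \<Rightarrow> 'a::euclidean_space \<Rightarrow> 'a \<Rightarrow> 'a" where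
  "newton_grad s = radial_grad (\<lambda>t. - newton_exp TYPE('a) * (t + s\<^sup>2) powr (- newton_exp TYPE('a) - 1))"

definition newton_hess :: "real \<Rightarrow> 'a::euclidean_space \<Rightarrow> 'a \<Rightarrow> 'a \<Rightarrow> 'a" where
  "newton_hess s = radial_hess (\<lambda>t. - newton_exp TYPE('a) * (t + s\<^sup>2) powr (- newton_exp TYPE('a) - 1))
    (\<lambda>t. newton_exp TYPE('a) * (newton_exp TYPE('a) + 1) * (t + s\<^sup>2) powr (- newton_exp TYPE('a) - 2))"

text \<open>Because the dimension is \<open>2 * k + 2\<close>, all terms of the Laplacian without
  \<open>s\<close> cancel. The remainder is an approximate point mass, concentrated at scale
  \<open>s\<close> and of total size independent of \<open>s\<close>.\<close>

lemma newton_C2: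
  fixes a :: "'a::euclidean_space" and s k :: real
  assumes s: "0 < s"
  defines "k \<equiv> newton_exp TYPE('a)"
  shows "C2_fun S (newton s a) (newton_grad s a) (newton_hess s a)"
    and "newton_grad s a x \<bullet> (x - a)
      = - 2 * k * ((x - a) \<bullet> (x - a)) * ((x - a) \<bullet> (x - a) + s\<^sup>2) powr (- k - 1)"
    and "C2_fun.lap (newton_hess s a) x
      = - 2 * real DIM('a) * k * s\<^sup>2 * ((x - a) \<bullet> (x - a) + s\<^sup>2) powr (- k - 2)"
proof -
  let ?g = "\<lambda>t. (t + s\<^sup>2) powr - k" and ?g' = "\<lambda>t. - k * (t + s\<^sup>2) powr (- k - 1)"
    and ?g'' = "\<lambda>t. k * (k + 1) * (t + s\<^sup>2) powr (- k - 2)"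
  have pos: "t + s\<^sup>2 > 0" if "0 \<le> t" for t using s that by (simp add: add_nonneg_pos)
  have d1: "(?g has_real_derivative ?g' t) (at t)" if "0 \<le> t" for t
    using pos[OF that] by (auto intro!: derivative_eq_intros)
  have d2: "(?g' has_real_derivative ?g'' t) (at t)" if "0 \<le> t" for t
  proof -
    have "- k - 1 - 1 = - k - 2" by simp
    then show ?thesis
      using pos[OF that] by (auto intro!: derivative_eq_intros simp: algebra_simps)
  qed
  have c: "continuous_on {0..} ?g''"
    by (intro continuous_intros) (metis atLeast_iff less_irrefl pos)
  note C = C2_fun_radial[OF d1 d2 c, where a = a]
  show "C2_fun S (newton s a) (newton_grad s a) (newton_hess s a)"
    unfolding newton_def[abs_def] newton_grad_def newton_hess_def k_def[symmetric] by (rule C(1))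
  show "newton_grad s a x \<bullet> (x - a) =
      - 2 * k * ((x - a) \<bullet> (x - a)) * ((x - a) \<bullet> (x - a) + s\<^sup>2) powr (- k - 1)"
    by (simp add: newton_grad_def radial_grad_def k_def)
  show "C2_fun.lap (newton_hess s a) x =
      - 2 * real DIM('a) * k * s\<^sup>2 * ((x - a) \<bullet> (x - a) + s\<^sup>2) powr (- k - 2)"
  proof -
    define t where "t = (x - a) \<bullet> (x - a)"
    have t: "0 \<le> t" by (simp add: t_def)
    have aux: "2 * (2 * k + 2) * (- k * (E * (t + q))) + 4 * t * (k * (k + 1) * E)
        = - 2 * (2 * k + 2) * k * q * E" for E q :: real
      by (simp add: algebra_simps)
    have "- k - 1 = - k - 2 + 1" by simp
    then have e: "(t + s\<^sup>2) powr (- k - 1) = (t + s\<^sup>2) powr (- k - 2) * (t + s\<^sup>2)"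
      using pos[OF t] by (simp only: powr_add) simp
    have N: "real DIM('a) = 2 * k + 2" 
      unfolding k_def newton_exp_def by (simp add: field_simps)
    show ?thesis
      by (unfold newton_hess_def k_def[symmetric], rule trans[OF C(2)], unfold t_def[symmetric] e N) (assumption | rule aux)+
  qed
qed

lemma newton_pos: "0 < s \<Longrightarrow> 0 < newton s a x"
  using add_nonneg_pos[of "(x - a) \<bullet> (x - a)" "s\<^sup>2"] unfolding newton_def by (simp add: less_imp_neq[symmetric])

lemma powr_newton_exp:
  assumes "0 < r" "2 < DIM('a::euclidean_space)"
  shows "(r\<^sup>2) powr - newton_exp TYPE('a) = 1 / r ^ (DIM('a) - 2)"
proof -
  have "r\<^sup>2 = r powr 2" using assms by simp
  then have "(r\<^sup>2) powr - newton_exp TYPE('a) = r powr (2 * - newton_exp TYPE('a))"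
    by (simp only: powr_powr)
  also have "2 * - newton_exp TYPE('a) = - real (DIM('a) - 2)"
    using assms by (simp add: newton_exp_def of_nat_diff field_simps)
  also have "r powr \<dots> = 1 / r ^ (DIM('a) - 2)"
    using assms(1) by (simp only: powr_minus powr_realpow inverse_eq_divide)
  finally show ?thesis .
qed

lemma newton_le:
  fixes a x :: "'a::euclidean_space"
  assumes "0 < r" "r \<le> dist x a" "2 < DIM('a)"
  shows "newton s a x \<le> 1 / r ^ (DIM('a) - 2)"
proof -
  have "r\<^sup>2 \<le> (x - a) \<bullet> (x - a)"
    using assms by (simp add: dot_square_norm dist_norm power_mono)
  then have "r\<^sup>2 \<le> (x - a) \<bullet> (x - a) + s\<^sup>2" by (simp add: add_increasing2)
  then have "newton s a x \<le> (r\<^sup>2) powr - newton_exp TYPE('a)"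
    unfolding newton_def using assms by (intro powr_mono2') (auto simp: newton_exp_def)
  then show ?thesis using powr_newton_exp[OF assms(1,3)] by simp
qed

lemma power_split_sq: "2 < n \<Longrightarrow> (r::real) ^ n = r ^ (n - 2) * r\<^sup>2"
  by (metis less_imp_le_nat le_add_diff_inverse2 power_add)

lemma norm_radial_grad: "norm (radial_grad g' a x) = 2 * \<bar>g' ((x - a) \<bullet> (x - a))\<bar> * dist x a"
  by (simp add: radial_grad_def dist_norm abs_mult)

lemma sqdist: "(x - a) \<bullet> (x - a) = (dist x a)\<^sup>2"
  by (simp add: dot_square_norm dist_norm)

text \<open>The argument of \<open>step\<close> runs from 0 at distance \<open>r\<close> to 1 at
  distance \<open>2 * r\<close>; the divisor 3 is 4 - 1.\<close>

definition cutoff :: "real \<Rightarrow> 'a::euclidean_space \<Rightarrow> 'a \<Rightarrow> real" where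
  "cutoff r a x = 1 - step (((x - a) \<bullet> (x - a) / r\<^sup>2 - 1) / 3)"

definition cutoff_grad :: "real \<Rightarrow> 'a::euclidean_space \<Rightarrow> 'a \<Rightarrow> 'a" where
  "cutoff_grad r = radial_grad (\<lambda>t. - step' ((t / r\<^sup>2 - 1) / 3) / (3 * r\<^sup>2))"

lemma cutoff:
  fixes a :: "'a::euclidean_space"
  assumes r: "0 < r"
  shows "GDERIV (cutoff r a) x :> cutoff_grad r a x" and "continuous_on UNIV (cutoff_grad r a)"
    and "0 \<le> cutoff r a x"
    and "dist x a \<le> r \<Longrightarrow> cutoff r a x = 1 \<and> cutoff_grad r a x = 0"
    and "2 * r \<le> dist x a \<Longrightarrow> cutoff r a x = 0 \<and> cutoff_grad r a x = 0"
    and "norm (cutoff_grad r a x) \<le> 3 / r"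
proof -
  let ?h = "\<lambda>t. (t / r\<^sup>2 - 1) / 3"
  have d: "((\<lambda>t. 1 - step (?h t)) has_real_derivative - step' (?h t) / (3 * r\<^sup>2)) (at t)" for t
  proof -
    have "(?h has_real_derivative 1 / (3 * r\<^sup>2)) (at t)"
      using r by (auto intro!: derivative_eq_intros simp: power2_eq_square)
    from DERIV_diff[OF DERIV_const[of 1] DERIV_chain2[OF step_deriv this]] show ?thesis by simp
  qed
  show "GDERIV (cutoff r a) x :> cutoff_grad r a x"
    unfolding cutoff_def[abs_def] cutoff_grad_def by (rule GDERIV_radial) (rule d)
  have c: "continuous_on UNIV (\<lambda>t. - step' (?h t) / (3 * r\<^sup>2))"
    using r by (intro continuous_intros continuous_on_compose2[OF continuous_step']) auto
  show "continuous_on UNIV (cutoff_grad r a)"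
    unfolding cutoff_grad_def radial_grad_def[abs_def]
    by (intro continuous_intros continuous_on_compose2[OF c]) auto
  show "0 \<le> cutoff r a x" by (simp add: cutoff_def step_le_1)
  show in1: "cutoff r a x = 1 \<and> cutoff_grad r a x = 0" if "dist x a \<le> r"
  proof -
    have "(dist x a)\<^sup>2 \<le> r\<^sup>2" using that by (intro power_mono) auto
    then have "?h ((x - a) \<bullet> (x - a)) \<le> 0" using r by (simp add: sqdist)
    then show ?thesis by (simp add: cutoff_def cutoff_grad_def radial_grad_def step_0 step'_0)
  qed
  show out: "cutoff r a x = 0 \<and> cutoff_grad r a x = 0" if "2 * r \<le> dist x a"
  proof -
    have "(2 * r)\<^sup>2 \<le> (dist x a)\<^sup>2" using that r by (intro power_mono) auto
    then have "1 \<le> ?h ((x - a) \<bullet> (x - a))" using r by (simp add: sqdist power_mult_distrib field_simps)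
    then show ?thesis by (simp add: cutoff_def cutoff_grad_def radial_grad_def step_1 step'_1)
  qed
  show "norm (cutoff_grad r a x) \<le> 3 / r"
  proof (cases "2 * r \<le> dist x a")
    case False
    have "norm (cutoff_grad r a x) = 2 * (step' (?h ((x - a) \<bullet> (x - a))) / (3 * r\<^sup>2)) * dist x a"
      using step'_nonneg by (simp add: cutoff_grad_def norm_radial_grad)
    \<comment> \<open>This product equals 8 / (3 r), which is then rounded up to 3 / r.\<close>
    also have "\<dots> \<le> 2 * (2 / (3 * r\<^sup>2)) * (2 * r)"
      using False r step'_le step'_nonneg by (intro mult_mono divide_right_mono) auto
    also have "\<dots> \<le> 3 / r" using r by (simp add: field_simps power2_eq_square)
    finally show ?thesis .
  qed (use out r in simp)
qed

text \<open>Integrate the divergence of \<open>(x - a) \<Gamma>\<close>, which dominates \<open>2 \<Gamma>\<close>, against a cutoff.\<close>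

lemma newton_integral_ball:
  fixes a :: "'a::euclidean_space"
  assumes N: "2 < DIM('a)" and s: "0 < s" and r: "0 < r"
  shows "integral (ball a r) (newton s a) \<le> 3 ^ Suc DIM('a) * measure lborel (ball (0::'a) 1) * r\<^sup>2"
proof -
  define k where "k = newton_exp TYPE('a)"
  have Nk: "real DIM('a) = 2 * k + 2" unfolding k_def newton_exp_def by (simp add: field_simps)
  have k0: "0 \<le> k" using N by (simp add: k_def newton_exp_def)
  define S where "S = ball a (3 * r)"
  have S: "open S" "bounded S" by (auto simp: S_def)
  define P where "P = newton_grad s a"
  have C2: "C2_fun S (newton s a) P (newton_hess s a)"
    and P: "P x \<bullet> (x - a) = - 2 * k * ((x - a) \<bullet> (x - a)) * ((x - a) \<bullet> (x - a) + s\<^sup>2) powr (- k - 1)" for x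
    unfolding P_def k_def using newton_C2[OF s] by auto
  interpret C2_fun S "newton s a" P "newton_hess s a" by fact
  let ?q = "\<lambda>x. (x - a) \<bullet> (x - a)"
  define \<omega> where "\<omega> = cutoff r a"
  note ct = cutoff[OF r, where a = a, folded \<omega>_def]
  have \<omega>c: "continuous_on T (cutoff_grad r a)" for T
    using ct(2) continuous_on_subset by blast
  define DV where "DV x h = newton s a x *\<^sub>R h + (h \<bullet> P x) *\<^sub>R (x - a)" for x h
  have DV: "((\<lambda>x. newton s a x *\<^sub>R (x - a)) has_derivative DV x) (at x)" if "x \<in> S" for x
    unfolding DV_def using grad[OF that] unfolding gderiv_def
    by (auto intro!: derivative_eq_intros)
  have DVc: "continuous_on S (\<lambda>x. DV x h)" for h
    unfolding DV_def by (intro continuous_intros continuous continuous_grad)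
  \<comment> \<open>The divergence is N times the kernel plus its radial derivative term, which is
    at least -(N - 2) times the kernel.\<close>
  have trDV: "(\<Sum>b\<in>Basis. DV x b \<bullet> b) \<ge> 2 * newton s a x" for x
  proof -
    have "(\<Sum>b\<in>Basis. (b \<bullet> P x) *\<^sub>R (x - a) \<bullet> b) = P x \<bullet> (x - a)"
      using trace_rank_one[of "P x" "x - a"] by (simp add: inner_commute)
    then have tr: "(\<Sum>b\<in>Basis. DV x b \<bullet> b) = newton s a x * DIM('a) + P x \<bullet> (x - a)"
      by (simp add: DV_def inner_add_left sum.distrib)
    have "?q x * (?q x + s\<^sup>2) powr (- k - 1) \<le> (?q x + s\<^sup>2) * (?q x + s\<^sup>2) powr (- k - 1)"
      by (intro mult_right_mono) auto
    also have "\<dots> = newton s a x"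
    proof -
      have "0 < ?q x + s\<^sup>2" using s by (simp add: add_nonneg_pos)
      then have "(?q x + s\<^sup>2) powr (1 + (- k - 1)) = (?q x + s\<^sup>2) * (?q x + s\<^sup>2) powr (- k - 1)"
        by (subst powr_add) simp
      then show ?thesis by (simp add: newton_def k_def)
    qed
    finally have "2 * k * (?q x * (?q x + s\<^sup>2) powr (- k - 1)) \<le> 2 * k * newton s a x"
      using k0 by (intro mult_left_mono) auto
    moreover have "P x \<bullet> (x - a) = - (2 * k * (?q x * (?q x + s\<^sup>2) powr (- k - 1)))"
      unfolding P by (simp only: mult_minus_left mult.assoc)
    moreover have "newton s a x * DIM('a) = 2 * k * newton s a x + 2 * newton s a x"
      unfolding Nk by (simp only: distrib_left mult_ac)
    ultimately show ?thesis unfolding tr by linarith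
  qed
  have supp: "\<omega> x *\<^sub>R (newton s a x *\<^sub>R (x - a)) = 0" if "x \<in> S - cball a (2 * r)" for x
    using that ct(5)[of x] by (simp add: dist_commute)
  have id: "bdd_cont S (\<lambda>x. cutoff_grad r a x \<bullet> (newton s a x *\<^sub>R (x - a)) + \<omega> x * (\<Sum>b\<in>Basis. DV x b \<bullet> b))"
    "integral S (\<lambda>x. cutoff_grad r a x \<bullet> (newton s a x *\<^sub>R (x - a)) + \<omega> x * (\<Sum>b\<in>Basis. DV x b \<bullet> b)) = 0"
    by (rule integral_scalar_times_field[OF S(1) compact_cball _ ct(1) \<omega>c DV DVc supp]; use r in \<open>auto simp: S_def\<close>)+
  have nc: "bdd_cont S (newton s a)"
  proof -
    have "continuous_on UNIV (newton s a)"
      by (rule C2_fun.continuous[OF newton_C2(1)[OF s]])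
    then show ?thesis using S(2) by (rule bdd_cont_continuous_UNIV)
  qed
  have \<omega>b: "bdd_cont S (\<lambda>x. \<omega> x)"
    by (rule bdd_cont_continuous_UNIV[OF _ S(2)])
       (intro continuous_at_imp_continuous_on ballI gderiv_continuous[OF ct(1)])
  define M where "M = 1 / r ^ (DIM('a) - 2)"
  have M0: "0 \<le> M" using r by (simp add: M_def)
  \<comment> \<open>The gradient of the cutoff lives where the distance lies between
    \<open>r\<close> and \<open>2 * r\<close>. There the boundary term is at most (3 / r) M (2 r) =
    6 M.\<close>
  have pt: "2 * (\<omega> x * newton s a x) - 6 * M
      \<le> cutoff_grad r a x \<bullet> (newton s a x *\<^sub>R (x - a)) + \<omega> x * (\<Sum>b\<in>Basis. DV x b \<bullet> b)" if "x \<in> S" for x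
  proof -
    have 1: "2 * (\<omega> x * newton s a x) \<le> \<omega> x * (\<Sum>b\<in>Basis. DV x b \<bullet> b)"
      using mult_left_mono[OF trDV ct(3), of x x] by (simp add: mult_ac)
    have "\<bar>cutoff_grad r a x \<bullet> (newton s a x *\<^sub>R (x - a))\<bar> \<le> 6 * M"
    proof (cases "r \<le> dist x a \<and> dist x a \<le> 2 * r")
      case True
      have "newton s a x \<le> M" unfolding M_def using True by (intro newton_le[OF r _ N]) simp
      then have "newton s a x * dist x a \<le> M * (2 * r)" using True M0 by (intro mult_mono) auto
      then have "norm (cutoff_grad r a x) * (newton s a x * dist x a) \<le> 3 / r * (M * (2 * r))"
        by (rule mult_mono[OF ct(6)]) (use r newton_pos[OF s, of a x] in auto)
      also have "\<dots> = 6 * M" using r by simp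
      finally show ?thesis
        using Cauchy_Schwarz_ineq2[of "cutoff_grad r a x" "newton s a x *\<^sub>R (x - a)"] newton_pos[OF s, of a x]
        by (simp add: dist_norm)
    next
      case False
      then have "cutoff_grad r a x = 0" using ct(4,5)[of x] by (meson linear)
      then show ?thesis using M0 by simp
    qed
    then show ?thesis using 1 by linarith
  qed
  note int = bdd_cont_integrable[OF _ S]
  have "integral S (\<lambda>x. 2 * (\<omega> x * newton s a x) - 6 * M) \<le> 0"
  proof -
    have "bdd_cont S (\<lambda>x. 2 * (\<omega> x * newton s a x) - 6 * M)"
      by (intro bdd_cont_intros nc \<omega>b)
    then show ?thesis using integral_le[OF int int, OF _ id(1) pt] id(2) by simp
  qed
  moreover have "integral S (\<lambda>x. 2 * (\<omega> x * newton s a x) - 6 * M)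
      = 2 * integral S (\<lambda>x. \<omega> x * newton s a x) - integral S (\<lambda>x. 6 * M)"
    by (subst integral_diff) (intro int bdd_cont_intros nc \<omega>b | simp)+
  moreover have "integral S (\<lambda>x. 6 * M) = 6 * M * ((3 * r) ^ DIM('a) * measure lborel (ball (0::'a) 1))"
    unfolding S_def integral_const_ball using r by (subst measure_ball_power) auto
  moreover have "integral (ball a r) (newton s a) \<le> integral S (\<lambda>x. \<omega> x * newton s a x)"
  proof -
    have "integral (ball a r) (newton s a) = integral (ball a r) (\<lambda>x. \<omega> x * newton s a x)"
      by (rule integral_cong) (use ct(4) in \<open>simp add: dist_commute less_imp_le\<close>)
    also have "\<dots> \<le> integral S (\<lambda>x. \<omega> x * newton s a x)"
    proof (rule integral_subset_le)
      show sub: "ball a r \<subseteq> S" using r by (auto simp: S_def)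
      have b: "bdd_cont S (\<lambda>x. \<omega> x * newton s a x)" by (intro bdd_cont_intros nc \<omega>b)
      show "(\<lambda>x. \<omega> x * newton s a x) integrable_on S" by (rule int[OF b])
      show "(\<lambda>x. \<omega> x * newton s a x) integrable_on ball a r"
        by (rule bdd_cont_integrable[OF bdd_cont_subset[OF b sub]]) auto
      show "\<forall>x\<in>S. 0 \<le> \<omega> x * newton s a x"
        by (intro ballI mult_nonneg_nonneg ct(3) less_imp_le newton_pos s)
    qed
    finally show ?thesis .
  qed
  ultimately have "integral (ball a r) (newton s a) \<le> 3 * M * ((3 * r) ^ DIM('a) * measure lborel (ball (0::'a) 1))"
    by linarith
  also have "M * (3 * r) ^ DIM('a) = 3 ^ DIM('a) * r\<^sup>2"
  proof -
    have "r ^ DIM('a) = r ^ (DIM('a) - 2) * r\<^sup>2" 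
      by (rule power_split_sq[OF N])
    then show ?thesis using r by (simp add: M_def power_mult_distrib)
  qed
  then have "3 * M * ((3 * r) ^ DIM('a) * measure lborel (ball (0::'a) 1))
      = 3 ^ Suc DIM('a) * measure lborel (ball (0::'a) 1) * r\<^sup>2"
    by (simp add: algebra_simps)
  finally show ?thesis .
qed

section \<open>A priori bounds\<close>

text \<open>\<open>G_unif\<close> is the form in which regularity of the gradient up to the boundary
  enters: it bounds the gradient, and it later transfers one-sided information from a nearby point
  of a segment to its endpoint. \<open>hess_sym\<close> is what makes the stress tensor identity
  available.\<close>

locale semilinear = C2_fun \<Omega> u G D
  for \<Omega> :: "'a::euclidean_space set" and u G D +
  fixes p \<mu> :: real
  assumes open_dom: "open \<Omega>" and bounded_dom: "bounded \<Omega>"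
    and u_cont: "continuous_on (closure \<Omega>) u" and u_frontier: "\<And>x. x \<in> frontier \<Omega> \<Longrightarrow> u x = 0"
    and G_unif: "uniformly_continuous_on \<Omega> G"
    and hess_sym: "\<And>x a b. x \<in> \<Omega> \<Longrightarrow> D x a \<bullet> b = D x b \<bullet> a"
    and \<mu>_pos: "0 < \<mu>" and p_gt_1: "1 < p"
    and eq: "\<And>x. x \<in> \<Omega> \<Longrightarrow> - lap x = \<mu> * pospart (u x - 1) powr p"
begin

definition f :: "'a \<Rightarrow> real" where "f x = \<mu> * pospart (u x - 1) powr p"

lemma f_nonneg: "0 \<le> f x"
  using \<mu>_pos by (simp add: f_def)

lemma f_eq_0: "u x \<le> 1 \<Longrightarrow> f x = 0"
  by (simp add: f_def)

lemma u_bdd: "bdd_cont \<Omega> u"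
  by (rule bdd_cont_closure[OF bounded_dom u_cont])

lemma G_bdd: "bdd_cont \<Omega> G"
  unfolding bdd_cont_def using continuous_grad bounded_uniformly_continuous_image[OF G_unif bounded_dom] by simp

lemma f_bdd: "bdd_cont \<Omega> f"
proof -
  have "continuous_on UNIV (\<lambda>t. \<mu> * pospart (t - 1) powr p)"
    using p_gt_1 by (intro continuous_intros continuous_on_powr') auto
  from bdd_cont_compose[OF u_bdd this] show ?thesis by (simp add: f_def[abs_def])
qed

lemma integrable: "bdd_cont \<Omega> (g :: 'a \<Rightarrow> real) \<Longrightarrow> g integrable_on \<Omega>"
  by (rule bdd_cont_integrable[OF _ open_dom bounded_dom])

lemma integrable_ball: "bdd_cont \<Omega> (g :: 'a \<Rightarrow> real) \<Longrightarrow> g integrable_on ball x r \<inter> \<Omega>"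
  by (rule bdd_cont_integrable[OF bdd_cont_subset])
     (use open_dom bounded_dom in \<open>auto intro: bounded_Int open_Int\<close>)

lemma integral_ball_le:
  "bdd_cont \<Omega> g \<Longrightarrow> (\<And>x. x \<in> \<Omega> \<Longrightarrow> 0 \<le> g x) \<Longrightarrow> integral (ball x r \<inter> \<Omega>) g \<le> integral \<Omega> (g :: 'a \<Rightarrow> real)"
  by (intro integral_subset_le integrable integrable_ball) auto

text \<open>The weak maximum principle in integrated form. Green's identity is applied to the
  truncation of \<open>- u\<close> and to B^2 - |x|^2, which is nonnegative on the domain with
  Laplacian -2N. The source lives where u > 1 and the truncation where u < 0, so the integral of the
  truncated \<open>- u\<close> is nonpositive.\<close>

lemma u_nonneg:
  assumes "x \<in> \<Omega>"
  shows "0 \<le> u x"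
proof (rule ccontr)
  assume neg: "\<not> 0 \<le> u x"
  \<comment> \<open>Near x the value of \<open>- u\<close> stays above \<open>3 * d\<close>, so its
    truncation, which loses at most \<open>2 * d\<close>, stays above \<open>d\<close>.\<close>
  define d where "d = - u x / 4"
  have d: "0 < d" using neg by (simp add: d_def)
  obtain B where B: "\<And>y. y \<in> \<Omega> \<Longrightarrow> norm y \<le> B"
    using bounded_dom by (auto simp: bounded_iff)
  define g where "g t = B\<^sup>2 - t" for t :: real
  have gd: "(g has_real_derivative - 1) (at t)" for t
    unfolding g_def[abs_def] by (auto intro!: derivative_eq_intros)
  have \<psi>: "C2_fun \<Omega> (\<lambda>x. g ((x - 0) \<bullet> (x - 0))) (radial_grad (\<lambda>_. - 1) 0) (radial_hess (\<lambda>_. - 1) (\<lambda>_. 0) 0)"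
    by (rule C2_fun_radial) (auto intro: gd)
  have lap\<psi>: "C2_fun.lap (radial_hess (\<lambda>_. - 1) (\<lambda>_. 0) (0::'a)) x = - 2 * real DIM('a)" for x
    by (subst C2_fun_radial(2)[of g]) (auto intro: gd)
  have \<psi>0: "0 \<le> g ((x - 0) \<bullet> (x - 0))" if "x \<in> \<Omega>" for x
    using B[OF that] by (simp add: g_def dot_square_norm power_mono)
  have C2m: "C2_fun \<Omega> (\<lambda>x. - u x) (\<lambda>x. - G x) (\<lambda>x h. - D x h)"
    by (rule C2_fun_minus) (rule C2_fun_axioms)
  have lapm: "C2_fun.lap (\<lambda>x h. - D x h) y = - lap y" for y
    unfolding C2_fun.lap_def[OF C2m] lap_def by (simp add: sum_negf)
  have cm: "continuous_on (closure \<Omega>) (\<lambda>x. - u x)"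
    by (intro continuous_intros u_cont)
  have fm: "- u x \<le> 0" if "x \<in> frontier \<Omega>" for x using u_frontier[OF that] by simp
  note id = truncated_energy_identity[OF open_dom bounded_dom d C2m cm fm \<psi>]
  have "0 \<le> integral \<Omega> (\<lambda>x. trunc' d (- u x) * g ((x - 0) \<bullet> (x - 0)) * (- G x \<bullet> - G x))"
    by (intro integral_nonneg integrable id(1) mult_nonneg_nonneg trunc'_nonneg[OF d] \<psi>0 inner_ge_zero)
  also have "\<dots> = integral \<Omega> (\<lambda>x. trunc d (- u x) * g ((x - 0) \<bullet> (x - 0)) * - C2_fun.lap (\<lambda>x h. - D x h) x)
      + integral \<Omega> (\<lambda>x. truncint d (- u x) * C2_fun.lap (radial_hess (\<lambda>_. - 1) (\<lambda>_. 0) (0::'a)) x)"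
    by (rule id(4))
  also have "integral \<Omega> (\<lambda>x. trunc d (- u x) * g ((x - 0) \<bullet> (x - 0)) * - C2_fun.lap (\<lambda>x h. - D x h) x) = integral \<Omega> (\<lambda>x. 0)"
  proof (rule integral_cong)
    fix y assume y: "y \<in> \<Omega>"
    show "trunc d (- u y) * g ((y - 0) \<bullet> (y - 0)) * - C2_fun.lap (\<lambda>x h. - D x h) y = 0"
    proof (cases "u y \<le> 1")
      case True
      then show ?thesis using eq[OF y] by (simp add: lapm)
    next
      case False
      then show ?thesis using d by (simp add: trunc_0)
    qed
  qed
  also have "integral \<Omega> (\<lambda>x. truncint d (- u x) * C2_fun.lap (radial_hess (\<lambda>_. - 1) (\<lambda>_. 0) (0::'a)) x)
      = - 2 * real DIM('a) * integral \<Omega> (\<lambda>x. truncint d (- u x))"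
    unfolding lap\<psi> by (subst integral_mult_left) (rule mult.commute)
  finally have le0: "integral \<Omega> (\<lambda>x. truncint d (- u x)) \<le> 0"
    by (simp add: mult_le_0_iff)
  have "isCont u x"
    using grad[OF assms] by (rule gderiv_continuous)
  then obtain \<epsilon> where \<epsilon>: "0 < \<epsilon>" "\<And>y. dist y x < \<epsilon> \<Longrightarrow> dist (u y) (u x) < d"
    unfolding continuous_at_eps_delta using d by blast
  obtain \<epsilon>' where \<epsilon>': "0 < \<epsilon>'" "ball x \<epsilon>' \<subseteq> \<Omega>"
    using open_dom assms open_contains_ball by blast
  define r where "r = min \<epsilon> \<epsilon>'"
  have "d * measure lborel (ball x r) \<le> integral \<Omega> (\<lambda>x. truncint d (- u x))"
  proof (rule integral_ge_ball[OF _ open_dom bounded_dom])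
    show "bdd_cont \<Omega> (\<lambda>x. truncint d (- u x))"
      by (rule bdd_cont_compose[OF bdd_cont_minus[OF u_bdd] continuous_truncint[OF d]])
    show "0 \<le> truncint d (- u x)" for x by (rule truncint_nonneg[OF d])
    show "ball x r \<subseteq> \<Omega>" using \<epsilon>'(2) by (auto simp: r_def)
    show "d \<le> truncint d (- u y)" if "y \<in> ball x r" for y
    proof -
      have "dist (u y) (u x) < d" using that by (intro \<epsilon>(2)) (auto simp: r_def dist_commute)
      then have "- u y - 2 * d \<ge> d" unfolding dist_real_def d_def by linarith
      then show ?thesis using truncint_ge[OF d, of "- u y"] by linarith
    qed
  qed
  moreover have "0 < measure lborel (ball x r)"
    using \<epsilon>(1) \<epsilon>'(1) by (intro content_ball_pos) (auto simp: r_def)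
  ultimately show False using le0 d by (smt (verit) mult_pos_pos)
qed

text \<open>Green's representation up to constants: no information on the Green function of the domain is used,
  only that the truncated solution is subharmonic off the support of \<open>f\<close>.\<close>

lemma potential_bound_newton:
  fixes k :: real
  assumes N: "2 < DIM('a)" and x: "x \<in> \<Omega>" "0 < u x"
  defines "k \<equiv> newton_exp TYPE('a)"
  obtains s where "0 < s"
    "real DIM('a) * k * 2 powr (- k - 2) / 2 * measure lborel (ball (0::'a) 1) * u x \<le> integral \<Omega> (\<lambda>y. newton s x y * f y)"
proof -
  \<comment> \<open>Near x the solution exceeds \<open>u x / 2\<close>; the loss
    \<open>2 * d\<close> of the truncation leaves \<open>u x / 4\<close>.\<close>
  define d where "d = u x / 8"
  have d: "0 < d" using x by (simp add: d_def)
  have "isCont u x"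
    using grad[OF x(1)] by (rule gderiv_continuous)
  moreover have "0 < u x / 2" using x by simp
  ultimately obtain \<epsilon> where \<epsilon>: "0 < \<epsilon>" "\<And>y. dist y x < \<epsilon> \<Longrightarrow> dist (u y) (u x) < u x / 2"
    unfolding continuous_at_eps_delta by blast
  obtain \<epsilon>' where \<epsilon>': "0 < \<epsilon>'" "ball x \<epsilon>' \<subseteq> \<Omega>"
    using open_dom x open_contains_ball by blast
  \<comment> \<open>The kernel is regularized at a scale on which u is still comparable to
    \<open>u x\<close>, so that its approximate point mass samples only such values.\<close>
  define s where "s = min \<epsilon> \<epsilon>'"
  have s: "0 < s" using \<epsilon> \<epsilon>' by (simp add: s_def)
  have sb: "ball x s \<subseteq> \<Omega>" using \<epsilon>' by (auto simp: s_def)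
  have k0: "0 \<le> k" using N by (simp add: k_def newton_exp_def)
  have u0: "u y \<le> 0" if "y \<in> frontier \<Omega>" for y using u_frontier[OF that] by simp
  note id = truncated_energy_identity[OF open_dom bounded_dom d C2_fun_axioms u_cont u0 newton_C2(1)[OF s, of \<Omega> x]]
  define lp where "lp y = 2 * real DIM('a) * k * s\<^sup>2 * ((y - x) \<bullet> (y - x) + s\<^sup>2) powr (- k - 2)" for y
  have lp: "C2_fun.lap (newton_hess s x) y = - lp y" for y
    unfolding lp_def newton_C2(3)[OF s] k_def by simp
  have lp0: "0 \<le> lp y" for y
    using k0 by (simp add: lp_def)
  have nc: "bdd_cont \<Omega> (newton s x)"
    by (rule bdd_cont_continuous_UNIV[OF C2_fun.continuous[OF newton_C2(1)[OF s]] bounded_dom])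
  \<comment> \<open>The term from the truncation layer is discarded by its sign; this turns the
    identity into an upper bound for the truncated solution near x.\<close>
  have "0 \<le> integral \<Omega> (\<lambda>y. trunc' d (u y) * newton s x y * (G y \<bullet> G y))"
    by (intro integral_nonneg integrable id(1) mult_nonneg_nonneg trunc'_nonneg[OF d] inner_ge_zero
        less_imp_le[OF newton_pos[OF s]])
  then have "integral \<Omega> (\<lambda>y. truncint d (u y) * lp y) \<le> integral \<Omega> (\<lambda>y. trunc d (u y) * newton s x y * - lap y)"
    using id(4) by (simp add: lp)
  also have "\<dots> \<le> integral \<Omega> (\<lambda>y. newton s x y * f y)"
  proof (intro integral_le integrable id(2) bdd_cont_mult nc f_bdd)
    show "trunc d (u y) * newton s x y * - lap y \<le> newton s x y * f y" if "y \<in> \<Omega>" for y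
      unfolding eq[OF that] f_def[symmetric]
      using mult_right_mono[OF trunc_bounds(2)[OF d, of "u y"], of "newton s x y * f y"]
        f_nonneg[of y] newton_pos[OF s, of x y] by (simp add: mult.assoc)
  qed
  finally have upper: "integral \<Omega> (\<lambda>y. truncint d (u y) * lp y) \<le> integral \<Omega> (\<lambda>y. newton s x y * f y)" .
  define c where "c = u x / 4 * (2 * real DIM('a) * k * s\<^sup>2 * (2 * s\<^sup>2) powr (- k - 2))"
  have "c * measure lborel (ball x s) \<le> integral \<Omega> (\<lambda>y. truncint d (u y) * lp y)"
  proof (rule integral_ge_ball[OF _ open_dom bounded_dom _ sb])
    show "bdd_cont \<Omega> (\<lambda>y. truncint d (u y) * lp y)"
      using bdd_cont_minus[OF id(3)] by (simp add: lp)
    show "0 \<le> truncint d (u y) * lp y" for y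
      using truncint_nonneg[OF d] lp0 by simp
    show "c \<le> truncint d (u y) * lp y" if "y \<in> ball x s" for y
      unfolding c_def
    proof (rule mult_mono)
      have "dist (u y) (u x) < u x / 2" using that by (intro \<epsilon>(2)) (auto simp: s_def dist_commute)
      then have "u x / 4 \<le> u y - 2 * d" unfolding dist_real_def d_def by linarith
      then show "u x / 4 \<le> truncint d (u y)" using truncint_ge[OF d, of "u y"] by linarith
      have "(dist y x)\<^sup>2 \<le> s\<^sup>2" using that by (intro power_mono) (auto simp: dist_commute)
      then have "(y - x) \<bullet> (y - x) + s\<^sup>2 \<le> 2 * s\<^sup>2" by (simp add: dot_square_norm dist_norm)
      moreover have "0 < (y - x) \<bullet> (y - x) + s\<^sup>2" using s by (simp add: add_nonneg_pos)
      ultimately have "(2 * s\<^sup>2) powr (- k - 2) \<le> ((y - x) \<bullet> (y - x) + s\<^sup>2) powr (- k - 2)"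
        using k0 by (intro powr_mono2') auto
      then show "2 * real DIM('a) * k * s\<^sup>2 * (2 * s\<^sup>2) powr (- k - 2) \<le> lp y"
        unfolding lp_def using k0 by (intro mult_left_mono) auto
      show "0 \<le> truncint d (u y)" by (rule truncint_nonneg[OF d])
      show "0 \<le> 2 * real DIM('a) * k * s\<^sup>2 * (2 * s\<^sup>2) powr (- k - 2)" using k0 by simp
    qed
  qed
  \<comment> \<open>All powers of \<open>s\<close> cancel: the kernel's Laplacian contributes
    \<open>s ^ 2 / s ^ (N + 2)\<close> and the ball contributes \<open>s ^ N\<close>. The final
    constant is therefore independent of the solution.\<close>
  moreover have "c * measure lborel (ball x s)
      = real DIM('a) * k * 2 powr (- k - 2) / 2 * measure lborel (ball (0::'a) 1) * u x"
  proof -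
    have "(2 * s\<^sup>2) powr (- k - 2) = 2 powr (- k - 2) * (s powr 2) powr (- k - 2)"
      using s by (simp add: powr_mult)
    also have "(s powr 2) powr (- k - 2) = s powr (- real (DIM('a) + 2))"
      unfolding powr_powr by (rule arg_cong[where f = "(powr) s"]) (simp add: k_def newton_exp_def field_simps)
    also have "\<dots> = 1 / s ^ (DIM('a) + 2)"
      using s by (simp only: powr_minus powr_realpow inverse_eq_divide)
    finally have "(2 * s\<^sup>2) powr (- k - 2) * s\<^sup>2 * s ^ DIM('a) = 2 powr (- k - 2)"
      using s by (simp add: power_add power2_eq_square)
    moreover have "c * measure lborel (ball x s) = u x * real DIM('a) * k / 2 * measure lborel (ball (0::'a) 1)
        * ((2 * s\<^sup>2) powr (- k - 2) * s\<^sup>2 * s ^ DIM('a))"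
      using s by (subst measure_ball_power) (simp_all add: c_def)
    ultimately show ?thesis by simp
  qed
  ultimately show ?thesis using that[OF s] upper by simp
qed

end

section \<open>Potential estimate, supremum bound and concentration\<close>

text \<open>The kernel integral is split at the radii \<open>r\<close> and \<open>R\<close>: inside
  \<open>r\<close> the bound \<open>F\<close> meets the integral of the kernel, of order
  \<open>r ^ 2\<close>; outside \<open>r\<close> and outside \<open>R\<close> the kernel is at most
  its value at that radius. The constant depends on the dimension only, hence the quantification
  over all solutions inside.\<close>

lemma potential_bound:
  assumes N: "2 < DIM('a::euclidean_space)"
  shows "\<exists>C>0. \<forall>(\<Omega>::'a set) u G D p \<mu> x r R F. semilinear \<Omega> u G D p \<mu> \<longrightarrow> x \<in> \<Omega> \<longrightarrow> 0 < r \<longrightarrow> r \<le> R \<longrightarrow> 0 \<le> F \<longrightarrow>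
     (\<forall>y\<in>ball x r \<inter> \<Omega>. semilinear.f u p \<mu> y \<le> F) \<longrightarrow>
     u x \<le> C * (F * r\<^sup>2 + integral (ball x R \<inter> \<Omega>) (semilinear.f u p \<mu>) / r ^ (DIM('a) - 2)
                + integral \<Omega> (semilinear.f u p \<mu>) / R ^ (DIM('a) - 2))"
proof -
  define V where "V = measure lborel (ball (0::'a) 1)"
  have V: "0 < V" unfolding V_def by (rule content_ball_pos) simp
  define k where "k = newton_exp TYPE('a)"
  have k: "0 < k" using N by (simp add: k_def newton_exp_def)
  define c where "c = real DIM('a) * k * 2 powr (- k - 2) / 2 * V"
  have c: "0 < c" using k V N by (simp add: c_def)
  define C' where "C' = max 1 (3 ^ Suc DIM('a) * V)"
  have C': "1 \<le> C'" by (simp add: C'_def)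
  show ?thesis
  proof (intro exI[of _ "C' / c"] conjI allI impI)
    show "0 < C' / c" using C' c by simp
    fix \<Omega> :: "'a set" and u G D p \<mu> x r R F
    assume sl: "semilinear \<Omega> u G D p \<mu>" and x: "x \<in> \<Omega>" and r: "0 < r" "r \<le> R" and F: "0 \<le> F"
      and fF: "\<forall>y\<in>ball x r \<inter> \<Omega>. semilinear.f u p \<mu> y \<le> F"
    interpret semilinear \<Omega> u G D p \<mu> by (rule sl)
    have I0: "0 \<le> integral (ball x R \<inter> \<Omega>) f" "0 \<le> integral \<Omega> f"
      by (intro integral_nonneg integrable integrable_ball f_bdd f_nonneg)+
    define T where "T = F * r\<^sup>2 + integral (ball x R \<inter> \<Omega>) f / r ^ (DIM('a) - 2)
                + integral \<Omega> f / R ^ (DIM('a) - 2)"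
    have T0: "0 \<le> T" using I0 F r by (simp add: T_def)
    show "u x \<le> C' / c * T"
    proof (cases "0 < u x")
      case True
      obtain s where s: "0 < s" and le: "c * u x \<le> integral \<Omega> (\<lambda>y. newton s x y * f y)"
        using potential_bound_newton[OF N x True] unfolding c_def k_def V_def by metis
      define M where "M t = 1 / t ^ (DIM('a) - 2)" for t :: real
      have M: "0 \<le> M r" "0 \<le> M R" using r by (simp_all add: M_def)
      have nc: "bdd_cont \<Omega> (newton s x)"
        by (rule bdd_cont_continuous_UNIV[OF C2_fun.continuous[OF newton_C2(1)[OF s]] bounded_dom])
      have i1: "(\<lambda>y. if y \<in> ball x r then F * newton s x y else 0) integrable_on \<Omega>"
        unfolding integrable_restrict_Int by (intro integrable_ball bdd_cont_intros nc)
      have i2: "(\<lambda>y. if y \<in> ball x R then M r * f y else 0) integrable_on \<Omega>"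
        unfolding integrable_restrict_Int by (intro integrable_ball bdd_cont_intros f_bdd)
      have i3: "(\<lambda>y. M R * f y) integrable_on \<Omega>"
        by (intro integrable bdd_cont_intros f_bdd)
      have "integral \<Omega> (\<lambda>y. newton s x y * f y) \<le>
          integral \<Omega> (\<lambda>y. (if y \<in> ball x r then F * newton s x y else 0)
            + (if y \<in> ball x R then M r * f y else 0) + M R * f y)"
      proof (intro integral_le integrable_add i1 i2 i3 integrable bdd_cont_mult nc f_bdd)
        fix y assume y: "y \<in> \<Omega>"
        have "newton s x y \<le> M r" if "y \<notin> ball x r"
          unfolding M_def using that r by (intro newton_le N) (auto simp: dist_commute)
        moreover have "newton s x y \<le> M R" if "y \<notin> ball x R"
          unfolding M_def using that r by (intro newton_le N) (auto simp: dist_commute)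
        ultimately consider "y \<in> ball x r" | "y \<notin> ball x r" "y \<in> ball x R" "newton s x y \<le> M r"
          | "y \<notin> ball x r" "y \<notin> ball x R" "newton s x y \<le> M R" by blast
        then show "newton s x y * f y \<le> (if y \<in> ball x r then F * newton s x y else 0)
            + (if y \<in> ball x R then M r * f y else 0) + M R * f y"
        proof cases
          case 1
          have "newton s x y * f y \<le> F * newton s x y"
            using mult_left_mono[of "f y" F "newton s x y"] fF 1 y newton_pos[OF s, of x y] by (simp add: mult.commute)
          then show ?thesis using 1 M f_nonneg[of y] by (simp add: add_increasing2)
        next
          case 2
          then show ?thesis using M f_nonneg[of y] mult_right_mono[of "newton s x y" "M r" "f y"]
            by (simp add: add_increasing2)
        next
          case 3
          then show ?thesis using f_nonneg[of y] mult_right_mono[of "newton s x y" "M R" "f y"] by simp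
        qed
      qed
      also have "\<dots> = integral (ball x r \<inter> \<Omega>) (\<lambda>y. F * newton s x y) + M r * integral (ball x R \<inter> \<Omega>) f
          + M R * integral \<Omega> f"
        by (simp only: integral_add[OF integrable_add[OF i1 i2] i3] integral_add[OF i1 i2] integral_restrict_Int
            integral_mult_right)
      also have "integral (ball x r \<inter> \<Omega>) (\<lambda>y. F * newton s x y) \<le> F * (3 ^ Suc DIM('a) * V * r\<^sup>2)"
      proof -
        have "integral (ball x r \<inter> \<Omega>) (newton s x) \<le> integral (ball x r) (newton s x)"
        proof (intro integral_subset_le integrable_ball nc)
          show "newton s x integrable_on ball x r"
            by (rule bdd_cont_integrable[OF bdd_cont_continuous_UNIV[OF C2_fun.continuous[OF newton_C2(1)[OF s]]]]) auto
        qed (auto intro: less_imp_le newton_pos s)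
        also have "\<dots> \<le> 3 ^ Suc DIM('a) * V * r\<^sup>2"
          unfolding V_def by (rule newton_integral_ball[OF N s r(1)])
        finally show ?thesis using F unfolding integral_mult_right by (rule mult_left_mono)
      qed
      also have "F * (3 ^ Suc DIM('a) * V * r\<^sup>2) \<le> C' * (F * r\<^sup>2)"
        using F mult_right_mono[of "3 ^ Suc DIM('a) * V" C' "F * r\<^sup>2"] by (simp add: C'_def mult_ac)
      also have "M r * integral (ball x R \<inter> \<Omega>) f \<le> C' * (M r * integral (ball x R \<inter> \<Omega>) f)"
        using mult_right_mono[OF C', of "M r * integral (ball x R \<inter> \<Omega>) f"] M I0 by simp
      also have "M R * integral \<Omega> f \<le> C' * (M R * integral \<Omega> f)"
        using mult_right_mono[OF C', of "M R * integral \<Omega> f"] M I0 by simp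
      finally have "integral \<Omega> (\<lambda>y. newton s x y * f y) \<le> C' * T"
        by (simp add: T_def M_def distrib_left)
      then have "c * u x \<le> C' * T" using le by linarith
      then show ?thesis using c by (simp add: field_simps)
    next
      case False
      then show ?thesis using C' c T0 by (smt (verit) divide_nonneg_pos mult_nonneg_nonneg)
    qed
  qed
qed

lemma pospart_mono: "s \<le> t \<Longrightarrow> pospart s \<le> pospart t"
  by (simp add: pospart_def)

text \<open>Optimizing the radius in the potential bound at a maximum point gives \<open>M \<le> C M\<^bsup>p (N - 2) / N\<^esup>\<close>;
  this is where \<open>p < N / (N - 2)\<close> enters.\<close>

lemma sup_bound:
  assumes N: "2 < DIM('a::euclidean_space)" and p: "1 < p" "p * (real DIM('a) - 2) < real DIM('a)" and C0: "0 < C0"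
  shows "\<exists>M\<ge>1. \<forall>(\<Omega>::'a set) u G D \<mu> \<epsilon>. semilinear \<Omega> u G D p \<mu> \<longrightarrow> 0 < \<epsilon> \<longrightarrow> \<mu> * \<epsilon>\<^sup>2 = 1 \<longrightarrow>
     integral \<Omega> (semilinear.f u p \<mu>) \<le> C0 * \<epsilon> ^ (DIM('a) - 2) \<longrightarrow> (\<forall>x\<in>\<Omega>. u x \<le> M)"
proof -
  obtain C where C: "0 < C" and pot: "\<And>(\<Omega>::'a set) u G D p \<mu> x r R F. semilinear \<Omega> u G D p \<mu> \<Longrightarrow> x \<in> \<Omega> \<Longrightarrow> 0 < r \<Longrightarrow> r \<le> R \<Longrightarrow> 0 \<le> F \<Longrightarrow>
     (\<forall>y\<in>ball x r \<inter> \<Omega>. semilinear.f u p \<mu> y \<le> F) \<Longrightarrow>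
     u x \<le> C * (F * r\<^sup>2 + integral (ball x R \<inter> \<Omega>) (semilinear.f u p \<mu>) / r ^ (DIM('a) - 2)
                + integral \<Omega> (semilinear.f u p \<mu>) / R ^ (DIM('a) - 2))"
    using potential_bound[OF N] by blast
  define q where "q = p * (real DIM('a) - 2) / real DIM('a)"
  have q: "q < 1" using p N by (simp add: q_def)
  define B where "B = C * (1 + 2 * C0)"
  have B: "0 < B" using C C0 by (simp add: B_def)
  \<comment> \<open>From \<open>m \<le> B * m powr q\<close> with \<open>q < 1\<close> follows
    \<open>m \<le> B powr (1 / (1 - q))\<close>.\<close>
  define M where "M = max 1 (B powr (1 / (1 - q)))"
  show ?thesis
  proof (intro exI[of _ M] conjI allI impI ballI)
    show "1 \<le> M" by (simp add: M_def)
    fix \<Omega> :: "'a set" and u G D \<mu> \<epsilon> x0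
    assume sl: "semilinear \<Omega> u G D p \<mu>" and \<epsilon>: "0 < \<epsilon>" "\<mu> * \<epsilon>\<^sup>2 = 1"
      and mass: "integral \<Omega> (semilinear.f u p \<mu>) \<le> C0 * \<epsilon> ^ (DIM('a) - 2)" and x0: "x0 \<in> \<Omega>"
    interpret semilinear \<Omega> u G D p \<mu> by (rule sl)
    have "compact (closure \<Omega>)" using bounded_dom by (simp add: compact_closure)
    then obtain x where x: "x \<in> closure \<Omega>" "\<And>y. y \<in> closure \<Omega> \<Longrightarrow> u y \<le> u x"
      using continuous_attains_sup[OF _ _ u_cont] x0 closure_subset by (metis empty_iff subsetD)
    have le: "u y \<le> u x" if "y \<in> \<Omega>" for y using x(2) that closure_subset by blast
    have "u x \<le> M"
    proof (cases "u x \<le> 1")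
      case False
      define m where "m = u x"
      have m: "1 < m" using False by (simp add: m_def)
      have x\<Omega>: "x \<in> \<Omega>"
        using x(1) u_frontier[of x] m open_dom by (cases "x \<in> \<Omega>") (auto simp: m_def frontier_def interior_open)
      \<comment> \<open>At radius \<open>\<epsilon> * s\<close> the competing terms are of order
        \<open>m powr p * s ^ 2\<close> and \<open>1 / s ^ (N - 2)\<close>. They agree for
        \<open>s ^ N = m powr (- p)\<close>, and both then equal \<open>m powr q\<close>.\<close>
      define s where "s = m powr (- p / real DIM('a))"
      have s: "0 < s" using m by (simp add: s_def)
      have f_le: "f y \<le> \<mu> * m powr p" if "y \<in> \<Omega>" for y
      proof -
        have "pospart (u y - 1) \<le> pospart m" using le[OF that] by (intro pospart_mono) (simp add: m_def)
        then have "pospart (u y - 1) powr p \<le> m powr p" using m p by (intro powr_mono2) auto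
        then show ?thesis unfolding f_def using \<mu>_pos by (intro mult_left_mono) auto
      qed
      have "m \<le> C * (\<mu> * m powr p * (\<epsilon> * s)\<^sup>2 + integral (ball x (\<epsilon> * s) \<inter> \<Omega>) f / (\<epsilon> * s) ^ (DIM('a) - 2)
                + integral \<Omega> f / (\<epsilon> * s) ^ (DIM('a) - 2))"
        unfolding m_def
        by (rule pot[OF sl x\<Omega>]) (use \<epsilon> s f_le m \<mu>_pos in \<open>auto simp: m_def[symmetric]\<close>)
      also have "\<dots> \<le> C * (m powr q + C0 * m powr q + C0 * m powr q)"
      proof (intro mult_left_mono add_mono less_imp_le[OF C])
        have "\<mu> * m powr p * (\<epsilon> * s)\<^sup>2 = (\<mu> * \<epsilon>\<^sup>2) * (m powr p * s\<^sup>2)"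
          by (simp add: power_mult_distrib)
        also have "m powr p * s\<^sup>2 = m powr q"
        proof -
          have "s\<^sup>2 = m powr (- 2 * p / real DIM('a))"
            unfolding s_def power2_eq_square powr_add[symmetric] by (rule arg_cong[where f = "(powr) m"]) simp
          then have "m powr p * s\<^sup>2 = m powr (p + (- 2 * p / real DIM('a)))" by (simp only: powr_add)
          also have "p + (- 2 * p / real DIM('a)) = q" using N by (simp add: q_def field_simps)
          finally show ?thesis .
        qed
        finally show "\<mu> * m powr p * (\<epsilon> * s)\<^sup>2 \<le> m powr q" by (simp add: \<epsilon>)
        have "1 / s ^ (DIM('a) - 2) = m powr q"
        proof -
          have "s ^ (DIM('a) - 2) = s powr real (DIM('a) - 2)" using s by (simp add: powr_realpow)
          also have "\<dots> = m powr (- p / real DIM('a) * real (DIM('a) - 2))" by (simp add: s_def powr_powr)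
          also have "- p / real DIM('a) * real (DIM('a) - 2) = - q"
            using N by (simp add: q_def of_nat_diff)
          finally show ?thesis by (simp add: powr_minus field_simps)
        qed
        then have e: "C0 * \<epsilon> ^ (DIM('a) - 2) / (\<epsilon> * s) ^ (DIM('a) - 2) = C0 * m powr q"
          using \<epsilon> by (simp add: power_mult_distrib flip: \<open>1 / s ^ (DIM('a) - 2) = m powr q\<close>)
        show 2: "integral \<Omega> f / (\<epsilon> * s) ^ (DIM('a) - 2) \<le> C0 * m powr q"
          unfolding e[symmetric] using mass \<epsilon> s by (intro divide_right_mono) auto
        have "integral (ball x (\<epsilon> * s) \<inter> \<Omega>) f \<le> integral \<Omega> f"
          by (rule integral_ball_le[OF f_bdd f_nonneg])
        then show "integral (ball x (\<epsilon> * s) \<inter> \<Omega>) f / (\<epsilon> * s) ^ (DIM('a) - 2) \<le> C0 * m powr q"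
          using 2 \<epsilon> s by (meson divide_right_mono less_imp_le mult_pos_pos order_trans zero_less_power)
      qed
      also have "\<dots> = B * m powr q" by (simp add: B_def algebra_simps)
      finally have "m powr 1 \<le> B * m powr q" using m by simp
      then have "m powr (1 - q) \<le> B"
        using m by (simp add: powr_diff field_simps)
      then have "(m powr (1 - q)) powr (1 / (1 - q)) \<le> B powr (1 / (1 - q))"
        using q by (intro powr_mono2) auto
      then have "m \<le> B powr (1 / (1 - q))" using q m by (simp add: powr_powr)
      then show ?thesis by (simp add: M_def m_def)
    qed (simp add: M_def)
    then show "u x0 \<le> M" using le[OF x0] by linarith
  qed
qed

text \<open>In the potential bound at a point with u > 1, the near term is at most 1/4 by the
  uniform bound on u if the inner radius is a small multiple of \<epsilon>, and the far term is at
  most 1/4 if the outer radius is a large one. The mass in between has to supply the remaining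
  1/2.\<close>

lemma concentration:
  assumes N: "2 < DIM('a::euclidean_space)" and p: "1 < p" "p * (real DIM('a) - 2) < real DIM('a)" and C0: "0 < C0"
  shows "\<exists>R m. 0 < R \<and> 0 < m \<and> (\<forall>(\<Omega>::'a set) u G D \<mu> \<epsilon> x. semilinear \<Omega> u G D p \<mu> \<longrightarrow> 0 < \<epsilon> \<longrightarrow> \<mu> * \<epsilon>\<^sup>2 = 1 \<longrightarrow>
     integral \<Omega> (semilinear.f u p \<mu>) \<le> C0 * \<epsilon> ^ (DIM('a) - 2) \<longrightarrow> x \<in> \<Omega> \<longrightarrow> 1 < u x \<longrightarrow>
     m * \<epsilon> ^ (DIM('a) - 2) \<le> integral (ball x (R * \<epsilon>) \<inter> \<Omega>) (semilinear.f u p \<mu>))"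
proof -
  obtain C where C: "0 < C" and pot: "\<And>(\<Omega>::'a set) u G D p \<mu> x r R F. semilinear \<Omega> u G D p \<mu> \<Longrightarrow> x \<in> \<Omega> \<Longrightarrow> 0 < r \<Longrightarrow> r \<le> R \<Longrightarrow> 0 \<le> F \<Longrightarrow>
     (\<forall>y\<in>ball x r \<inter> \<Omega>. semilinear.f u p \<mu> y \<le> F) \<Longrightarrow>
     u x \<le> C * (F * r\<^sup>2 + integral (ball x R \<inter> \<Omega>) (semilinear.f u p \<mu>) / r ^ (DIM('a) - 2)
                + integral \<Omega> (semilinear.f u p \<mu>) / R ^ (DIM('a) - 2))"
    using potential_bound[OF N] by blast
  obtain M where M: "1 \<le> M" and sup: "\<And>(\<Omega>::'a set) u G D \<mu> \<epsilon> x. semilinear \<Omega> u G D p \<mu> \<Longrightarrow> 0 < \<epsilon> \<Longrightarrow> \<mu> * \<epsilon>\<^sup>2 = 1 \<Longrightarrow>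
     integral \<Omega> (semilinear.f u p \<mu>) \<le> C0 * \<epsilon> ^ (DIM('a) - 2) \<Longrightarrow> x \<in> \<Omega> \<Longrightarrow> u x \<le> M"
    using sup_bound[OF N p C0] by metis
  \<comment> \<open>Chosen so that the near term, computed with the supremum bound \<open>M\<close>,
    is exactly 1/4.\<close>
  define t where "t = sqrt (1 / (4 * C * M powr p))"
  have Mp: "0 < M powr p" using M by simp
  have t: "0 < t" using C Mp by (simp add: t_def)
  have t2: "C * (M powr p * t\<^sup>2) = 1 / 4"
  proof -
    have "t\<^sup>2 = 1 / (4 * C * M powr p)" unfolding t_def using C Mp by (intro real_sqrt_pow2) simp
    then show ?thesis using C Mp M by (simp add: field_simps)
  qed
  \<comment> \<open>\<open>4 * C * C0\<close> makes the far term at most 1/4,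
    \<open>1 \<le> R\<close> gives \<open>R \<le> R ^ (N - 2)\<close>, and \<open>t \<le> R\<close>
    orders the two radii.\<close>
  define R where "R = max t (max 1 (4 * C * C0))"
  have R: "t \<le> R" "1 \<le> R" "4 * C * C0 \<le> R" by (simp_all add: R_def)
  define m where "m = t ^ (DIM('a) - 2) / (2 * C)"
  have m: "0 < m" using t C by (simp add: m_def)
  have "R \<le> R ^ (DIM('a) - 2)" using R(2) N power_increasing[of 1 "DIM('a) - 2" R] by simp
  then have RC: "C * (C0 / R ^ (DIM('a) - 2)) \<le> 1 / 4"
    using R by (simp add: field_simps)
  show ?thesis
  proof (rule exI[of _ R], rule exI[of _ m], intro conjI allI impI m)
    show "0 < R" using R by simp
    fix \<Omega> :: "'a set" and u G D \<mu> \<epsilon> x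
    assume sl: "semilinear \<Omega> u G D p \<mu>" and \<epsilon>: "0 < \<epsilon>" "\<mu> * \<epsilon>\<^sup>2 = 1"
      and mass: "integral \<Omega> (semilinear.f u p \<mu>) \<le> C0 * \<epsilon> ^ (DIM('a) - 2)" and x: "x \<in> \<Omega>" "1 < u x"
    interpret semilinear \<Omega> u G D p \<mu> by (rule sl)
    define I where "I = integral (ball x (R * \<epsilon>) \<inter> \<Omega>) f / \<epsilon> ^ (DIM('a) - 2)"
    have f_le: "f y \<le> \<mu> * M powr p" if "y \<in> \<Omega>" for y
    proof -
      have "pospart (u y - 1) \<le> pospart M" using sup[OF sl \<epsilon> mass that] by (intro pospart_mono) simp
      then have "pospart (u y - 1) powr p \<le> M powr p" using M p by (intro powr_mono2) auto
      then show ?thesis unfolding f_def using \<mu>_pos by (intro mult_left_mono) auto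
    qed
    have "u x \<le> C * (\<mu> * M powr p * (t * \<epsilon>)\<^sup>2 + integral (ball x (R * \<epsilon>) \<inter> \<Omega>) f / (t * \<epsilon>) ^ (DIM('a) - 2)
                + integral \<Omega> f / (R * \<epsilon>) ^ (DIM('a) - 2))"
      by (rule pot[OF sl x(1)]) (use \<epsilon> t R f_le \<mu>_pos in auto)
    also have "\<mu> * M powr p * (t * \<epsilon>)\<^sup>2 = (\<mu> * \<epsilon>\<^sup>2) * (M powr p * t\<^sup>2)"
      by (simp add: power_mult_distrib)
    also have "integral (ball x (R * \<epsilon>) \<inter> \<Omega>) f / (t * \<epsilon>) ^ (DIM('a) - 2) = I / t ^ (DIM('a) - 2)"
      by (simp add: I_def power_mult_distrib)
    also have "C * ((\<mu> * \<epsilon>\<^sup>2) * (M powr p * t\<^sup>2) + I / t ^ (DIM('a) - 2) + integral \<Omega> f / (R * \<epsilon>) ^ (DIM('a) - 2))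
        \<le> C * (M powr p * t\<^sup>2 + I / t ^ (DIM('a) - 2) + C0 / R ^ (DIM('a) - 2))"
    proof -
      have "integral \<Omega> f / (R * \<epsilon>) ^ (DIM('a) - 2) \<le> C0 * \<epsilon> ^ (DIM('a) - 2) / (R * \<epsilon>) ^ (DIM('a) - 2)"
        using mass \<epsilon> R by (intro divide_right_mono) auto
      also have "\<dots> = C0 / R ^ (DIM('a) - 2)" using \<epsilon> by (simp add: power_mult_distrib)
      finally show ?thesis using C by (intro mult_left_mono add_mono) (auto simp: \<epsilon>)
    qed
    also have "\<dots> = 1 / 4 + C * (I / t ^ (DIM('a) - 2)) + C * (C0 / R ^ (DIM('a) - 2))"
      by (simp only: distrib_left t2)
    finally have "1 / 2 \<le> C * (I / t ^ (DIM('a) - 2))" using RC x(2) by linarith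
    then have "m \<le> I" using C t by (simp add: m_def field_simps)
    then show "m * \<epsilon> ^ (DIM('a) - 2) \<le> integral (ball x (R * \<epsilon>) \<inter> \<Omega>) f"
      using \<epsilon> by (simp add: I_def field_simps)
  qed
qed

section \<open>An energy estimate up to the boundary\<close>

context semilinear
begin

text \<open>By \<open>u_nonneg\<close>, an interior zero of u is a minimum. Where truncations at
  positive levels fail to approach 1, the gradient thus contributes nothing.\<close>

lemma grad_eq_0:
  assumes "x \<in> \<Omega>" "u x = 0"
  shows "G x = 0"
proof -
  have "(\<lambda>h. h \<bullet> G x) = (\<lambda>h. 0)"
    using assms u_nonneg grad[OF assms(1)] unfolding gderiv_def
    by (intro differential_zero_maxmin[OF assms(1) open_dom]) auto
  then have "G x \<bullet> G x = 0" by metis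
  then show ?thesis by simp
qed

text \<open>The equation is tested with \<zeta>^2 u times a truncation. The support of \<zeta> may
  cross the boundary because u vanishes there. The derivative of the truncation enters with a good
  sign since u is nonnegative.\<close>

lemma caccioppoli:
  assumes \<zeta>: "\<And>x. GDERIV \<zeta> x :> Z x" "continuous_on UNIV Z"
    and harm: "\<And>x. x \<in> \<Omega> \<Longrightarrow> \<zeta> x \<noteq> 0 \<Longrightarrow> u x \<le> 1"
  shows "integral \<Omega> (\<lambda>x. (\<zeta> x)\<^sup>2 * (G x \<bullet> G x)) \<le> 4 * integral \<Omega> (\<lambda>x. (u x)\<^sup>2 * (Z x \<bullet> Z x))"
proof -
  have \<zeta>c: "continuous_on UNIV \<zeta>"
    using \<zeta>(1) by (intro continuous_at_imp_continuous_on ballI gderiv_continuous)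
  have \<zeta>b: "bdd_cont \<Omega> \<zeta>" and Zb: "bdd_cont \<Omega> Z"
    using \<zeta>c \<zeta>(2) bounded_dom by (auto intro: bdd_cont_continuous_UNIV)
  define d where "d k = 1 / real (Suc k)" for k
  have d: "0 < d k" for k by (simp add: d_def)
  have T: "bdd_cont \<Omega> (\<lambda>x. trunc (d k) (u x))" for k
    by (rule bdd_cont_compose[OF u_bdd continuous_trunc[OF d]])
  have A: "bdd_cont \<Omega> (\<lambda>x. trunc (d k) (u x) * ((\<zeta> x)\<^sup>2 * (G x \<bullet> G x)))" for k
    by (intro bdd_cont_intros T \<zeta>b G_bdd)
  have B: "bdd_cont \<Omega> (\<lambda>x. (u x)\<^sup>2 * (Z x \<bullet> Z x))"
    by (intro bdd_cont_intros u_bdd Zb)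
  have step: "integral \<Omega> (\<lambda>x. trunc (d k) (u x) * ((\<zeta> x)\<^sup>2 * (G x \<bullet> G x))) \<le> 4 * integral \<Omega> (\<lambda>x. (u x)\<^sup>2 * (Z x \<bullet> Z x))" for k
  proof -
    let ?c = "\<lambda>x. trunc (d k) (u x)" and ?c' = "\<lambda>x. trunc' (d k) (u x)"
    define K where "K = {x\<in>closure \<Omega>. d k \<le> u x}"
    have K: "compact K" "K \<subseteq> \<Omega>"
      using compact_superlevel[OF open_dom bounded_dom u_cont, of "d k"] u_frontier d by (fastforce simp: K_def)+
    have off: "u x \<le> d k" if "x \<in> \<Omega> - K" for x
      using that closure_subset by (force simp: K_def)
    define P where "P x = (\<zeta> x * \<zeta> x) *\<^sub>R (u x *\<^sub>R (?c' x *\<^sub>R G x) + ?c x *\<^sub>R G x)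
      + (u x * ?c x) *\<^sub>R (\<zeta> x *\<^sub>R Z x + \<zeta> x *\<^sub>R Z x)" for x
    have P: "GDERIV (\<lambda>x. (\<zeta> x * \<zeta> x) * (u x * ?c x)) x :> P x" if "x \<in> \<Omega>" for x
      unfolding P_def
      by (intro GDERIV_mult \<zeta> grad that GDERIV_comp[OF grad[OF that] trunc_deriv[OF d] refl])
    have Pc: "continuous_on \<Omega> P"
      unfolding P_def[abs_def]
      by (intro continuous_intros continuous_on_subset[OF \<zeta>c] continuous_on_subset[OF \<zeta>(2)] continuous
          continuous_grad continuous_on_compose2[OF continuous_trunc[OF d] continuous]
          continuous_on_compose2[OF continuous_trunc'[OF d] continuous]) auto
    note id = integral_scalar_times_field[OF open_dom K P Pc hess hess_cont]
    have id1: "bdd_cont \<Omega> (\<lambda>x. P x \<bullet> G x + \<zeta> x * \<zeta> x * (u x * ?c x) * (\<Sum>b\<in>Basis. D x b \<bullet> b))"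
      by (rule id) (simp_all add: trunc_0[OF d off])
    have id2: "integral \<Omega> (\<lambda>x. P x \<bullet> G x + \<zeta> x * \<zeta> x * (u x * ?c x) * (\<Sum>b\<in>Basis. D x b \<bullet> b)) = 0"
      by (rule id) (simp_all add: trunc_0[OF d off])
    have "integral \<Omega> (\<lambda>x. (?c x * ((\<zeta> x)\<^sup>2 * (G x \<bullet> G x))) - 4 * ((u x)\<^sup>2 * (Z x \<bullet> Z x))) \<le>
        integral \<Omega> (\<lambda>x. 2 * (P x \<bullet> G x + \<zeta> x * \<zeta> x * (u x * ?c x) * (\<Sum>b\<in>Basis. D x b \<bullet> b)))"
    proof (intro integral_le integrable)
      show "bdd_cont \<Omega> (\<lambda>x. (?c x * ((\<zeta> x)\<^sup>2 * (G x \<bullet> G x))) - 4 * ((u x)\<^sup>2 * (Z x \<bullet> Z x)))"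
        by (intro bdd_cont_diff bdd_cont_mult[OF bdd_cont_const] A B)
      show "bdd_cont \<Omega> (\<lambda>x. 2 * (P x \<bullet> G x + \<zeta> x * \<zeta> x * (u x * ?c x) * (\<Sum>b\<in>Basis. D x b \<bullet> b)))"
        by (intro bdd_cont_mult[OF bdd_cont_const] id1)
      fix x assume x: "x \<in> \<Omega>"
      have lap0: "\<zeta> x * \<zeta> x * (u x * ?c x) * (\<Sum>b\<in>Basis. D x b \<bullet> b) = 0"
      proof (cases "\<zeta> x = 0")
        case False
        then have "lap x = 0" using harm[OF x] eq[OF x] by simp
        then show ?thesis by (simp add: lap_def)
      qed simp
      have PG: "P x \<bullet> G x = (\<zeta> x)\<^sup>2 * u x * ?c' x * (G x \<bullet> G x) + (\<zeta> x)\<^sup>2 * ?c x * (G x \<bullet> G x)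
          + 2 * (\<zeta> x * u x * ?c x * (Z x \<bullet> G x))"
        by (simp add: P_def inner_add_left algebra_simps power2_eq_square)
      \<comment> \<open>This square absorbs the mixed term into one of the two copies of the
        gradient term, which is why the tested identity is doubled.\<close>
      have "0 \<le> ?c x * (((\<zeta> x) *\<^sub>R G x + (2 * u x) *\<^sub>R Z x) \<bullet> ((\<zeta> x) *\<^sub>R G x + (2 * u x) *\<^sub>R Z x))"
        using trunc_bounds[OF d] by (intro mult_nonneg_nonneg inner_ge_zero) auto
      also have "\<dots> = ?c x * (\<zeta> x)\<^sup>2 * (G x \<bullet> G x) + 4 * (\<zeta> x * u x * ?c x * (Z x \<bullet> G x)) + 4 * ?c x * ((u x)\<^sup>2 * (Z x \<bullet> Z x))"
        by (simp add: inner_add_left inner_add_right inner_commute algebra_simps power2_eq_square)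
      also have "4 * ?c x * ((u x)\<^sup>2 * (Z x \<bullet> Z x)) \<le> 4 * ((u x)\<^sup>2 * (Z x \<bullet> Z x))"
        using mult_right_mono[OF trunc_bounds(2)[OF d, of k "u x"], of "4 * ((u x)\<^sup>2 * (Z x \<bullet> Z x))"] by simp
      finally have "0 \<le> ?c x * (\<zeta> x)\<^sup>2 * (G x \<bullet> G x) + 4 * (\<zeta> x * u x * ?c x * (Z x \<bullet> G x)) + 4 * ((u x)\<^sup>2 * (Z x \<bullet> Z x))"
        by simp
      moreover have "0 \<le> (\<zeta> x)\<^sup>2 * u x * ?c' x * (G x \<bullet> G x)"
        using u_nonneg[OF x] trunc'_nonneg[OF d] by (intro mult_nonneg_nonneg inner_ge_zero zero_le_power2)
      ultimately show "(?c x * ((\<zeta> x)\<^sup>2 * (G x \<bullet> G x))) - 4 * ((u x)\<^sup>2 * (Z x \<bullet> Z x))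
          \<le> 2 * (P x \<bullet> G x + \<zeta> x * \<zeta> x * (u x * ?c x) * (\<Sum>b\<in>Basis. D x b \<bullet> b))"
        unfolding lap0 PG by (simp add: algebra_simps)
    qed
    also have "\<dots> = 0" unfolding integral_mult_right id2 by simp
    finally have "integral \<Omega> (\<lambda>x. (?c x * ((\<zeta> x)\<^sup>2 * (G x \<bullet> G x))) - 4 * ((u x)\<^sup>2 * (Z x \<bullet> Z x))) \<le> 0" .
    then show ?thesis
      by (subst (asm) integral_diff[OF integrable[OF A] integrable[OF bdd_cont_mult[OF bdd_cont_const B]]]) simp
  qed
  \<comment> \<open>The truncations tend to 1 where u > 0; where u = 0 the limit integrand is 0 by
    \<open>grad_eq_0\<close>.\<close>
  have "(\<lambda>k. integral \<Omega> (\<lambda>x. trunc (d k) (u x) * ((\<zeta> x)\<^sup>2 * (G x \<bullet> G x)))) \<longlonglongrightarrow> integral \<Omega> (\<lambda>x. (\<zeta> x)\<^sup>2 * (G x \<bullet> G x))"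
  proof (rule dominated_convergence(2)[OF integrable[OF A]])
    show "(\<lambda>x. (\<zeta> x)\<^sup>2 * (G x \<bullet> G x)) integrable_on \<Omega>"
      by (intro integrable bdd_cont_intros \<zeta>b G_bdd)
    show "norm (trunc (d k) (u x) * ((\<zeta> x)\<^sup>2 * (G x \<bullet> G x))) \<le> (\<zeta> x)\<^sup>2 * (G x \<bullet> G x)" for k x
      using trunc_bounds[OF d, of k "u x"] by (simp add: abs_mult mult_left_le_one_le)
    show "(\<lambda>k. trunc (d k) (u x) * ((\<zeta> x)\<^sup>2 * (G x \<bullet> G x))) \<longlonglongrightarrow> (\<zeta> x)\<^sup>2 * (G x \<bullet> G x)" if x: "x \<in> \<Omega>" for x
    proof (cases "u x = 0")
      case True
      then show ?thesis using grad_eq_0[OF x] by simp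
    next
      case False
      then have "0 < u x / 2" using u_nonneg[OF x] by simp
      moreover have "d \<longlonglongrightarrow> 0" unfolding d_def by (rule LIMSEQ_Suc, rule lim_1_over_n)
      ultimately have "eventually (\<lambda>k. d k < u x / 2) sequentially"
        using order_tendstoD(2) by blast
      then have "eventually (\<lambda>k. trunc (d k) (u x) * ((\<zeta> x)\<^sup>2 * (G x \<bullet> G x)) = (\<zeta> x)\<^sup>2 * (G x \<bullet> G x)) sequentially"
        by eventually_elim (simp add: trunc_1[OF d])
      then show ?thesis by (rule tendsto_eventually)
    qed
  qed
  then show ?thesis using step by (intro LIMSEQ_le_const2) auto
qed

end

section \<open>The balance of forces at the boundary\<close>

lemma half_cancel: "y \<noteq> 0 \<Longrightarrow> a / (2 * y) * y = a / (2::real)"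
  by simp

text \<open>For \<kappa> = 0 and \<eta> = \<psi> = 1, with a the inner product of \<open>L\<close>
  and \<open>e\<close>, the claim is |L|^2 a - 2 \<theta> |L|^2 + \<theta>^2 a / c0^2 >= 0. For a >
  0 it follows from |L| <= a / c0, since the left side is at least |L|^2 (a - \<theta>)^2 / a. This
  is the Cauchy-Schwarz inequality between flux and force, made pointwise with a parameter \<theta>
  so that it applies inside the truncation layer. The errors due to \<open>n\<close> are kept as
  multiples of a because such terms can be integrated away.\<close>

lemma force_pointwise:
  fixes L n e G :: "'a::real_inner" and c0 n0 G0 \<kappa> \<theta> \<psi> \<eta> :: real
  defines "G \<equiv> L - \<kappa> *\<^sub>R n" and "C1 \<equiv> 2 * n0 * (G0 + n0) / c0 + 2 * n0\<^sup>2 / c0 + n0\<^sup>2"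
  assumes c0: "0 < c0" and La: "norm L * c0 \<le> L \<bullet> e" and n: "norm n \<le> n0" and G: "norm G \<le> G0" and e: "norm e = 1"
    and \<kappa>: "0 < \<kappa>" "\<kappa> \<le> 1" and \<psi>: "0 \<le> \<psi>" "\<psi> \<le> \<eta>" and \<theta>: "0 < \<theta>"
  shows "0 \<le> \<eta> * (2 * (L \<bullet> G) * (G \<bullet> e) - (G \<bullet> G) * (L \<bullet> e)) - 2 * \<theta> * \<psi> * (L \<bullet> G)
     + (\<theta>\<^sup>2 / c0\<^sup>2 + 2 * \<theta> * \<kappa> * n0 / c0) * \<psi> * (L \<bullet> e) + \<kappa> * C1 * \<eta> * (L \<bullet> e)"
proof -
  define a where "a = L \<bullet> e"
  define l where "l = norm L"
  have n0: "0 \<le> n0" using n norm_ge_zero order_trans by blast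
  have l0: "0 \<le> l" by (simp add: l_def)
  have lca: "l * c0 \<le> a" using La by (simp add: l_def a_def)
  have a0: "0 \<le> a" using lca l0 c0 by (meson less_imp_le mult_nonneg_nonneg order_trans)
  have la: "l \<le> a / c0" using lca c0 by (simp add: field_simps)
  have LL: "L \<bullet> L = l\<^sup>2" by (simp add: l_def dot_square_norm)
  have Ln: "\<bar>L \<bullet> n\<bar> \<le> l * n0"
    using Cauchy_Schwarz_ineq2[of L n] mult_left_mono[OF n l0] by (simp add: l_def)
  have ne: "\<bar>n \<bullet> e\<bar> \<le> n0"
    using Cauchy_Schwarz_ineq2[of n e] n e by simp
  have nn: "n \<bullet> n \<le> n0\<^sup>2"
    using n by (simp add: dot_square_norm power_mono)
  have lG: "l \<le> G0 + n0"
  proof -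
    have "L = G + \<kappa> *\<^sub>R n" by (simp add: G_def)
    then have "l \<le> norm G + norm (\<kappa> *\<^sub>R n)" unfolding l_def by (metis norm_triangle_ineq)
    also have "norm (\<kappa> *\<^sub>R n) \<le> n0"
      using \<kappa> n mult_left_le_one_le[of "norm n" \<kappa>] by simp
    finally show ?thesis using G by linarith
  qed
  have expand: "2 * (L \<bullet> G) * (G \<bullet> e) - (G \<bullet> G) * a = l\<^sup>2 * a
      - \<kappa> * (2 * (n \<bullet> e) * l\<^sup>2 - 2 * \<kappa> * (L \<bullet> n) * (n \<bullet> e) + \<kappa> * (n \<bullet> n) * a)"
    by (simp add: G_def a_def LL inner_diff_left inner_diff_right inner_commute[of n L] algebra_simps power2_eq_square)
  have err: "2 * (n \<bullet> e) * l\<^sup>2 - 2 * \<kappa> * (L \<bullet> n) * (n \<bullet> e) + \<kappa> * (n \<bullet> n) * a \<le> C1 * a"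
  proof -
    have l2: "l\<^sup>2 \<le> (G0 + n0) * (a / c0)"
      unfolding power2_eq_square using lG la l0 by (intro mult_mono) auto
    have "2 * (n \<bullet> e) * l\<^sup>2 \<le> 2 * n0 * ((G0 + n0) * (a / c0))"
    proof -
      have "(n \<bullet> e) * l\<^sup>2 \<le> n0 * l\<^sup>2" using ne by (intro mult_right_mono) auto
      also have "\<dots> \<le> n0 * ((G0 + n0) * (a / c0))" by (rule mult_left_mono[OF l2 n0])
      finally show ?thesis by simp
    qed
    moreover have "- (2 * \<kappa> * (L \<bullet> n) * (n \<bullet> e)) \<le> 2 * n0\<^sup>2 / c0 * a"
    proof -
      have "- (2 * \<kappa> * (L \<bullet> n) * (n \<bullet> e)) \<le> \<bar>2 * \<kappa> * (L \<bullet> n) * (n \<bullet> e)\<bar>" by linarith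
      also have "\<dots> = 2 * \<kappa> * (\<bar>L \<bullet> n\<bar> * \<bar>n \<bullet> e\<bar>)" using \<kappa> by (simp add: abs_mult)
      also have "\<dots> \<le> 2 * 1 * ((a / c0 * n0) * n0)"
      proof (intro mult_mono)
        have "l * n0 \<le> a / c0 * n0" by (rule mult_right_mono[OF la n0])
        then show "\<bar>L \<bullet> n\<bar> \<le> a / c0 * n0" using Ln by linarith
      qed (use \<kappa> ne n0 a0 c0 in auto)
      finally show ?thesis by (simp add: power2_eq_square mult_ac)
    qed
    moreover have "\<kappa> * (n \<bullet> n) * a \<le> 1 * n0\<^sup>2 * a"
      using \<kappa> nn a0 by (intro mult_mono) auto
    ultimately have "2 * (n \<bullet> e) * l\<^sup>2 - 2 * \<kappa> * (L \<bullet> n) * (n \<bullet> e) + \<kappa> * (n \<bullet> n) * a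
       \<le> 2 * n0 * ((G0 + n0) * (a / c0)) + 2 * n0\<^sup>2 / c0 * a + n0\<^sup>2 * a" by linarith
    also have "\<dots> = C1 * a" unfolding C1_def by (simp add: distrib_right)
    finally show ?thesis .
  qed
  have "2 * (L \<bullet> G) * (G \<bullet> e) - (G \<bullet> G) * a \<ge> l\<^sup>2 * a - \<kappa> * (C1 * a)"
    unfolding expand using mult_left_mono[OF err, of \<kappa>] \<kappa> by linarith
  then have 1: "\<eta> * (2 * (L \<bullet> G) * (G \<bullet> e) - (G \<bullet> G) * a) \<ge> \<eta> * (l\<^sup>2 * a) - \<eta> * (\<kappa> * (C1 * a))"
    using \<psi> mult_left_mono[of "l\<^sup>2 * a - \<kappa> * (C1 * a)" "2 * (L \<bullet> G) * (G \<bullet> e) - (G \<bullet> G) * a" \<eta>]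
    by (simp add: right_diff_distrib)
  have 2: "\<eta> * (l\<^sup>2 * a) \<ge> \<psi> * (l\<^sup>2 * a)"
    using \<psi> a0 by (intro mult_right_mono) auto
  have "L \<bullet> G = l\<^sup>2 - \<kappa> * (L \<bullet> n)" by (simp add: G_def inner_diff_right LL)
  also have "\<dots> \<le> l\<^sup>2 + \<kappa> * (n0 * a / c0)"
  proof -
    have "- (L \<bullet> n) \<le> n0 * a / c0"
      using Ln mult_right_mono[OF la n0] by (simp add: mult.commute)
    from mult_left_mono[OF this, of \<kappa>] \<kappa> show ?thesis by simp
  qed
  finally have 3: "2 * \<theta> * \<psi> * (L \<bullet> G) \<le> 2 * \<theta> * \<psi> * (l\<^sup>2 + \<kappa> * (n0 * a / c0))"
    using \<theta> \<psi> by (intro mult_left_mono) auto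
  have "l\<^sup>2 * a - 2 * \<theta> * l\<^sup>2 + \<theta>\<^sup>2 / c0\<^sup>2 * a \<ge> 0"
  proof (cases "a = 0")
    case True
    then have "l = 0" using la l0 by simp
    then show ?thesis using True by simp
  next
    case False
    then have a: "0 < a" using a0 by simp
    have "l\<^sup>2 \<le> (a / c0)\<^sup>2" using la l0 by (intro power_mono) auto
    then have "\<theta>\<^sup>2 / a * l\<^sup>2 \<le> \<theta>\<^sup>2 / a * (a / c0)\<^sup>2" using a by (intro mult_left_mono) auto
    also have "\<dots> = \<theta>\<^sup>2 / c0\<^sup>2 * a" using a by (simp add: power2_eq_square)
    finally have "l\<^sup>2 * a - 2 * \<theta> * l\<^sup>2 + \<theta>\<^sup>2 / c0\<^sup>2 * a \<ge> l\<^sup>2 * a - 2 * \<theta> * l\<^sup>2 + \<theta>\<^sup>2 / a * l\<^sup>2" by linarith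
    moreover have "l\<^sup>2 * a - 2 * \<theta> * l\<^sup>2 + \<theta>\<^sup>2 / a * l\<^sup>2 = l\<^sup>2 * (a - \<theta>)\<^sup>2 / a"
      using a by (simp add: field_simps power2_eq_square)
    moreover have "0 \<le> l\<^sup>2 * (a - \<theta>)\<^sup>2 / a" using a by simp
    ultimately show ?thesis by linarith
  qed
  then have 4: "0 \<le> \<psi> * (l\<^sup>2 * a - 2 * \<theta> * l\<^sup>2 + \<theta>\<^sup>2 / c0\<^sup>2 * a)" using \<psi> by simp
  have "0 \<le> \<eta> * (2 * (L \<bullet> G) * (G \<bullet> e) - (G \<bullet> G) * a) - 2 * \<theta> * \<psi> * (L \<bullet> G)
     + (\<theta>\<^sup>2 / c0\<^sup>2 + 2 * \<theta> * \<kappa> * n0 / c0) * \<psi> * a + \<kappa> * C1 * \<eta> * a"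
    using 1 2 3 4 by (simp add: algebra_simps)
  then show ?thesis unfolding a_def .
qed

context semilinear
begin

text \<open>The translational balance of forces at the boundary. The truncation is performed at the level sets of
  \<open>lv = u + \<kappa> \<phi>\<close> instead of those of \<open>u\<close>: since \<open>\<phi>\<close> is strictly monotone in a cone of directions,
  its gradient lies in the dual cone near the boundary although that of \<open>u\<close> may vanish there.\<close>

context
  fixes z e :: 'a and \<phi> n \<psi> P\<psi> D\<psi> \<eta> P\<eta> and r1 r2 c0 b n0 :: real and S :: "'a set"
  defines "S \<equiv> ball z r1 \<inter> \<Omega>"
  assumes r: "0 < r2" "r2 < r1"
    and \<phi>: "\<And>x. x \<in> ball z r1 \<Longrightarrow> GDERIV \<phi> x :> n x" "continuous_on (ball z r1) n"
      "\<And>x. x \<in> ball z r1 \<Longrightarrow> norm (n x) \<le> n0"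
    and dom: "\<And>x. x \<in> ball z r1 \<Longrightarrow> x \<in> \<Omega> \<longleftrightarrow> 0 < \<phi> x"
    and e: "norm e = 1" and b: "0 < b" and c0: "0 < c0"
    and cone: "\<And>x e'. x \<in> ball z r1 \<Longrightarrow> norm (e' - e) \<le> c0 \<Longrightarrow> b \<le> n x \<bullet> e'"
    and \<psi>: "C2_fun UNIV \<psi> P\<psi> D\<psi>" "\<And>x. 0 \<le> \<psi> x" "\<And>x. \<psi> x \<le> \<eta> x"
      "\<And>x. x \<notin> cball z r2 \<Longrightarrow> \<psi> x = 0 \<and> P\<psi> x = 0"
      "\<And>x. x \<in> S \<Longrightarrow> 0 \<le> C2_fun.lap D\<psi> x"
    and \<eta>: "\<And>x. GDERIV \<eta> x :> P\<eta> x" "continuous_on UNIV P\<eta>"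
      "\<And>x. x \<notin> cball z r2 \<Longrightarrow> \<eta> x = 0 \<and> P\<eta> x = 0"
      "\<And>x. x \<in> \<Omega> \<Longrightarrow> P\<eta> x \<noteq> 0 \<Longrightarrow> u x \<le> 1"
begin

text \<open>Six divergence identities are combined. The terms that carry the derivative of the
  truncation stand for boundary integrals; together they are nonnegative by
  \<open>force_pointwise\<close>. What remains is the source tested with \<psi>, the force on the
  support of \<open>P\<eta>\<close>, and errors controlled by \<theta> and \<kappa>.\<close>

lemma force_inequality_aux:
  fixes \<kappa> \<theta> G0 :: real
  assumes \<theta>: "0 < \<theta>" and \<kappa>: "0 < \<kappa>" "\<kappa> \<le> 1" and G0: "\<And>x. x \<in> \<Omega> \<Longrightarrow> norm (G x) \<le> G0"
  shows "2 * \<theta> * integral S (\<lambda>x. \<psi> x * f x) - \<theta>\<^sup>2 / c0\<^sup>2 * integral S (\<lambda>x. norm (P\<psi> x))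
      - 3 * integral S (\<lambda>x. (G x \<bullet> G x) * norm (P\<eta> x))
    \<le> \<kappa> * ((2 * \<theta> * n0 + 2 * \<theta> * n0 / c0) * integral S (\<lambda>x. norm (P\<psi> x))
      + (2 * n0 * (G0 + n0) / c0 + 2 * n0\<^sup>2 / c0 + n0\<^sup>2) * integral S (\<lambda>x. norm (P\<eta> x)))"
proof -
  interpret \<psi>: C2_fun UNIV \<psi> P\<psi> D\<psi> by fact
  define C1 where "C1 = 2 * n0 * (G0 + n0) / c0 + 2 * n0\<^sup>2 / c0 + n0\<^sup>2"
  have S: "open S" "bounded S" using open_dom bounded_dom by (auto simp: S_def)
  have S\<Omega>: "S \<subseteq> \<Omega>" and SB: "S \<subseteq> ball z r1" by (auto simp: S_def)
  define lv where "lv x = u x + \<kappa> * \<phi> x" for x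
  define L where "L x = G x + \<kappa> *\<^sub>R n x" for x
  have L: "GDERIV lv x :> L x" if "x \<in> S" for x
    unfolding lv_def L_def using that S\<Omega> SB
    by (intro GDERIV_subst[OF GDERIV_add[OF grad GDERIV_mult[OF GDERIV_const \<phi>(1)]]]) auto
  have \<phi>c: "continuous_on (ball z r1) \<phi>"
    using \<phi>(1) by (intro continuous_at_imp_continuous_on ballI gderiv_continuous)
  have Lc: "continuous_on S L"
    unfolding L_def[abs_def]
    by (intro continuous_intros continuous_on_subset[OF continuous_grad S\<Omega>] continuous_on_subset[OF \<phi>(2) SB])
  have lv_cont: "continuous_on S lv"
    using L by (intro continuous_at_imp_continuous_on ballI gderiv_continuous)
  have \<phi>_pos: "0 < \<phi> x" if "x \<in> S" for x using that dom SB S\<Omega> by blast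
  have u_le_lv: "u x \<le> lv x" if "x \<in> S" for x using \<phi>_pos[OF that] \<kappa> by (simp add: lv_def)

  \<comment> \<open>Uniform continuity of the gradient and \<open>u \<ge> 0\<close> make \<open>u\<close> almost increasing along the cone where \<open>u\<close> is small.\<close>
  have inward: "x + t *\<^sub>R e' \<in> S"
    if x: "x \<in> S" "x \<in> cball z r2" and e': "norm (e' - e) \<le> c0" and t: "0 \<le> t" "t * (1 + c0) < r1 - r2" for x t e'
  proof -
    have ne': "norm e' \<le> 1 + c0" using norm_triangle_ineq2[of e' e] e' e by linarith
    have in_ball: "x + s *\<^sub>R e' \<in> ball z r1" if s: "0 \<le> s" "s \<le> t" for s
    proof -
      have "dist z (x + s *\<^sub>R e') \<le> dist z x + norm (s *\<^sub>R e')"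
        using dist_triangle[of z "x + s *\<^sub>R e'" x] by (simp add: dist_norm)
      also have "norm (s *\<^sub>R e') \<le> t * (1 + c0)" using s ne' by (simp add: mult_mono)
      finally show ?thesis using x(2) t(2) by simp
    qed
    show ?thesis
    proof (cases "t = 0")
      case False
      then have "0 < t" using t by simp
      then obtain s where s: "0 < s" "s < t" "\<phi> (x + t *\<^sub>R e') - \<phi> x = t * (n (x + s *\<^sub>R e') \<bullet> e')"
        using gderiv_mvt[of t \<phi> x e' n] in_ball \<phi>(1) by (metis less_imp_le)
      have "b \<le> n (x + s *\<^sub>R e') \<bullet> e'" using s by (intro cone in_ball e') auto
      then have "0 \<le> t * (n (x + s *\<^sub>R e') \<bullet> e')" using t b by simp
      then have "0 < \<phi> (x + t *\<^sub>R e')" using s(3) \<phi>_pos[OF x(1)] by linarith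
      then show ?thesis using in_ball[of t] t dom by (simp add: S_def)
    qed (use x in simp)
  qed
  \<comment> \<open>A change of \<open>G\<close> below this bound changes its component along any
    \<open>e'\<close> of the cone by at most \<open>\<kappa> * b / 2\<close>, as
    \<open>norm e' \<le> 1 + c0\<close>.\<close>
  have "0 < \<kappa> * b / (2 * (1 + c0))" using \<kappa> b c0 by simp
  then obtain \<delta> where \<delta>: "0 < \<delta>" "\<And>x y. x \<in> \<Omega> \<Longrightarrow> y \<in> \<Omega> \<Longrightarrow> dist y x < \<delta> \<Longrightarrow> dist (G y) (G x) < \<kappa> * b / (2 * (1 + c0))"
    using G_unif unfolding uniformly_continuous_on_def by metis
  define t where "t = min (r1 - r2) \<delta> / (2 * (1 + c0))"
  have t: "0 < t" using r \<delta> c0 by (simp add: t_def)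
  have tc: "t * (1 + c0) < r1 - r2" "t * (1 + c0) < \<delta>"
  proof -
    have "t * (1 + c0) = min (r1 - r2) \<delta> / 2"
    proof -
      show ?thesis unfolding t_def by (rule half_cancel) (use c0 in simp)
    qed
    moreover have "0 < min (r1 - r2) \<delta>" using r \<delta>(1) by simp
    moreover have "min (r1 - r2) \<delta> \<le> r1 - r2" "min (r1 - r2) \<delta> \<le> \<delta>" by simp_all
    ultimately show "t * (1 + c0) < r1 - r2" "t * (1 + c0) < \<delta>" by argo+
  qed
  \<comment> \<open>\<open>2 * d \<le> 1\<close> places the whole set {u > 1} where the truncation
    equals 1. The second bound makes a drop of u by at most \<open>2 * d\<close> along a segment of
    parameter length \<open>t\<close> negligible against the slope \<open>\<kappa> * b\<close>
    gained from \<phi>.\<close>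
  define d where "d = min (1 / 2) (t * \<kappa> * b / 4)"
  have d: "0 < d" "d \<le> 1 / 2" "d \<le> t * \<kappa> * b / 4" using t \<kappa> b by (simp_all add: d_def)
  have Le': "0 \<le> L x \<bullet> e'" if x: "x \<in> S" "x \<in> cball z r2" "lv x \<le> 2 * d" and e': "norm (e' - e) \<le> c0" for x e'
  proof -
    have ne': "norm e' \<le> 1 + c0" using norm_triangle_ineq2[of e' e] e' e by linarith
    have inS: "x + s *\<^sub>R e' \<in> S" if "0 \<le> s" "s \<le> t" for s
    proof (rule inward[OF x(1,2) e' that(1)])
      show "s * (1 + c0) < r1 - r2"
        using tc(1) mult_right_mono[OF that(2), of "1 + c0"] c0 by linarith
    qed
    obtain s where s: "0 < s" "s < t" "u (x + t *\<^sub>R e') - u x = t * (G (x + s *\<^sub>R e') \<bullet> e')"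
      using gderiv_mvt[of t u x e' G] grad inS S\<Omega> t by (metis less_imp_le subsetD)
    have "0 \<le> u (x + t *\<^sub>R e')" using inS[of t] t S\<Omega> u_nonneg by auto
    moreover have "u x \<le> 2 * d" using u_le_lv[OF x(1)] x(3) by simp
    ultimately have "- (2 * d) \<le> t * (G (x + s *\<^sub>R e') \<bullet> e')" using s(3) by linarith
    then have "- (t * \<kappa> * b / 2) \<le> t * (G (x + s *\<^sub>R e') \<bullet> e')" using d(3) by linarith
    then have "t * (- (\<kappa> * b / 2)) \<le> t * (G (x + s *\<^sub>R e') \<bullet> e')" by (simp add: mult.assoc)
    then have 1: "- (\<kappa> * b / 2) \<le> G (x + s *\<^sub>R e') \<bullet> e'" using t by (simp only: mult_le_cancel_left_pos)
    have "dist (x + s *\<^sub>R e') x < \<delta>"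
    proof -
      have "norm (s *\<^sub>R e') \<le> t * (1 + c0)" using s(1,2) ne' by (simp add: mult_mono)
      then show ?thesis using tc(2) by (simp add: dist_norm)
    qed
    then have "norm (G (x + s *\<^sub>R e') - G x) < \<kappa> * b / (2 * (1 + c0))"
      using \<delta>(2)[of x "x + s *\<^sub>R e'"] x(1) inS[of s] s(1,2) S\<Omega> by (auto simp: dist_norm)
    then have "norm (G (x + s *\<^sub>R e') - G x) * norm e' \<le> \<kappa> * b / (2 * (1 + c0)) * (1 + c0)"
      using ne' \<kappa> b c0 by (intro mult_mono) auto
    also have "\<dots> = \<kappa> * b / 2" by (rule half_cancel) (use c0 in simp)
    finally have "(G (x + s *\<^sub>R e') - G x) \<bullet> e' \<le> \<kappa> * b / 2"
      using norm_cauchy_schwarz[of "G (x + s *\<^sub>R e') - G x" e'] by linarith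
    then have "- (\<kappa> * b) \<le> G x \<bullet> e'" using 1 by (simp add: inner_diff_left)
    moreover have "\<kappa> * b \<le> \<kappa> * (n x \<bullet> e')"
      using cone[OF _ e'] x(1) SB \<kappa> by (intro mult_left_mono) auto
    ultimately show ?thesis by (simp add: L_def inner_add_left)
  qed
  have La: "norm (L x) * c0 \<le> L x \<bullet> e" if x: "x \<in> S" "x \<in> cball z r2" "lv x \<le> 2 * d" for x
  proof (cases "L x = 0")
    case False
    \<comment> \<open>The worst direction of the cone is tried, the one tilted from \<open>e\<close>
      by \<open>c0\<close> against \<open>L x\<close>.\<close>
    have "norm (e - (c0 / norm (L x)) *\<^sub>R L x - e) \<le> c0" using False c0 by simp
    from Le'[OF x this] have "0 \<le> L x \<bullet> e - c0 / norm (L x) * (L x \<bullet> L x)" by (simp add: inner_diff_right)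
    then show ?thesis using False by (simp add: dot_square_norm power2_eq_square mult.commute)
  qed simp

  \<comment> \<open>\<open>K\<close> is closed although it is cut out of the closure; it misses the
    frontier because there \<open>lv x = \<kappa> * \<phi> x\<close>, which is nonpositive.\<close>
  define K where "K = {x \<in> closure \<Omega> \<inter> cball z r2. d \<le> lv x}"
  have cb: "cball z r2 \<subseteq> ball z r1" using r by auto
  have "closed K"
  proof -
    have "continuous_on (closure \<Omega> \<inter> cball z r2) lv"
      unfolding lv_def[abs_def]
      by (intro continuous_intros continuous_on_subset[OF u_cont] continuous_on_subset[OF \<phi>c]) (use cb in auto)
    from continuous_on_closed_Collect_le[OF continuous_on_const this] show ?thesis
      unfolding K_def by auto
  qed
  then have K: "compact K"
    using compact_Int_closed[OF compact_cball[of z r2], of K] by (simp add: K_def Int_absorb1 subset_iff Int_def) (metis (no_types, lifting) Collect_cong)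
  have KS: "K \<subseteq> S"
  proof
    fix x assume x: "x \<in> K"
    then have xb: "x \<in> ball z r1" using cb by (auto simp: K_def)
    have "x \<in> \<Omega>"
    proof (rule ccontr)
      assume nx: "x \<notin> \<Omega>"
      then have "x \<in> frontier \<Omega>" using x open_dom by (simp add: K_def frontier_def interior_open)
      then have "lv x = \<kappa> * \<phi> x" using u_frontier by (simp add: lv_def)
      moreover have "\<phi> x \<le> 0" using dom[OF xb] nx by auto
      ultimately have "lv x \<le> 0" using \<kappa> by (simp add: mult_nonneg_nonpos)
      then show False using x d by (simp add: K_def)
    qed
    then show "x \<in> S" using xb by (simp add: S_def)
  qed
  have off: "x \<notin> cball z r2 \<or> lv x \<le> d" if "x \<in> S - K" for x
    using that S\<Omega> closure_subset by (force simp: K_def)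

  define c where "c x = trunc d (lv x)" for x
  define c' where "c' x = trunc' d (lv x)" for x
  define X where "X x = truncint d (lv x)" for x
  have c_bounds: "0 \<le> c x" "c x \<le> 1" for x using trunc_bounds[OF d(1)] by (simp_all add: c_def)
  have offK: "\<psi> x = 0 \<and> P\<psi> x = 0 \<and> \<eta> x = 0 \<and> P\<eta> x = 0 \<or> c x = 0 \<and> X x = 0 \<and> c' x = 0 \<and> u x \<le> 1" if x: "x \<in> S - K" for x
  proof (cases "x \<in> cball z r2")
    case True
    then have "lv x \<le> d" using off[OF x] by blast
    moreover have "u x \<le> 1" using u_le_lv[of x] x calculation d by simp
    ultimately show ?thesis by (simp add: c_def c'_def X_def trunc_0[OF d(1)] trunc'_eq_0[OF d(1)] truncint_0[OF d(1)])
  qed (use \<psi>(4) \<eta>(3) in simp)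
  have cD: "GDERIV c x :> c' x *\<^sub>R L x" and XD: "GDERIV X x :> c x *\<^sub>R L x" if "x \<in> S" for x
    unfolding c_def[abs_def] c'_def X_def[abs_def]
    by (rule GDERIV_comp[OF L[OF that] trunc_deriv[OF d(1)] refl]
             GDERIV_comp[OF L[OF that] truncint_deriv[OF d(1)] refl])+
  have \<eta>c: "continuous_on UNIV \<eta>"
    using \<eta>(1) by (intro continuous_at_imp_continuous_on ballI gderiv_continuous)
  \<comment> \<open>A primitive of the nonlinearity. Its gradient is the source force
    \<open>f x *\<^sub>R G x\<close>, so the work of the source is a divergence, and the leftover
    \<open>F x *\<^sub>R P\<eta> x\<close> vanishes as u is at most 1 on the support of
    \<open>P\<eta>\<close>.\<close>
  define F where "F x = \<mu> / (p + 1) * pospart (u x - 1) powr (p + 1)" for x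
  have FD: "GDERIV F x :> f x *\<^sub>R G x" if "x \<in> S" for x
  proof -
    have "((\<lambda>t. \<mu> / (p + 1) * pospart (t - 1) powr (p + 1)) has_real_derivative
        \<mu> / (p + 1) * ((p + 1) * pospart (u x - 1) powr (p + 1 - 1) * 1)) (at (u x))"
      by (intro DERIV_cmult DERIV_chain2[OF pospart_powr_deriv]) (use p_gt_1 in \<open>auto intro!: derivative_eq_intros\<close>)
    moreover have "x \<in> \<Omega>" using that S\<Omega> by blast
    ultimately have "GDERIV F x :> (\<mu> / (p + 1) * ((p + 1) * pospart (u x - 1) powr (p + 1 - 1) * 1)) *\<^sub>R G x"
      unfolding F_def[abs_def] by (intro GDERIV_comp[OF grad _ refl])
    then show ?thesis using p_gt_1 by (simp add: f_def)
  qed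
  have F0: "F x *\<^sub>R P\<eta> x = 0" if "x \<in> S" for x
    using \<eta>(4)[of x] that S\<Omega> by (cases "P\<eta> x = 0") (auto simp: F_def)
  have cf: "c x * f x = f x" if "x \<in> S" for x
  proof (cases "u x \<le> 1")
    case False
    then have "2 * d \<le> lv x" using u_le_lv[OF that] d by linarith
    then show ?thesis by (simp add: c_def trunc_1[OF d(1)])
  qed (simp add: f_eq_0)

  note cont = continuous_on_subset[OF continuous_grad S\<Omega>] Lc continuous_on_subset[OF \<eta>c subset_UNIV]
    continuous_on_subset[OF \<eta>(2) subset_UNIV] continuous_on_subset[OF \<psi>.continuous subset_UNIV]
    continuous_on_subset[OF \<psi>.continuous_grad subset_UNIV]
    continuous_on_compose2[OF continuous_trunc[OF d(1)] lv_cont, folded c_def]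
    continuous_on_compose2[OF continuous_trunc'[OF d(1)] lv_cont, folded c'_def]
    continuous_on_compose2[OF continuous_truncint[OF d(1)] lv_cont, folded X_def]
    continuous_on_subset[OF bdd_contD(1)[OF f_bdd] S\<Omega>]
  have Fc: "continuous_on S F"
    using FD by (intro continuous_at_imp_continuous_on ballI gderiv_continuous)
  have hessS: "\<And>x. x \<in> S \<Longrightarrow> (G has_derivative D x) (at x)" "\<And>h. continuous_on S (\<lambda>x. D x h)"
    "\<And>x a b. x \<in> S \<Longrightarrow> D x a \<bullet> b = D x b \<bullet> a"
    using hess hess_cont hess_sym S\<Omega> continuous_on_subset by blast+
  have hess\<psi>: "\<And>x. x \<in> S \<Longrightarrow> (P\<psi> has_derivative D\<psi> x) (at x)" "\<And>h. continuous_on S (\<lambda>x. D\<psi> x h)"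
    using \<psi>.hess \<psi>.hess_cont continuous_on_subset by blast+
  have conste: "\<And>x. x \<in> S \<Longrightarrow> ((\<lambda>x. e) has_derivative (\<lambda>h. 0)) (at x)" "\<And>h. continuous_on S (\<lambda>x. 0::'a)"
    by auto
  have trG: "(\<Sum>b\<in>Basis. D x b \<bullet> b) = - f x" if "x \<in> S" for x
    using eq[of x] that S\<Omega> by (auto simp: f_def lap_def)

  define Pc\<eta> where "Pc\<eta> x = c x *\<^sub>R P\<eta> x + \<eta> x *\<^sub>R (c' x *\<^sub>R L x)" for x
  define Pc\<psi> where "Pc\<psi> x = c x *\<^sub>R P\<psi> x + \<psi> x *\<^sub>R (c' x *\<^sub>R L x)" for x
  have Pc\<eta>D: "GDERIV (\<lambda>x. c x * \<eta> x) x :> Pc\<eta> x" if "x \<in> S" for x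
    unfolding Pc\<eta>_def by (intro GDERIV_mult cD \<eta>(1) that)
  have Pc\<eta>C: "continuous_on S Pc\<eta>"
    unfolding Pc\<eta>_def[abs_def] by (intro continuous_intros cont; simp)
  have Pc\<psi>D: "GDERIV (\<lambda>x. c x * \<psi> x) x :> Pc\<psi> x" if "x \<in> S" for x
    unfolding Pc\<psi>_def by (intro GDERIV_mult cD \<psi>.grad that UNIV_I)
  have Pc\<psi>C: "continuous_on S Pc\<psi>"
    unfolding Pc\<psi>_def[abs_def] by (intro continuous_intros cont; simp)
  have PXC: "continuous_on S (\<lambda>x. c x *\<^sub>R L x)"
    by (intro continuous_intros cont; simp)
  have P\<eta>FD: "GDERIV (\<lambda>x. \<eta> x * F x) x :> \<eta> x *\<^sub>R (f x *\<^sub>R G x) + F x *\<^sub>R P\<eta> x" if "x \<in> S" for x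
    by (intro GDERIV_mult \<eta>(1) FD that)
  have P\<eta>FC: "continuous_on S (\<lambda>x. \<eta> x *\<^sub>R (f x *\<^sub>R G x) + F x *\<^sub>R P\<eta> x)"
    by (intro continuous_intros cont Fc; simp)
  have s1: "c x * \<eta> x = 0" "c x * \<psi> x = 0" if "x \<in> S - K" for x using offK[OF that] by auto
  have sa: "(c x * \<eta> x) *\<^sub>R V = 0" if "x \<in> S - K" for x and V :: 'a using s1[OF that] by simp
  have sb: "(c x * \<psi> x) *\<^sub>R V = 0" if "x \<in> S - K" for x and V :: 'a using s1[OF that] by simp
  have sX: "X x *\<^sub>R P\<psi> x = 0" if "x \<in> S - K" for x using offK[OF that] by auto
  have sF: "(\<eta> x * F x) *\<^sub>R V = 0" if "x \<in> S - K" for x and V :: 'a using offK[OF that] by (auto simp: F_def)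
  note Ea = integral_stress_energy[OF S(1) K KS Pc\<eta>D Pc\<eta>C hessS s1(1), of e]
  note Ef = integral_scalar_times_field[OF S(1) K KS P\<eta>FD P\<eta>FC conste sF]
  note Eb = integral_scalar_times_field[OF S(1) K KS Pc\<psi>D Pc\<psi>C hessS(1,2) sb]
  note Ec = integral_scalar_times_field[OF S(1) K KS XD PXC hess\<psi> sX]
  note Ed = integral_scalar_times_field[OF S(1) K KS Pc\<psi>D Pc\<psi>C conste sb]
  note Ee = integral_scalar_times_field[OF S(1) K KS Pc\<eta>D Pc\<eta>C conste sa]
  \<comment> \<open>The coefficients of the error terms in \<open>force_pointwise\<close>. These
    terms are supplied by \<open>ed\<close> and \<open>ee\<close>, the identities for the constant
    field \<open>e\<close>, which trade the component of \<open>L\<close> along \<open>e\<close> in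
    the layer for gradients of \<psi> and \<eta>.\<close>
  define k1 where "k1 = \<theta>\<^sup>2 / c0\<^sup>2 + 2 * \<theta> * \<kappa> * n0 / c0"
  define k2 where "k2 = \<kappa> * C1"
  have n0: "0 \<le> n0" 
  proof -
    have "norm (n z) \<le> n0" using r by (intro \<phi>(3)) simp
    then show ?thesis using norm_ge_zero[of "n z"] by linarith
  qed
  have G00: "0 \<le> G0" if "x \<in> \<Omega>" for x using G0[OF that] norm_ge_zero[of "G x"] by linarith

  define ea where "ea x = (Pc\<eta> x \<bullet> G x) * (G x \<bullet> e) - (G x \<bullet> G x) * (Pc\<eta> x \<bullet> e) / 2
            + c x * \<eta> x * (\<Sum>b\<in>Basis. D x b \<bullet> b) * (G x \<bullet> e)" for x
  define ef where "ef x = (\<eta> x *\<^sub>R (f x *\<^sub>R G x) + F x *\<^sub>R P\<eta> x) \<bullet> e + \<eta> x * F x * (\<Sum>b\<in>Basis. (0::'a) \<bullet> b)" for x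
  define eb where "eb x = Pc\<psi> x \<bullet> G x + c x * \<psi> x * (\<Sum>b\<in>Basis. D x b \<bullet> b)" for x
  define ec where "ec x = (c x *\<^sub>R L x) \<bullet> P\<psi> x + X x * (\<Sum>b\<in>Basis. D\<psi> x b \<bullet> b)" for x
  define ed where "ed x = Pc\<psi> x \<bullet> e + c x * \<psi> x * (\<Sum>b\<in>Basis. (0::'a) \<bullet> b)" for x
  define ee where "ee x = Pc\<eta> x \<bullet> e + c x * \<eta> x * (\<Sum>b\<in>Basis. (0::'a) \<bullet> b)" for x
  have bc: "bdd_cont S ea" "bdd_cont S ef" "bdd_cont S eb" "bdd_cont S ec" "bdd_cont S ed" "bdd_cont S ee"
    unfolding ea_def[abs_def] ef_def[abs_def] eb_def[abs_def] ec_def[abs_def] ed_def[abs_def] ee_def[abs_def]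
    using Ea(1) Ef(1) Eb(1) Ec(1) Ed(1) Ee(1) by simp_all
  have i0: "integral S ea = 0" "integral S ef = 0" "integral S eb = 0" "integral S ec = 0" "integral S ed = 0" "integral S ee = 0"
    unfolding ea_def[abs_def] ef_def[abs_def] eb_def[abs_def] ec_def[abs_def] ed_def[abs_def] ee_def[abs_def]
    using Ea(2) Ef(2) Eb(2) Ec(2) Ed(2) Ee(2) by simp_all
  note int = bdd_cont_integrable[OF _ S]
  \<comment> \<open>The multipliers reproduce the expression of \<open>force_pointwise\<close> as
    the factor of \<open>c' x\<close>, and they make the terms
    \<open>c x * (G x \<bullet> P\<psi> x)\<close> of \<open>eb\<close> and \<open>ec\<close>
    cancel.\<close>
  define Q where "Q x = 2 * ea x + 2 * ef x + (- 2 * \<theta>) * eb x + 2 * \<theta> * ec x + k1 * ed x + k2 * ee x" for x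
  have Qb: "bdd_cont S Q"
    unfolding Q_def[abs_def] by (intro bdd_cont_add bdd_cont_mult[OF bdd_cont_const] bc)
  have Q0: "integral S Q = 0"
    unfolding Q_def[abs_def]
    by (simp only: integral_add integral_mult_right i0 int bdd_cont_add bdd_cont_mult bdd_cont_const bc)
  have \<psi>b: "bdd_cont S \<psi>" "bdd_cont S P\<psi>" "bdd_cont S P\<eta>" "bdd_cont S f" "bdd_cont S G"
    using \<psi>.continuous \<psi>.continuous_grad \<eta>(2) S(2) bdd_cont_subset[OF f_bdd S\<Omega>] bdd_cont_subset[OF G_bdd S\<Omega>]
    by (auto intro: bdd_cont_continuous_UNIV)
  define k3 where "k3 = 2 * \<theta> * \<kappa> * n0 + k1"
  define W where "W x = 2 * \<theta> * (\<psi> x * f x) - k3 * norm (P\<psi> x) - k2 * norm (P\<eta> x) - 3 * ((G x \<bullet> G x) * norm (P\<eta> x))" for x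
  have Wb: "bdd_cont S W"
    unfolding W_def[abs_def] by (intro bdd_cont_intros \<psi>b)
  have QW: "W x \<le> Q x" if x: "x \<in> S" for x
  proof -
    have x\<Omega>: "x \<in> \<Omega>" and xB: "x \<in> ball z r1" using x S\<Omega> SB by auto
    define T1 where "T1 = \<eta> x * (2 * (L x \<bullet> G x) * (G x \<bullet> e) - (G x \<bullet> G x) * (L x \<bullet> e)) - 2 * \<theta> * \<psi> x * (L x \<bullet> G x)
     + k1 * \<psi> x * (L x \<bullet> e) + k2 * \<eta> x * (L x \<bullet> e)"
    define T2 where "T2 = 2 * (P\<eta> x \<bullet> G x) * (G x \<bullet> e) - (G x \<bullet> G x) * (P\<eta> x \<bullet> e)
      + 2 * \<theta> * \<kappa> * (n x \<bullet> P\<psi> x) + k1 * (P\<psi> x \<bullet> e) + k2 * (P\<eta> x \<bullet> e)"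
    have Q: "Q x = c' x * T1 + c x * T2 + 2 * \<theta> * (\<psi> x * f x) + 2 * \<theta> * (X x * \<psi>.lap x)"
    proof -
      have 1: "2 * ea x + 2 * ef x = c' x * (\<eta> x * (2 * (L x \<bullet> G x) * (G x \<bullet> e) - (G x \<bullet> G x) * (L x \<bullet> e)))
          + c x * (2 * (P\<eta> x \<bullet> G x) * (G x \<bullet> e) - (G x \<bullet> G x) * (P\<eta> x \<bullet> e))"
      proof -
        have "c x * \<eta> x * (\<Sum>b\<in>Basis. D x b \<bullet> b) * (G x \<bullet> e) = - (\<eta> x * f x * (G x \<bullet> e))"
          using cf[OF x] by (simp add: trG[OF x] mult_ac)
        moreover have "ef x = \<eta> x * f x * (G x \<bullet> e)"
          using F0[OF x] by (simp add: ef_def inner_add_left del: scaleR_eq_0_iff)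
        ultimately show ?thesis
          unfolding ea_def Pc\<eta>_def by (simp add: inner_add_left algebra_simps)
      qed
      have 2: "eb x = c' x * (\<psi> x * (L x \<bullet> G x)) + c x * (P\<psi> x \<bullet> G x) - \<psi> x * f x"
        using cf[OF x] by (simp add: eb_def Pc\<psi>_def inner_add_left trG[OF x] mult_ac)
      have 3: "ec x = c x * (G x \<bullet> P\<psi> x) + \<kappa> * c x * (n x \<bullet> P\<psi> x) + X x * \<psi>.lap x"
        by (simp add: ec_def L_def \<psi>.lap_def inner_add_left algebra_simps)
      have 4: "ed x = c' x * (\<psi> x * (L x \<bullet> e)) + c x * (P\<psi> x \<bullet> e)"
        by (simp add: ed_def Pc\<psi>_def inner_add_left mult_ac)
      have 5: "ee x = c' x * (\<eta> x * (L x \<bullet> e)) + c x * (P\<eta> x \<bullet> e)"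
        by (simp add: ee_def Pc\<eta>_def inner_add_left mult_ac)
      show ?thesis
        unfolding Q_def 1 2 3 4 5 T1_def T2_def by (simp add: inner_commute[of "P\<psi> x" "G x"] algebra_simps)
    qed
    have T1: "0 \<le> c' x * T1"
    proof (cases "x \<in> cball z r2 \<and> lv x \<le> 2 * d")
      case True
      have Leq: "L x - \<kappa> *\<^sub>R n x = G x" by (simp add: L_def)
      then have "norm (L x - \<kappa> *\<^sub>R n x) \<le> G0" using G0[OF x\<Omega>] by simp
      from force_pointwise[OF c0 La[OF x conjunct1[OF True] conjunct2[OF True]] \<phi>(3)[OF xB] this e \<kappa>
          \<psi>(2)[of x] \<psi>(3)[of x] \<theta>, unfolded Leq]
      have "0 \<le> T1" unfolding T1_def k1_def k2_def C1_def .
      then show ?thesis using trunc'_nonneg[OF d(1)] by (simp add: c'_def)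
    next
      case False
      then have "T1 = 0 \<or> c' x = 0"
        using \<psi>(4)[of x] \<eta>(3)[of x] trunc'_eq_0(1)[OF d(1), of "lv x"] by (auto simp: T1_def c'_def)
      then show ?thesis by auto
    qed
    have T2: "- (3 * ((G x \<bullet> G x) * norm (P\<eta> x)) + k3 * norm (P\<psi> x) + k2 * norm (P\<eta> x)) \<le> T2"
    proof -
      have k: "0 \<le> k1" "0 \<le> k2"
        using \<theta> \<kappa> n0 c0 G00[OF x\<Omega>] by (simp_all add: k1_def k2_def C1_def)
      have i: "\<bar>y \<bullet> e\<bar> \<le> norm y" for y using Cauchy_Schwarz_ineq2[of y e] e by simp
      have "\<bar>(P\<eta> x \<bullet> G x) * (G x \<bullet> e)\<bar> \<le> (norm (P\<eta> x) * norm (G x)) * norm (G x)"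
        unfolding abs_mult by (intro mult_mono Cauchy_Schwarz_ineq2 i) auto
      also have "\<dots> = (G x \<bullet> G x) * norm (P\<eta> x)" by (simp add: dot_square_norm power2_eq_square)
      finally have 1: "- ((G x \<bullet> G x) * norm (P\<eta> x)) \<le> (P\<eta> x \<bullet> G x) * (G x \<bullet> e)" by linarith
      have 2: "(G x \<bullet> G x) * (P\<eta> x \<bullet> e) \<le> (G x \<bullet> G x) * norm (P\<eta> x)"
        using i[of "P\<eta> x"] by (intro mult_left_mono) auto
      have "\<bar>n x \<bullet> P\<psi> x\<bar> \<le> n0 * norm (P\<psi> x)"
        using Cauchy_Schwarz_ineq2[of "n x" "P\<psi> x"] mult_right_mono[OF \<phi>(3)[OF xB], of "norm (P\<psi> x)"] by simp
      then have "- (n0 * norm (P\<psi> x)) \<le> n x \<bullet> P\<psi> x" by linarith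
      then have 3: "2 * \<theta> * \<kappa> * (- (n0 * norm (P\<psi> x))) \<le> 2 * \<theta> * \<kappa> * (n x \<bullet> P\<psi> x)"
        using \<theta> \<kappa> by (intro mult_left_mono) auto
      have 4: "k1 * (- norm (P\<psi> x)) \<le> k1 * (P\<psi> x \<bullet> e)"
        using i[of "P\<psi> x"] k by (intro mult_left_mono) auto
      have 5: "k2 * (- norm (P\<eta> x)) \<le> k2 * (P\<eta> x \<bullet> e)"
        using i[of "P\<eta> x"] k by (intro mult_left_mono) auto
      show ?thesis using 1 2 3 4 5 unfolding T2_def k3_def by (simp add: algebra_simps)
    qed
    \<comment> \<open>The lower bound for \<open>T2\<close> is nonpositive, so it survives
      multiplication by \<open>c x\<close>, which lies between 0 and 1.\<close>
    have "- (3 * ((G x \<bullet> G x) * norm (P\<eta> x)) + k3 * norm (P\<psi> x) + k2 * norm (P\<eta> x)) \<le> c x * T2"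
    proof (cases "0 \<le> T2")
      case True
      then have "0 \<le> c x * T2" using c_bounds[of x] by simp
      moreover have "0 \<le> 3 * ((G x \<bullet> G x) * norm (P\<eta> x)) + k3 * norm (P\<psi> x) + k2 * norm (P\<eta> x)"
        using \<theta> \<kappa> n0 c0 G00[OF x\<Omega>] by (simp add: k1_def k2_def k3_def C1_def)
      ultimately show ?thesis by linarith
    next
      case False
      then have "T2 \<le> c x * T2" using mult_right_mono_neg[OF c_bounds(2), of T2 x] by simp
      then show ?thesis using T2 by linarith
    qed
    moreover have "0 \<le> 2 * \<theta> * (X x * \<psi>.lap x)"
      using \<theta> \<psi>(5)[OF x] truncint_nonneg[OF d(1)] by (simp add: X_def)
    ultimately show ?thesis using T1 unfolding Q W_def by linarith
  qed
  have "integral S W \<le> 0"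
    using integral_le[OF int[OF Wb] int[OF Qb] QW] Q0 by simp
  moreover have "integral S W = 2 * \<theta> * integral S (\<lambda>x. \<psi> x * f x) - k3 * integral S (\<lambda>x. norm (P\<psi> x))
      - k2 * integral S (\<lambda>x. norm (P\<eta> x)) - 3 * integral S (\<lambda>x. (G x \<bullet> G x) * norm (P\<eta> x))"
    unfolding W_def[abs_def]
    by (subst integral_diff integral_mult_right, (intro int bdd_cont_intros \<psi>b)+)+ (simp only: integral_mult_right)
  ultimately show ?thesis
    unfolding k1_def k2_def k3_def C1_def by (simp add: algebra_simps)
qed

text \<open>Letting \<kappa> tend to 0 removes the right side of
  \<open>force_inequality_aux\<close>. What is left is quadratic in \<theta>, and its optimum is the
  Cauchy-Schwarz inequality, with the integral of \<open>norm (P\<psi> x)\<close> in the role of the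
  area of the boundary patch.\<close>

lemma force_inequality:
  "c0\<^sup>2 * (integral S (\<lambda>x. \<psi> x * f x))\<^sup>2 \<le>
    3 * integral S (\<lambda>x. norm (P\<psi> x)) * integral S (\<lambda>x. (G x \<bullet> G x) * norm (P\<eta> x))"
proof -
  define I where "I = integral S (\<lambda>x. \<psi> x * f x)"
  define A where "A = integral S (\<lambda>x. norm (P\<psi> x))"
  define T where "T = integral S (\<lambda>x. (G x \<bullet> G x) * norm (P\<eta> x))"
  interpret \<psi>: C2_fun UNIV \<psi> P\<psi> D\<psi> by fact
  have S: "open S" "bounded S" "S \<subseteq> \<Omega>" using open_dom bounded_dom by (auto simp: S_def)
  note int = bdd_cont_integrable[OF _ S(1,2)]
  have \<psi>b: "bdd_cont S \<psi>" "bdd_cont S P\<psi>" "bdd_cont S P\<eta>" "bdd_cont S f" "bdd_cont S G"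
    using \<psi>.continuous \<psi>.continuous_grad \<eta>(2) S(2) bdd_cont_subset[OF f_bdd S(3)] bdd_cont_subset[OF G_bdd S(3)]
    by (auto intro: bdd_cont_continuous_UNIV)
  have I0: "0 \<le> I" unfolding I_def
    by (intro integral_nonneg int bdd_cont_intros \<psi>b mult_nonneg_nonneg \<psi>(2) f_nonneg)
  have A0: "0 \<le> A" unfolding A_def
    by (intro integral_nonneg int bdd_cont_intros \<psi>b norm_ge_zero)
  have T0: "0 \<le> T" unfolding T_def
    by (intro integral_nonneg int bdd_cont_intros \<psi>b mult_nonneg_nonneg inner_ge_zero norm_ge_zero)
  obtain G0 where G0: "\<And>x. x \<in> \<Omega> \<Longrightarrow> norm (G x) \<le> G0"
    using bdd_contD(2)[OF G_bdd] by (auto simp: bounded_iff)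
  have main: "2 * \<theta> * I - \<theta>\<^sup>2 / c0\<^sup>2 * A \<le> 3 * T" if \<theta>: "0 < \<theta>" for \<theta>
  proof -
    define C where "C = (2 * \<theta> * n0 + 2 * \<theta> * n0 / c0) * A
      + (2 * n0 * (G0 + n0) / c0 + 2 * n0\<^sup>2 / c0 + n0\<^sup>2) * integral S (\<lambda>x. norm (P\<eta> x))"
    have "2 * \<theta> * I - \<theta>\<^sup>2 / c0\<^sup>2 * A - 3 * T \<le> 0 + y" if "0 < y" for y
    proof -
      define \<kappa> where "\<kappa> = min 1 (y / (\<bar>C\<bar> + 1))"
      have \<kappa>: "0 < \<kappa>" "\<kappa> \<le> 1" "\<kappa> \<le> y / (\<bar>C\<bar> + 1)" using that by (simp_all add: \<kappa>_def add_nonneg_pos)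
      have "2 * \<theta> * I - \<theta>\<^sup>2 / c0\<^sup>2 * A - 3 * T \<le> \<kappa> * C"
        unfolding I_def A_def T_def C_def by (rule force_inequality_aux[OF \<theta> \<kappa>(1,2) G0])
      also have "\<dots> \<le> \<kappa> * (\<bar>C\<bar> + 1)" using \<kappa> by (intro mult_left_mono) auto
      also have "\<dots> \<le> y" using \<kappa>(3) by (simp add: field_simps)
      finally show ?thesis by simp
    qed
    then show ?thesis using field_le_epsilon[of "2 * \<theta> * I - \<theta>\<^sup>2 / c0\<^sup>2 * A - 3 * T" 0] by simp
  qed
  have "c0\<^sup>2 * I\<^sup>2 \<le> 3 * A * T"
  proof (cases "I = 0")
    case False
    then have I: "0 < I" using I0 by simp
    have "A \<noteq> 0"
    proof
      assume "A = 0"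
      \<comment> \<open>For \<open>A = 0\<close> the inequality is linear in \<theta> and fails for
        this large value.\<close>
      then have "2 * ((3 * T + 1) / I) * I \<le> 3 * T" using main[of "(3 * T + 1) / I"] I T0 by simp
      then show False using I T0 by simp
    qed
    then have A: "0 < A" using A0 by simp
    \<comment> \<open>The maximizer of \<open>2 * \<theta> * I\<close> minus the quadratic
      term.\<close>
    define \<theta> where "\<theta> = c0\<^sup>2 * I / A"
    have "0 < \<theta>" using c0 I A by (simp add: \<theta>_def)
    moreover have "\<theta>\<^sup>2 / c0\<^sup>2 * A = \<theta> * I"
      using c0 A by (simp add: \<theta>_def power2_eq_square)
    ultimately have "2 * \<theta> * I - \<theta> * I \<le> 3 * T" using main[of \<theta>] by (simp only:)
    then have "\<theta> * I \<le> 3 * T" by (simp add: algebra_simps)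
    then show ?thesis using A by (simp add: \<theta>_def field_simps power2_eq_square)
  qed (use A0 T0 in simp)
  then show ?thesis unfolding I_def A_def T_def .
qed

end

end

section \<open>Test functions and scales\<close>

context semilinear
begin

text \<open>If each of the \<open>K\<close> annuli contained a point with u > 1, the concentration
  balls of these points would be disjoint and carry total mass at least \<open>real K * m\<close>.
  The index starts at 1 so that the chosen scale exceeds \<open>d\<close> by at least one factor
  \<open>A\<close>.\<close>

lemma free_annulus:
  assumes d: "0 < d" and A: "64 \<le> A" and s: "s \<le> d / 8" and m: "0 < m"
    and conc: "\<And>y. y \<in> \<Omega> \<Longrightarrow> 1 < u y \<Longrightarrow> m \<le> integral (ball y s \<inter> \<Omega>) f"
    and K: "integral \<Omega> f < real K * m"
  obtains k where "1 \<le> k" "k \<le> K" "\<And>y. y \<in> \<Omega> \<Longrightarrow> d * A ^ k / 4 < dist y x \<Longrightarrow> dist y x < 4 * (d * A ^ k) \<Longrightarrow> u y \<le> 1"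
proof (rule ccontr)
  assume "\<not> thesis"
  then have "\<forall>k\<in>{1..K}. \<exists>y. y \<in> \<Omega> \<and> d * A ^ k / 4 < dist y x \<and> dist y x < 4 * (d * A ^ k) \<and> 1 < u y"
    using that by (metis atLeastAtMost_iff not_le)
  then obtain y where y: "\<And>k. k \<in> {1..K} \<Longrightarrow> y k \<in> \<Omega> \<and> d * A ^ k / 4 < dist (y k) x \<and> dist (y k) x < 4 * (d * A ^ k) \<and> 1 < u (y k)"
    by metis
  \<comment> \<open>With unit \<open>d * A ^ i\<close>, the ball in the i-th annulus ends before 4 +
    1/8, whereas the ball in a later annulus begins after 16 - 1/8, because \<open>A\<close> is at
    least 64.\<close>
  have disj: False if ij: "i \<in> {1..K}" "j \<in> {1..K}" "i < j" and w: "w \<in> ball (y i) s" "w \<in> ball (y j) s" for i j w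
  proof -
    have "A * A ^ i \<le> A ^ j" using ij A power_increasing[of "Suc i" j A] by simp
    moreover have "64 * A ^ i \<le> A * A ^ i" using A by (intro mult_right_mono) auto
    ultimately have "d * (64 * A ^ i) \<le> d * A ^ j" using d by (intro mult_left_mono) auto
    moreover have "1 \<le> A ^ i" using A by (intro one_le_power) auto
    then have "d * 1 \<le> d * A ^ i" using d by (intro mult_left_mono) auto
    moreover have "dist w x < 4 * (d * A ^ i) + d / 8"
      using y[OF ij(1)] w(1) s dist_triangle[of w x "y i"] by (auto simp: dist_commute)
    moreover have "d * A ^ j / 4 - d / 8 < dist w x"
      using y[OF ij(2)] w(2) s dist_triangle[of "y j" x w] by (auto simp: dist_commute)
    ultimately show False using d by linarith
  qed
  define g where "g k w = (if w \<in> ball (y k) s then f w else 0)" for k w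
  have gi: "g k integrable_on \<Omega>" for k
    unfolding g_def[abs_def] integrable_restrict_Int by (rule integrable_ball[OF f_bdd])
  have "real K * m = (\<Sum>k=1..K. m)" by simp
  also have "\<dots> \<le> (\<Sum>k=1..K. integral \<Omega> (g k))"
  proof (rule sum_mono)
    fix k assume "k \<in> {1..K}"
    then show "m \<le> integral \<Omega> (g k)"
      unfolding g_def[abs_def] integral_restrict_Int using conc y by blast
  qed
  also have "\<dots> = integral \<Omega> (\<lambda>w. \<Sum>k=1..K. g k w)"
    by (rule integral_sum[symmetric]) (auto intro: gi)
  also have "\<dots> \<le> integral \<Omega> f"
  proof (intro integral_le integrable_sum gi integrable f_bdd finite_atLeastAtMost)
    fix w assume "w \<in> \<Omega>"
    show "(\<Sum>k=1..K. g k w) \<le> f w"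
    proof (cases "\<exists>j\<in>{1..K}. w \<in> ball (y j) s")
      case True
      then obtain j where j: "j \<in> {1..K}" "w \<in> ball (y j) s" by blast
      have "g k w = (if k = j then f w else 0)" if "k \<in> {1..K}" for k
        using disj[OF that j(1) _ _ j(2)] disj[OF j(1) that _ j(2)] j(2) by (cases k j rule: linorder_cases) (auto simp: g_def)
      then have "(\<Sum>k=1..K. g k w) = (\<Sum>k=1..K. if k = j then f w else 0)" by (rule sum.cong[OF refl])
      also have "\<dots> = f w" using j(1) by simp
      finally show ?thesis by simp
    next
      case False
      then have "(\<Sum>k=1..K. g k w) = 0" by (intro sum.neutral) (auto simp: g_def)
      then show ?thesis using f_nonneg[of w] by simp
    qed
  qed
  finally show False using K by simp
qed

end

section \<open>Radial test functions on annuli and next to the boundary\<close>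

text \<open>The zeros 1/4 and 9 of the quadratic in the squared relative distance are the radii
  \<open>r / 2\<close> and \<open>3 * r\<close>; squaring the positive part makes the function
  C^1.\<close>

definition annulus_bump :: "real \<Rightarrow> 'a::euclidean_space \<Rightarrow> 'a \<Rightarrow> real" where
  "annulus_bump r a x = pospart (((x - a) \<bullet> (x - a) / r\<^sup>2 - 1 / 4) * (9 - (x - a) \<bullet> (x - a) / r\<^sup>2)) ^ 2"

definition annulus_bump_grad :: "real \<Rightarrow> 'a::euclidean_space \<Rightarrow> 'a \<Rightarrow> 'a" where
  "annulus_bump_grad r = radial_grad (\<lambda>t. 2 * pospart ((t / r\<^sup>2 - 1 / 4) * (9 - t / r\<^sup>2)) * ((37 / 4 - 2 * (t / r\<^sup>2)) / r\<^sup>2))"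

lemma annulus_bump:
  fixes a :: "'a::euclidean_space"
  assumes r: "0 < r"
  shows "GDERIV (annulus_bump r a) x :> annulus_bump_grad r a x" and "continuous_on UNIV (annulus_bump_grad r a)"
    and "r \<le> dist x a \<Longrightarrow> dist x a \<le> 2 * r \<Longrightarrow> 1 \<le> (annulus_bump r a x)\<^sup>2"
    and "dist x a \<le> r / 2 \<or> 3 * r \<le> dist x a \<Longrightarrow> annulus_bump r a x = 0 \<and> annulus_bump_grad r a x = 0"
    and "annulus_bump_grad r a x \<bullet> annulus_bump_grad r a x \<le> (9000 / r)\<^sup>2"
proof -
  let ?h = "\<lambda>t. (t / r\<^sup>2 - 1 / 4) * (9 - t / r\<^sup>2)"
  let ?g' = "\<lambda>t. 2 * pospart (?h t) * ((37 / 4 - 2 * (t / r\<^sup>2)) / r\<^sup>2)"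
  have d: "((\<lambda>t. pospart (?h t) ^ 2) has_real_derivative ?g' t) (at t)" for t
  proof -
    have "(?h has_real_derivative (37 / 4 - 2 * (t / r\<^sup>2)) / r\<^sup>2) (at t)"
    proof -
      have aux: "1 / B * (9 - y) + - 1 / B * (y - 1 / 4) = (37 / 4 - 2 * y) / B" if "B \<noteq> 0" for B y :: real
        using that by (simp add: field_simps)
      have 1: "((\<lambda>t. t / r\<^sup>2 - 1 / 4) has_real_derivative 1 / r\<^sup>2) (at t)"
        "((\<lambda>t. 9 - t / r\<^sup>2) has_real_derivative - 1 / r\<^sup>2) (at t)"
        using r by (auto intro!: derivative_eq_intros simp: power2_eq_square)
      show ?thesis
        by (rule DERIV_cong[OF DERIV_mult[OF 1]]) (use aux[of "r\<^sup>2" "t / r\<^sup>2"] r in \<open>simp add: mult.commute\<close>)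
    qed
    from pospart_power_deriv'[OF this, of 0] show ?thesis by (simp add: numeral_2_eq_2)
  qed
  show "GDERIV (annulus_bump r a) x :> annulus_bump_grad r a x"
    unfolding annulus_bump_def[abs_def] annulus_bump_grad_def by (rule GDERIV_radial) (rule d)
  have c: "continuous_on UNIV ?g'"
    using r by (intro continuous_intros) auto
  show "continuous_on UNIV (annulus_bump_grad r a)"
    unfolding annulus_bump_grad_def radial_grad_def[abs_def]
    by (intro continuous_intros continuous_on_compose2[OF c]) auto
  define q where "q = (x - a) \<bullet> (x - a) / r\<^sup>2"
  have q: "q = (dist x a / r)\<^sup>2" by (simp add: q_def sqdist power_divide)
  show "1 \<le> (annulus_bump r a x)\<^sup>2" if "r \<le> dist x a" "dist x a \<le> 2 * r"
  proof -
    have "1 \<le> dist x a / r" "dist x a / r \<le> 2" using that r by (simp_all add: field_simps)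
    then have "1\<^sup>2 \<le> q" "q \<le> 2\<^sup>2" unfolding q using r by (intro power_mono; simp)+
    then have "1 / 2 * 2 \<le> (q - 1 / 4) * (9 - q)" by (intro mult_mono) auto
    then have "1 \<le> pospart ((q - 1 / 4) * (9 - q))" unfolding pospart_def le_max_iff_disj by simp
    then show ?thesis unfolding annulus_bump_def q_def[symmetric] by (intro one_le_power)
  qed
  have h0: "?h ((x - a) \<bullet> (x - a)) \<le> 0" if "dist x a \<le> r / 2 \<or> 3 * r \<le> dist x a"
    using that
  proof
    assume "dist x a \<le> r / 2"
    then have "dist x a / r \<le> 1 / 2" using r by (simp add: field_simps)
    then have "q \<le> (1 / 2)\<^sup>2" unfolding q using r by (intro power_mono) auto
    then have "q \<le> 1 / 4" by (simp add: power2_eq_square)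
    then show ?thesis unfolding q_def[symmetric] by (intro mult_nonpos_nonneg) auto
  next
    assume "3 * r \<le> dist x a"
    then have "3 \<le> dist x a / r" using r by (simp add: field_simps)
    then have "3\<^sup>2 \<le> q" unfolding q by (intro power_mono) auto
    then show ?thesis unfolding q_def[symmetric] by (intro mult_nonneg_nonpos) auto
  qed
  then show out: "annulus_bump r a x = 0 \<and> annulus_bump_grad r a x = 0" if "dist x a \<le> r / 2 \<or> 3 * r \<le> dist x a"
    using that by (simp add: annulus_bump_def annulus_bump_grad_def radial_grad_def)
  have "norm (annulus_bump_grad r a x) \<le> 9000 / r"
  proof (cases "dist x a \<le> r / 2 \<or> 3 * r \<le> dist x a")
    case False
    then have "1 / 2 \<le> dist x a / r" "dist x a / r \<le> 3" using r by (simp_all add: field_simps)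
    then have "(1 / 2)\<^sup>2 \<le> q" "q \<le> 3\<^sup>2" unfolding q using r by (intro power_mono; simp)+
    then have q': "1 / 4 \<le> q" "q \<le> 9" by (simp_all add: power2_eq_square)
    have "(q - 1 / 4) * (9 - q) \<le> 9 * 9" using q' by (intro mult_mono) auto
    then have p: "pospart ((q - 1 / 4) * (9 - q)) \<le> 81" by (simp add: pospart_def)
    have "norm (annulus_bump_grad r a x)
        = 2 * (2 * pospart ((q - 1 / 4) * (9 - q)) * (\<bar>37 / 4 - 2 * q\<bar> / r\<^sup>2)) * dist x a"
      by (simp add: annulus_bump_grad_def norm_radial_grad q_def abs_mult)
    \<comment> \<open>The factors are 81 for the bump's base and 9 for its slope in the squared
      distance; the product is 8748 / r, rounded up to 9000 / r.\<close>
    also have "\<dots> \<le> 2 * (2 * 81 * (9 / r\<^sup>2)) * (3 * r)"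
      using False r q' p by (intro mult_mono divide_right_mono) auto
    also have "\<dots> \<le> 9000 / r" using r by (simp add: field_simps power2_eq_square)
    finally show ?thesis .
  qed (use out r in simp)
  then have "(norm (annulus_bump_grad r a x))\<^sup>2 \<le> (9000 / r)\<^sup>2" by (rule power_mono) simp
  then show "annulus_bump_grad r a x \<bullet> annulus_bump_grad r a x \<le> (9000 / r)\<^sup>2"
    by (simp add: dot_square_norm)
qed

text \<open>Subharmonic off a small ball around its centre once the exponent is large; the centre will lie outside the domain.\<close>

definition bump :: "nat \<Rightarrow> real \<Rightarrow> 'a::euclidean_space \<Rightarrow> 'a \<Rightarrow> real" where
  "bump k d a x = pospart (1 - (x - a) \<bullet> (x - a) / (16 * d\<^sup>2)) ^ (k + 3)"

definition bump_grad :: "nat \<Rightarrow> real \<Rightarrow> 'a::euclidean_space \<Rightarrow> 'a \<Rightarrow> 'a" where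
  "bump_grad k d = radial_grad (\<lambda>t. - real (k + 3) * pospart (1 - t / (16 * d\<^sup>2)) ^ (k + 2) / (16 * d\<^sup>2))"

definition bump_hess :: "nat \<Rightarrow> real \<Rightarrow> 'a::euclidean_space \<Rightarrow> 'a \<Rightarrow> 'a \<Rightarrow> 'a" where
  "bump_hess k d = radial_hess (\<lambda>t. - real (k + 3) * pospart (1 - t / (16 * d\<^sup>2)) ^ (k + 2) / (16 * d\<^sup>2))
    (\<lambda>t. real (k + 3) * real (k + 2) * pospart (1 - t / (16 * d\<^sup>2)) ^ (k + 1) / (16 * d\<^sup>2)\<^sup>2)"

text \<open>Write q for the squared distance and P for the base of the power. The Laplacian is a
  nonnegative multiple of \<open>P ^ (k + 1) * (real (k + 2) * q - 8 * N * d ^ 2 * P)\<close>, and P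
  is at most 1. The exponent \<open>k + 3\<close> leaves a continuous second derivative; 7/16 is the
  value of P at distance \<open>3 * d\<close>.\<close>

lemma bump:
  fixes a :: "'a::euclidean_space"
  assumes d: "0 < d"
  shows "C2_fun S (bump k d a) (bump_grad k d a) (bump_hess k d a)"
    and "0 \<le> bump k d a x" and "bump k d a x \<le> 1"
    and "4 * d \<le> dist x a \<Longrightarrow> bump k d a x = 0 \<and> bump_grad k d a x = 0"
    and "dist x a \<le> 3 * d \<Longrightarrow> (7 / 16) ^ (k + 3) \<le> bump k d a x"
    and "norm (bump_grad k d a x) \<le> real (k + 3) / (2 * d)"
    and "c * d \<le> dist x a \<Longrightarrow> 0 < c \<Longrightarrow> 8 * real DIM('a) \<le> real (k + 2) * c\<^sup>2 \<Longrightarrow> 0 \<le> C2_fun.lap (bump_hess k d a) x"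
proof -
  let ?D = "16 * d\<^sup>2"
  let ?p = "\<lambda>t. pospart (1 - t / ?D)"
  have D: "0 < ?D" using d by simp
  have lin: "((\<lambda>t. 1 - t / ?D) has_real_derivative - 1 / ?D) (at t)" for t
    using d by (auto intro!: derivative_eq_intros simp: power2_eq_square)
  have e: "k + 3 = Suc (Suc (k + 1))" "k + 2 = Suc (Suc k)" by simp_all
  have g1: "((\<lambda>t. ?p t ^ (k + 3)) has_real_derivative - real (k + 3) * ?p t ^ (k + 2) / ?D) (at t)" for t
    unfolding e(1) by (rule DERIV_cong[OF pospart_power_deriv'[OF lin]]) (simp add: e(2) del: of_nat_Suc of_nat_add power_Suc)
  have g2: "((\<lambda>t. - real (k + 3) * ?p t ^ (k + 2) / ?D) has_real_derivative
      real (k + 3) * real (k + 2) * ?p t ^ (k + 1) / ?D\<^sup>2) (at t)" for t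
  proof -
    have "((\<lambda>t. (- real (k + 3) / ?D) * ?p t ^ (k + 2)) has_real_derivative
        (- real (k + 3) / ?D) * (real (k + 2) * ?p t ^ (k + 1) * (- 1 / ?D))) (at t)"
      using DERIV_cmult[OF pospart_power_deriv'[OF lin, of k t], of "- real (k + 3) / ?D"] unfolding e(2) by simp
    moreover have "(- real (k + 3) / ?D) * (real (k + 2) * ?p t ^ (k + 1) * (- 1 / ?D))
        = real (k + 3) * real (k + 2) * ?p t ^ (k + 1) / ?D\<^sup>2"
    proof -
      have aux: "(- a / B) * (b * P * (- 1 / B)) = a * b * P / B\<^sup>2" for a b P B :: real
        by (simp add: power2_eq_square)
      show ?thesis by (rule aux)
    qed
    ultimately have "((\<lambda>t. (- real (k + 3) / ?D) * ?p t ^ (k + 2)) has_real_derivative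
        real (k + 3) * real (k + 2) * ?p t ^ (k + 1) / ?D\<^sup>2) (at t)" by (simp only:)
    then show ?thesis by (simp only: times_divide_eq_left)
  qed
  have g3: "continuous_on {0..} (\<lambda>t. real (k + 3) * real (k + 2) * ?p t ^ (k + 1) / ?D\<^sup>2)"
    using d by (intro continuous_intros) auto
  note C = C2_fun_radial[of "\<lambda>t. ?p t ^ (k + 3)" "\<lambda>t. - real (k + 3) * ?p t ^ (k + 2) / ?D"
      "\<lambda>t. real (k + 3) * real (k + 2) * ?p t ^ (k + 1) / ?D\<^sup>2", OF g1 g2 g3]
  show "C2_fun S (bump k d a) (bump_grad k d a) (bump_hess k d a)"
    unfolding bump_def[abs_def] bump_grad_def bump_hess_def by (rule C(1))
  define q where "q = (x - a) \<bullet> (x - a)"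
  have q: "q = (dist x a)\<^sup>2" by (simp add: q_def sqdist)
  have p1: "0 \<le> ?p q" "?p q \<le> 1" using D by (simp_all add: pospart_def q)
  show "0 \<le> bump k d a x" "bump k d a x \<le> 1"
    unfolding bump_def q_def[symmetric] using p1 by (simp_all add: power_le_one)
  have p0: "?p q = 0" if "4 * d \<le> dist x a"
  proof -
    have "(4 * d)\<^sup>2 \<le> q" unfolding q using that d by (intro power_mono) auto
    then have "1 \<le> q / ?D" using d by (simp add: power_mult_distrib)
    then show ?thesis by simp
  qed
  show out: "bump k d a x = 0 \<and> bump_grad k d a x = 0" if "4 * d \<le> dist x a"
    using p0[OF that] by (simp add: bump_def bump_grad_def radial_grad_def q_def)
  show "(7 / 16) ^ (k + 3) \<le> bump k d a x" if "dist x a \<le> 3 * d"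
  proof -
    have "q \<le> (3 * d)\<^sup>2" unfolding q using that by (intro power_mono) auto
    then have "q / ?D \<le> 9 / 16" using d by (simp add: power_mult_distrib field_simps)
    then have "7 / 16 \<le> ?p q" unfolding pospart_def le_max_iff_disj by linarith
    then show ?thesis unfolding bump_def q_def[symmetric] by (intro power_mono) auto
  qed
  show "norm (bump_grad k d a x) \<le> real (k + 3) / (2 * d)"
  proof (cases "4 * d \<le> dist x a")
    case False
    have "norm (bump_grad k d a x) = 2 * (real (k + 3) * ?p q ^ (k + 2) / ?D) * dist x a"
      using p1 by (simp add: bump_grad_def norm_radial_grad q_def abs_mult)
    also have "\<dots> \<le> 2 * (real (k + 3) * 1 / ?D) * (4 * d)"
      using False p1 d by (intro mult_mono divide_right_mono power_le_one) auto
    also have "\<dots> = real (k + 3) / (2 * d)" using d by (simp add: field_simps power2_eq_square)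
    finally show ?thesis .
  qed (use out d in simp)
  show "0 \<le> C2_fun.lap (bump_hess k d a) x" if c: "c * d \<le> dist x a" "0 < c" "8 * real DIM('a) \<le> real (k + 2) * c\<^sup>2"
  proof -
    have "(c * d)\<^sup>2 \<le> q" unfolding q using c d by (intro power_mono) auto
    then have "real (k + 2) * (c\<^sup>2 * d\<^sup>2) \<le> real (k + 2) * q" by (intro mult_left_mono) (auto simp: power_mult_distrib)
    moreover have "8 * real DIM('a) * d\<^sup>2 \<le> real (k + 2) * c\<^sup>2 * d\<^sup>2" using c by (intro mult_right_mono) auto
    ultimately have le: "8 * real DIM('a) * d\<^sup>2 \<le> real (k + 2) * q"
      unfolding mult.assoc by linarith
    have "C2_fun.lap (bump_hess k d a) x = 2 * real DIM('a) * (- real (k + 3) * ?p q ^ (k + 2) / ?D)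
        + 4 * q * (real (k + 3) * real (k + 2) * ?p q ^ (k + 1) / ?D\<^sup>2)"
      unfolding bump_hess_def C(2) q_def ..
    also have "\<dots> = real (k + 3) * ?p q ^ (k + 1) * 4 / ?D\<^sup>2 * (real (k + 2) * q - 8 * real DIM('a) * d\<^sup>2 * ?p q)"
    proof -
      have aux: "2 * N * (- a * P ^ (k + 2) / B) + 4 * q * (a * b * P ^ (k + 1) / B\<^sup>2)
          = a * P ^ (k + 1) * 4 / B\<^sup>2 * (b * q - N / 2 * B * P)" if "B \<noteq> 0" for a b P B N :: real
        using that by (simp add: field_simps power2_eq_square)
      have "8 * real DIM('a) * d\<^sup>2 = real DIM('a) / 2 * ?D" by simp
      then show ?thesis using aux[of ?D "real DIM('a)" "real (k + 3)" "?p q" "real (k + 2)"] D by simp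
    qed
    also have "0 \<le> \<dots>"
    proof -
      have "8 * real DIM('a) * d\<^sup>2 * ?p q \<le> 8 * real DIM('a) * d\<^sup>2"
        using p1 by (intro mult_left_le) auto
      then have 1: "0 \<le> real (k + 2) * q - 8 * real DIM('a) * d\<^sup>2 * ?p q" using le by linarith
      have "0 \<le> real (k + 3) * ?p q ^ (k + 1) * 4 / ?D\<^sup>2" using p1 by simp
      then show ?thesis using 1 by (rule mult_nonneg_nonneg)
    qed
    finally show ?thesis .
  qed
qed

section \<open>Exclusion of spikes near one boundary point\<close>

text \<open>All constants precede the solution, which makes the exclusion uniform and free of any
  limit argument. The order of choice matters: \<open>k\<close> from the cone and \<open>K\<close>
  from the mass, then \<open>A\<close>, and the admissible distance \<open>\<rho>0\<close> last,
  since it depends on \<open>A ^ K\<close>.\<close>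

lemma no_boundary_spike:
  fixes \<Omega> :: "'a::euclidean_space set" and n :: "'a \<Rightarrow> 'a" and r1 c0 b n0 p C0 :: real
  assumes N: "2 < DIM('a)" and p: "1 < p" "p * (real DIM('a) - 2) < real DIM('a)" and C0: "0 < C0"
    and open\<Omega>: "open \<Omega>" and z: "z \<in> frontier \<Omega>" and r1: "0 < r1"
    and \<phi>: "\<And>x. x \<in> ball z r1 \<Longrightarrow> GDERIV \<phi> x :> n x" "continuous_on (ball z r1) n"
      "\<And>x. x \<in> ball z r1 \<Longrightarrow> norm (n x) \<le> n0"
    and dom: "\<And>x. x \<in> ball z r1 \<Longrightarrow> x \<in> \<Omega> \<longleftrightarrow> 0 < \<phi> x"
    and e: "norm e = 1" and b: "0 < b" and c0: "0 < c0"
    and cone: "\<And>x e'. x \<in> ball z r1 \<Longrightarrow> norm (e' - e) \<le> c0 \<Longrightarrow> b \<le> n x \<bullet> e'"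
  shows "\<exists>\<rho>0>0. \<exists>\<Lambda>>0. \<forall>u G D \<mu> \<epsilon> x. semilinear \<Omega> u G D p \<mu> \<longrightarrow> 0 < \<epsilon> \<longrightarrow> \<mu> * \<epsilon>\<^sup>2 = 1 \<longrightarrow>
     integral \<Omega> (semilinear.f u p \<mu>) \<le> C0 * \<epsilon> ^ (DIM('a) - 2) \<longrightarrow> x \<in> \<Omega> \<longrightarrow> 1 < u x \<longrightarrow>
     dist x z < \<rho>0 \<longrightarrow> \<not> \<Lambda> * \<epsilon> \<le> infdist x (frontier \<Omega>)"
proof -
  obtain s where s: "DIM('a) = s + 2" using N by (metis add.commute less_imp_le_nat le_Suc_ex)
  define V where "V = measure lborel (ball (0::'a) 1)"
  have V: "0 < V" unfolding V_def by (rule content_ball_pos) simp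
  obtain C where C: "0 < C" and pot: "\<And>(\<Omega>::'a set) u G D p \<mu> x r R F. semilinear \<Omega> u G D p \<mu> \<Longrightarrow> x \<in> \<Omega> \<Longrightarrow> 0 < r \<Longrightarrow> r \<le> R \<Longrightarrow> 0 \<le> F \<Longrightarrow>
     (\<forall>y\<in>ball x r \<inter> \<Omega>. semilinear.f u p \<mu> y \<le> F) \<Longrightarrow>
     u x \<le> C * (F * r\<^sup>2 + integral (ball x R \<inter> \<Omega>) (semilinear.f u p \<mu>) / r ^ (DIM('a) - 2)
                + integral \<Omega> (semilinear.f u p \<mu>) / R ^ (DIM('a) - 2))"
    using potential_bound[OF N] by blast
  obtain R m0 where R: "0 < R" and m0: "0 < m0" and conc: "\<And>(\<Omega>::'a set) u G D \<mu> \<epsilon> x. semilinear \<Omega> u G D p \<mu> \<Longrightarrow> 0 < \<epsilon> \<Longrightarrow> \<mu> * \<epsilon>\<^sup>2 = 1 \<Longrightarrow>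
     integral \<Omega> (semilinear.f u p \<mu>) \<le> C0 * \<epsilon> ^ (DIM('a) - 2) \<Longrightarrow> x \<in> \<Omega> \<Longrightarrow> 1 < u x \<Longrightarrow>
     m0 * \<epsilon> ^ (DIM('a) - 2) \<le> integral (ball x (R * \<epsilon>) \<inter> \<Omega>) (semilinear.f u p \<mu>)"
    using concentration[OF N p C0] by metis
  \<comment> \<open>Large enough for the bump to be subharmonic at distance at least
    \<open>c0 * d\<close> from its centre.\<close>
  obtain k where k: "8 * real DIM('a) / c0\<^sup>2 \<le> real k" using real_arch_simple by blast
  have k': "8 * real DIM('a) \<le> real (k + 2) * c0\<^sup>2"
  proof -
    have "8 * real DIM('a) \<le> real k * c0\<^sup>2" using k c0 by (simp add: field_simps)
    also have "\<dots> \<le> real (k + 2) * c0\<^sup>2" by (intro mult_right_mono) auto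
    finally show ?thesis .
  qed
  obtain K where K: "C0 < real K * m0" using reals_Archimedean3[OF m0] by blast
  \<comment> \<open>\<open>c1\<close> stems from the lower bound for the flux. \<open>cA\<close>
    bounds the integral of the bump's gradient in units of \<open>d ^ (N - 1)\<close>.
    \<open>cT\<close> bounds the force on the annulus in units of
    \<open>E ^ 2 / \<rho> ^ (N - 1)\<close>: 12 is 3 from the cutoff times 4 from Caccioppoli,
    followed by the squared size of u, the squared slope 9000 and the volume of the ball of radius
    \<open>3 * \<rho>\<close>.\<close>
  define c1 where "c1 = c0\<^sup>2 * ((7 / 16) ^ (k + 3) * m0)\<^sup>2"
  define cA where "cA = real (k + 3) / 2 * 4 ^ (s + 2) * V"
  define cT where "cT = 12 * (2 * C * C0 * 4 ^ s)\<^sup>2 * 9000\<^sup>2 * 3 ^ (s + 2) * V"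
  have c1: "0 < c1" using c0 m0 by (simp add: c1_def)
  have cA: "0 < cA" using V by (simp add: cA_def add_pos_nonneg)
  have cT: "0 < cT" using V C C0 by (simp add: cT_def)
  define A where "A = max 64 (3 * cA * cT / c1 + 1)"
  have A: "64 \<le> A" "3 * cA * cT < c1 * A"
  proof -
    show "64 \<le> A" by (simp add: A_def)
    have "3 * cA * cT / c1 < A" by (simp add: A_def less_max_iff_disj)
    then show "3 * cA * cT < c1 * A" using c1 by (simp add: field_simps)
  qed
  \<comment> \<open>Even the largest scale, \<open>d * A ^ K\<close>, is then below r1/6, and the
    ball of radius \<open>2 * \<rho>\<close> around the spike stays in half of the chart.\<close>
  define \<rho>0 where "\<rho>0 = r1 / (6 * A ^ K)"
  have AK: "1 \<le> A ^ K" using A by (intro one_le_power) simp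
  have \<rho>0: "0 < \<rho>0" using r1 A by (simp add: \<rho>0_def)
  have \<rho>0K: "\<rho>0 * A ^ K = r1 / 6" using A by (simp add: \<rho>0_def)
  show ?thesis
  proof (rule exI[of _ "\<rho>0 / 64"], intro conjI, use \<rho>0 in simp, rule exI[of _ "8 * R"], intro conjI allI impI notI)
    show "0 < 8 * R" using R by simp
    fix u G D \<mu> \<epsilon> x
    assume sl: "semilinear \<Omega> u G D p \<mu>" and \<epsilon>: "0 < \<epsilon>" "\<mu> * \<epsilon>\<^sup>2 = 1"
      and mass: "integral \<Omega> (semilinear.f u p \<mu>) \<le> C0 * \<epsilon> ^ (DIM('a) - 2)" and x: "x \<in> \<Omega>" "1 < u x"
      and xz: "dist x z < \<rho>0 / 64" and far: "8 * R * \<epsilon> \<le> infdist x (frontier \<Omega>)"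
    interpret semilinear \<Omega> u G D p \<mu> by (rule sl)
    have N2: "DIM('a) - 2 = s" using s by simp
    define E where "E = \<epsilon> ^ s"
    have E: "0 < E" using \<epsilon> by (simp add: E_def)
    have mass': "integral \<Omega> f \<le> C0 * E" using mass by (simp add: N2 E_def)
    obtain zh where zh: "zh \<in> frontier \<Omega>" "\<And>y. y \<in> frontier \<Omega> \<Longrightarrow> dist x zh \<le> dist x y"
      using distance_attains_inf[OF frontier_closed, of \<Omega> x] z by blast
    define d where "d = dist x zh"
    \<comment> \<open>The factor 8 in \<open>8 * R\<close> gives this bound: the concentration ball
      of the spike fits into radius \<open>d / 8\<close>, as required by \<open>free_annulus\<close>
      and by the lower bound for the bump.\<close>
    have Rd: "R * \<epsilon> \<le> d / 8" using far infdist_le[OF zh(1), of x] by (simp add: d_def)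
    have d0: "0 < d" using Rd R \<epsilon> mult_pos_pos[of R \<epsilon>] by linarith
    have dz: "d \<le> dist x z" unfolding d_def by (rule zh(2)[OF z])
    have d\<rho>: "d < \<rho>0 / 64" using dz xz by linarith

    \<comment> \<open>A scale comparable to \<open>d\<close> whose annulus carries no part of \<open>{u > 1}\<close>: there are at most \<open>K\<close> concentration points.\<close>
    have mE: "m0 * E \<le> integral (ball y (R * \<epsilon>) \<inter> \<Omega>) f" if "y \<in> \<Omega>" "1 < u y" for y
      using conc[OF sl \<epsilon> mass that] by (simp add: N2 E_def)
    have "integral \<Omega> f < real K * (m0 * E)"
    proof -
      have "C0 * E < real K * m0 * E" using K E by (intro mult_strict_right_mono)
      then show ?thesis using mass' by simp
    qed
    then obtain j where j: "1 \<le> j" "j \<le> K"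
      and free: "\<And>y. y \<in> \<Omega> \<Longrightarrow> d * A ^ j / 4 < dist y x \<Longrightarrow> dist y x < 4 * (d * A ^ j) \<Longrightarrow> u y \<le> 1"
      using free_annulus[OF d0 A(1) Rd _ mE] m0 E by (metis mult_pos_pos)
    define \<rho> where "\<rho> = d * A ^ j"
    have Aj: "A \<le> A ^ j" "A ^ j \<le> A ^ K"
      using j A power_increasing[of 1 j A] power_increasing[of j K A] by simp_all
    have \<rho>d: "64 * d \<le> \<rho>" using Aj(1) A(1) d0 mult_left_mono[of 64 "A ^ j" d] by (simp add: \<rho>_def mult.commute)
    have \<rho>: "0 < \<rho>" using \<rho>d d0 by linarith
    have \<rho>r: "2 * \<rho> \<le> r1 / 3"
    proof -
      have "d * A ^ j \<le> \<rho>0 * A ^ K"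
        using Aj d\<rho> d0 \<rho>0 A by (intro mult_mono) auto
      then show ?thesis unfolding \<rho>0K \<rho>_def by simp
    qed
    have \<rho>0r: "\<rho>0 \<le> r1 / 6" using \<rho>0K \<rho>0 mult_left_mono[OF AK, of \<rho>0] by linarith

    \<comment> \<open>The centre of the bump: the nearest boundary point pushed outward by
      \<open>d\<close>, so that it is within \<open>2 * d\<close> of the spike and yet at distance
      at least \<open>c0 * d\<close> from the domain inside the chart.\<close>
    define y0 where "y0 = zh - d *\<^sub>R e"
    have xy0: "dist x y0 \<le> 2 * d"
    proof -
      have "dist zh y0 = d" using d0 e by (simp add: y0_def dist_norm)
      then show ?thesis using dist_triangle[of x y0 zh] by (simp add: d_def)
    qed
    \<comment> \<open>If a point y of the domain were closer to \<open>y0\<close>, the direction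
      from y to \<open>zh\<close> would lie in the cone. Then \<phi> would increase along the
      segment and be positive at \<open>zh\<close>, which is on the frontier.\<close>
    have exterior: "c0 * d \<le> dist y y0" if y: "y \<in> ball z r1 \<inter> \<Omega>" for y
    proof (rule ccontr)
      assume "\<not> c0 * d \<le> dist y y0"
      then have lt: "dist y y0 < c0 * d" by simp
      define e' where "e' = (1 / d) *\<^sub>R (zh - y)"
      have "e' - e = (1 / d) *\<^sub>R (y0 - y)"
        using d0 by (simp add: e'_def y0_def algebra_simps)
      then have "norm (e' - e) = dist y y0 / d" using d0 by (simp add: dist_norm norm_minus_commute)
      moreover have "dist y y0 / d \<le> c0" using lt d0 by (simp add: pos_divide_le_eq)
      ultimately have e': "norm (e' - e) \<le> c0" by simp
      have "dist z zh < r1"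
        using dist_triangle[of z zh x] xz d\<rho> \<rho>0r r1 by (simp add: d_def dist_commute)
      then have zb: "zh \<in> ball z r1" by simp
      have seg: "y + t *\<^sub>R e' \<in> ball z r1" if t: "0 \<le> t" "t \<le> d" for t
      proof -
        have "y + t *\<^sub>R e' = (1 - t / d) *\<^sub>R y + (t / d) *\<^sub>R zh"
          using d0 by (simp add: e'_def algebra_simps)
        then show ?thesis
          using convexD_alt[OF convex_ball[of z r1] _ zb, of y "t / d"] y t d0 by simp
      qed
      obtain t where t: "0 < t" "t < d" "\<phi> (y + d *\<^sub>R e') - \<phi> y = d * (n (y + t *\<^sub>R e') \<bullet> e')"
        using gderiv_mvt[of d \<phi> y e' n] seg \<phi>(1) d0 by metis
      have "b \<le> n (y + t *\<^sub>R e') \<bullet> e'" using t by (intro cone seg e') auto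
      then have "0 < d * (n (y + t *\<^sub>R e') \<bullet> e')" using d0 b by simp
      moreover have "0 < \<phi> y" using y dom by blast
      moreover have "y + d *\<^sub>R e' = zh" using d0 by (simp add: e'_def)
      ultimately have "0 < \<phi> zh" using t(3) by simp
      then have "zh \<in> \<Omega>" using dom[OF zb] by simp
      then show False using zh(1) open\<Omega> by (simp add: frontier_def interior_open)
    qed

    let ?S = "ball z r1 \<inter> \<Omega>"
    have S: "open ?S" "bounded ?S" "?S \<subseteq> \<Omega>" using open_dom bounded_dom by auto
    note bp = bump[OF d0, where k = k and a = y0] and ct = cutoff[OF \<rho>, where a = x]
      and an = annulus_bump[OF \<rho>, where a = x]
    have zr: "dist x z < r1 / 300" using xz \<rho>0r r1 by linarith
    have sup\<psi>: "bump k d y0 y = 0 \<and> bump_grad k d y0 y = 0" if "y \<notin> cball z (r1 / 2)" for y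
    proof (rule bp(4))
      have "r1 / 2 < dist z y" using that by simp
      also have "dist z y \<le> dist x z + (dist x y0 + dist y y0)"
        using dist_triangle[of z y x] dist_triangle[of x y y0] by (simp add: dist_commute)
      finally show "4 * d \<le> dist y y0" using zr xy0 d\<rho> \<rho>0r r1 by linarith
    qed
    have sup\<eta>: "cutoff \<rho> x y = 0 \<and> cutoff_grad \<rho> x y = 0" if "y \<notin> cball z (r1 / 2)" for y
    proof (rule ct(5))
      have "r1 / 2 < dist z y" using that by simp
      also have "dist z y \<le> dist x z + dist y x"
        using dist_triangle[of z y x] by (simp add: dist_commute)
      finally show "2 * \<rho> \<le> dist y x" using zr \<rho>r r1 by linarith
    qed
    have le: "bump k d y0 y \<le> cutoff \<rho> x y" for y
    proof (cases "dist y x \<le> \<rho>")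
      case True
      then show ?thesis using ct(4) bp(3) by simp
    next
      case False
      have "4 * d \<le> dist y y0"
        using False \<rho>d xy0 d0 dist_triangle[of y x y0] by (simp add: dist_commute)
      then show ?thesis using bp(4) ct(3) by simp
    qed
    have harm: "u y \<le> 1" if "y \<in> \<Omega>" "cutoff_grad \<rho> x y \<noteq> 0" for y
    proof (rule free[OF that(1)])
      have "\<rho> < dist y x" "dist y x < 2 * \<rho>" using that(2) ct(4,5) by (meson not_le)+
      then show "d * A ^ j / 4 < dist y x" "dist y x < 4 * (d * A ^ j)"
        using \<rho> unfolding \<rho>_def[symmetric] by simp_all
    qed
    have lap0: "0 \<le> C2_fun.lap (bump_hess k d y0) y" if "y \<in> ?S" for y
      by (rule bp(7)[OF exterior[OF that] c0 k'])
    have r2: "0 < r1 / 2" "r1 / 2 < r1" using r1 by simp_all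
    note force = force_inequality[OF r2 \<phi> dom e b c0 cone bp(1) bp(2) le sup\<psi> lap0 ct(1,2) sup\<eta> harm]

    have Cc: "C2_fun UNIV (bump k d y0) (bump_grad k d y0) (bump_hess k d y0)" by (rule bp(1))
    have bb: "bdd_cont T (bump k d y0)" "bdd_cont T (bump_grad k d y0)" if "bounded T" for T
      using C2_fun.continuous[OF Cc] C2_fun.continuous_grad[OF Cc] that by (auto intro: bdd_cont_continuous_UNIV)
    have bc: "bdd_cont T (cutoff_grad \<rho> x)" if "bounded T" for T
      using ct(2) that by (rule bdd_cont_continuous_UNIV)
    have abc: "continuous_on UNIV (annulus_bump \<rho> x)"
      using an(1) by (intro continuous_at_imp_continuous_on ballI gderiv_continuous)
    have ba: "bdd_cont T (annulus_bump \<rho> x)" "bdd_cont T (annulus_bump_grad \<rho> x)" if "bounded T" for T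
      using abc an(2) that by (auto intro: bdd_cont_continuous_UNIV)
    have fS: "bdd_cont ?S f" and GS: "bdd_cont ?S G"
      using bdd_cont_subset[OF f_bdd S(3)] bdd_cont_subset[OF G_bdd S(3)] .

    \<comment> \<open>The concentration ball lies within \<open>3 * d\<close> of \<open>y0\<close>,
      where the bump is at least \<open>(7 / 16) ^ (k + 3)\<close>.\<close>
    have I: "(7 / 16) ^ (k + 3) * m0 * E \<le> integral ?S (\<lambda>y. bump k d y0 y * f y)"
    proof -
      have sub: "ball x (R * \<epsilon>) \<inter> \<Omega> \<subseteq> ?S"
      proof
        fix y assume y: "y \<in> ball x (R * \<epsilon>) \<inter> \<Omega>"
        then have "dist z y < dist x z + d / 8"
          using dist_triangle[of z y x] Rd by (simp add: dist_commute)
        then show "y \<in> ?S" using y zr d\<rho> \<rho>0r r1 by simp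
      qed
      have "(7 / 16) ^ (k + 3) * (m0 * E) \<le> (7 / 16) ^ (k + 3) * integral (ball x (R * \<epsilon>) \<inter> \<Omega>) f"
        by (intro mult_left_mono mE x) simp
      also have "\<dots> = integral (ball x (R * \<epsilon>) \<inter> \<Omega>) (\<lambda>y. (7 / 16) ^ (k + 3) * f y)"
        by (simp only: integral_mult_right)
      also have "\<dots> \<le> integral (ball x (R * \<epsilon>) \<inter> \<Omega>) (\<lambda>y. bump k d y0 y * f y)"
      proof (intro integral_le integrable_ball bdd_cont_mult bdd_cont_const f_bdd bb bounded_dom mult_right_mono f_nonneg)
        fix y assume y: "y \<in> ball x (R * \<epsilon>) \<inter> \<Omega>"
        then have "dist y y0 \<le> 3 * d"
          using dist_triangle[of y y0 x] Rd xy0 d0 by (simp add: dist_commute)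
        then show "(7 / 16) ^ (k + 3) \<le> bump k d y0 y" by (rule bp(5))
      qed
      also have "\<dots> \<le> integral ?S (\<lambda>y. bump k d y0 y * f y)"
        by (intro integral_subset_le[OF sub] integrable_ball bdd_cont_mult f_bdd bb bounded_dom)
           (use bp(2) f_nonneg in auto)
      finally show ?thesis by (simp add: mult.assoc)
    qed
    have SA: "integral ?S (\<lambda>y. norm (bump_grad k d y0 y)) \<le> cA * d ^ (s + 1)"
    proof -
      have "integral ?S (\<lambda>y. norm (bump_grad k d y0 y)) \<le> real (k + 3) / (2 * d) * ((4 * d) ^ DIM('a) * V)"
        unfolding V_def
      proof (rule integral_le_ball[OF bdd_cont_norm[OF bb(2)[OF S(2)]] S(1,2), of "4 * d" _ y0])
        show "norm (bump_grad k d y0 y) \<le> 0" if "y \<notin> ball y0 (4 * d)" for y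
          using bp(4)[of y] that by (simp add: dist_commute)
        show "norm (bump_grad k d y0 y) \<le> real (k + 3) / (2 * d)" for y by (rule bp(6))
      qed (use d0 in auto)
      also have "\<dots> = cA * d ^ (s + 1)"
        using d0 by (simp add: s cA_def power_mult_distrib power_add field_simps)
      finally show ?thesis .
    qed
    \<comment> \<open>The size of u on the annulus, from the potential bound with both radii equal
      to \<open>\<rho> / 4\<close> and \<open>F = 0\<close>: balls of that radius around its points
      carry no source. The factor 2 counts the two remaining terms.\<close>
    define U where "U = 2 * C * C0 * E / (\<rho> / 4) ^ s"
    have U0: "0 \<le> U" using C C0 E \<rho> by (simp add: U_def)
    have uU: "u y \<le> U" if y: "y \<in> \<Omega>" "\<rho> / 2 < dist y x" "dist y x < 3 * \<rho>" for y
    proof -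
      have "f w \<le> 0" if w: "w \<in> ball y (\<rho> / 4) \<inter> \<Omega>" for w
      proof -
        have "u w \<le> 1"
        proof (rule free)
          show "w \<in> \<Omega>" using w by simp
          show "d * A ^ j / 4 < dist w x"
            using w y(2) dist_triangle[of y x w] by (simp add: \<rho>_def[symmetric] dist_commute)
          show "dist w x < 4 * (d * A ^ j)"
            using w y(3) dist_triangle[of w x y] \<rho> by (simp add: \<rho>_def[symmetric] dist_commute)
        qed
        then show ?thesis by (simp add: f_eq_0)
      qed
      then have "u y \<le> C * (0 * (\<rho> / 4)\<^sup>2 + integral (ball y (\<rho> / 4) \<inter> \<Omega>) f / (\<rho> / 4) ^ (DIM('a) - 2)
                + integral \<Omega> f / (\<rho> / 4) ^ (DIM('a) - 2))"
        using \<rho> by (intro pot[OF sl y(1)]) auto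
      also have "\<dots> \<le> C * (C0 * E / (\<rho> / 4) ^ s + C0 * E / (\<rho> / 4) ^ s)"
      proof -
        have "integral (ball y (\<rho> / 4) \<inter> \<Omega>) f \<le> C0 * E"
          using integral_ball_le[OF f_bdd f_nonneg] mass' order_trans by blast
        then have "integral (ball y (\<rho> / 4) \<inter> \<Omega>) f / (\<rho> / 4) ^ s \<le> C0 * E / (\<rho> / 4) ^ s"
          using \<rho> by (intro divide_right_mono) auto
        moreover have "integral \<Omega> f / (\<rho> / 4) ^ s \<le> C0 * E / (\<rho> / 4) ^ s"
          using \<rho> mass' by (intro divide_right_mono) auto
        ultimately show ?thesis unfolding N2 using C by (intro mult_left_mono) linarith+
      qed
      also have "\<dots> = U" by (simp add: U_def)
      finally show ?thesis .
    qed
    \<comment> \<open>The cutoff's gradient is supported where the square of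
      \<open>annulus_bump\<close> is at least 1, so Caccioppoli on the wider annulus, still free of
      the set {u > 1}, controls the force by the supremum \<open>U\<close>.\<close>
    have T: "integral ?S (\<lambda>y. (G y \<bullet> G y) * norm (cutoff_grad \<rho> x y)) \<le> cT * E\<^sup>2 / \<rho> ^ (s + 1)"
    proof -
      have zg: "bdd_cont \<Omega> (\<lambda>y. (annulus_bump \<rho> x y)\<^sup>2 * (G y \<bullet> G y))"
        by (intro bdd_cont_intros ba bounded_dom G_bdd)
      have "integral ?S (\<lambda>y. (G y \<bullet> G y) * norm (cutoff_grad \<rho> x y))
          \<le> integral ?S (\<lambda>y. 3 / \<rho> * ((annulus_bump \<rho> x y)\<^sup>2 * (G y \<bullet> G y)))"
      proof (intro integral_le bdd_cont_integrable[OF _ S(1,2)])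
        show "bdd_cont ?S (\<lambda>y. (G y \<bullet> G y) * norm (cutoff_grad \<rho> x y))"
          by (intro bdd_cont_intros bc S GS)
        show "bdd_cont ?S (\<lambda>y. 3 / \<rho> * ((annulus_bump \<rho> x y)\<^sup>2 * (G y \<bullet> G y)))"
          by (intro bdd_cont_mult[OF bdd_cont_const] bdd_cont_subset[OF zg S(3)])
        show "(G y \<bullet> G y) * norm (cutoff_grad \<rho> x y) \<le> 3 / \<rho> * ((annulus_bump \<rho> x y)\<^sup>2 * (G y \<bullet> G y))" for y
        proof (cases "cutoff_grad \<rho> x y = 0")
          case False
          then have "\<rho> \<le> dist y x" "dist y x \<le> 2 * \<rho>" using ct(4,5) by (meson linear)+
          then have "1 \<le> (annulus_bump \<rho> x y)\<^sup>2" by (rule an(3))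
          then have "(G y \<bullet> G y) * norm (cutoff_grad \<rho> x y) \<le> ((annulus_bump \<rho> x y)\<^sup>2 * (G y \<bullet> G y)) * (3 / \<rho>)"
            using ct(6)[of y] mult_right_mono[of 1 "(annulus_bump \<rho> x y)\<^sup>2" "G y \<bullet> G y"]
            by (intro mult_mono) auto
          then show ?thesis by (simp only: mult.commute)
        qed (use \<rho> in simp)
      qed
      also have "\<dots> \<le> integral \<Omega> (\<lambda>y. 3 / \<rho> * ((annulus_bump \<rho> x y)\<^sup>2 * (G y \<bullet> G y)))"
        using \<rho> by (intro integral_subset_le[OF S(3)] integrable bdd_cont_mult[OF bdd_cont_const] zg
            bdd_cont_integrable[OF _ S(1,2)] bdd_cont_subset[OF zg S(3)]) auto
      also have "\<dots> = 3 / \<rho> * integral \<Omega> (\<lambda>y. (annulus_bump \<rho> x y)\<^sup>2 * (G y \<bullet> G y))"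
        by (simp only: integral_mult_right)
      also have "\<dots> \<le> 3 / \<rho> * (4 * integral \<Omega> (\<lambda>y. (u y)\<^sup>2 * (annulus_bump_grad \<rho> x y \<bullet> annulus_bump_grad \<rho> x y)))"
      proof (intro mult_left_mono caccioppoli[OF an(1,2)])
        show "u y \<le> 1" if "y \<in> \<Omega>" "annulus_bump \<rho> x y \<noteq> 0" for y
        proof (rule free[OF that(1)])
          have "\<rho> / 2 < dist y x" "dist y x < 3 * \<rho>" using that(2) an(4) by (meson not_le)+
          then show "d * A ^ j / 4 < dist y x" "dist y x < 4 * (d * A ^ j)"
            using \<rho> unfolding \<rho>_def[symmetric] by simp_all
        qed
      qed (use \<rho> in simp)
      also have "\<dots> \<le> 3 / \<rho> * (4 * (U\<^sup>2 * (9000 / \<rho>)\<^sup>2 * ((3 * \<rho>) ^ DIM('a) * V)))"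
        unfolding V_def
      proof (intro mult_left_mono integral_le_ball[OF _ open_dom bounded_dom, where a = x])
        show "bdd_cont \<Omega> (\<lambda>y. (u y)\<^sup>2 * (annulus_bump_grad \<rho> x y \<bullet> annulus_bump_grad \<rho> x y))"
          by (intro bdd_cont_intros u_bdd ba bounded_dom)
        show "(u y)\<^sup>2 * (annulus_bump_grad \<rho> x y \<bullet> annulus_bump_grad \<rho> x y) \<le> 0" if "y \<notin> ball x (3 * \<rho>)" for y
          using an(4)[of y] that by (simp add: dist_commute)
        show "(u y)\<^sup>2 * (annulus_bump_grad \<rho> x y \<bullet> annulus_bump_grad \<rho> x y) \<le> U\<^sup>2 * (9000 / \<rho>)\<^sup>2" if y: "y \<in> \<Omega>" for y
        proof (cases "dist y x \<le> \<rho> / 2 \<or> 3 * \<rho> \<le> dist y x")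
          case False
          then have "u y \<le> U" using uU[OF y] by simp
          then have "(u y)\<^sup>2 \<le> U\<^sup>2" using u_nonneg[OF y] by (rule power_mono)
          then show ?thesis using an(5)[of y] by (intro mult_mono) auto
        qed (use an(4)[of y] in simp)
      qed (use \<rho> in auto)
      also have "\<dots> = cT * E\<^sup>2 / \<rho> ^ (s + 1)"
        using \<rho> unfolding s U_def cT_def
        by (simp add: power_mult_distrib power_divide power_add field_simps power2_eq_square)
      finally show ?thesis .
    qed
    have "c1 * E\<^sup>2 = c0\<^sup>2 * ((7 / 16) ^ (k + 3) * m0 * E)\<^sup>2"
      by (simp add: c1_def power_mult_distrib)
    also have "\<dots> \<le> c0\<^sup>2 * (integral ?S (\<lambda>y. bump k d y0 y * f y))\<^sup>2"
      using I m0 E by (intro mult_left_mono power_mono) auto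
    also have "\<dots> \<le> 3 * integral ?S (\<lambda>y. norm (bump_grad k d y0 y)) * integral ?S (\<lambda>y. (G y \<bullet> G y) * norm (cutoff_grad \<rho> x y))"
      by (rule force)
    also have "\<dots> \<le> 3 * (cA * d ^ (s + 1)) * (cT * E\<^sup>2 / \<rho> ^ (s + 1))"
    proof (intro mult_mono SA T order_refl)
      show "0 \<le> integral ?S (\<lambda>y. (G y \<bullet> G y) * norm (cutoff_grad \<rho> x y))"
        by (intro integral_nonneg bdd_cont_integrable[OF _ S(1,2)] bdd_cont_intros bc S GS) auto
      show "0 \<le> integral ?S (\<lambda>y. norm (bump_grad k d y0 y))"
        by (intro integral_nonneg bdd_cont_integrable[OF _ S(1,2)] bdd_cont_norm bb S norm_ge_zero)
    qed (use cA d0 in auto)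
    also have "\<dots> = 3 * cA * cT * E\<^sup>2 / (A ^ j) ^ (s + 1)"
      using d0 by (simp add: \<rho>_def power_mult_distrib)
    \<comment> \<open>One factor \<open>A\<close> is enough for the contradiction; it is gained
      because \<open>1 \<le> j\<close>.\<close>
    also have "\<dots> \<le> 3 * cA * cT * E\<^sup>2 / A"
    proof (rule divide_left_mono)
      have "A ^ j \<le> (A ^ j) ^ (s + 1)" using Aj A power_increasing[of 1 "s + 1" "A ^ j"] by simp
      then show "A \<le> (A ^ j) ^ (s + 1)" using Aj by linarith
    qed (use A cA cT in auto)
    finally have "c1 * E\<^sup>2 * A \<le> 3 * cA * cT * E\<^sup>2" using A by (simp add: field_simps)
    then have "c1 * A \<le> 3 * cA * cT" using E by (simp add: mult.commute mult.left_commute)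
    then show False using A(2) by linarith
  qed
qed

section \<open>Reduction to the analytic setting\<close>

text \<open>One application of the mean value theorem in direction \<open>a\<close> reduces the
  second difference to a difference of gradients at two points near x. Both are expanded around x by
  differentiability of \<open>G\<close> there, which gives the two error terms in the factor
  \<open>2 * norm a + norm b\<close>.\<close>

lemma second_difference:
  fixes f :: "'a::euclidean_space \<Rightarrow> real"
  assumes \<Omega>: "open \<Omega>" "x \<in> \<Omega>" and grad: "\<And>y. y \<in> \<Omega> \<Longrightarrow> GDERIV f y :> G y"
    and hess: "(G has_derivative D) (at x)" and \<epsilon>: "0 < \<epsilon>"
  shows "\<exists>\<delta>>0. \<forall>t. 0 < t \<longrightarrow> t < \<delta> \<longrightarrow>
    \<bar>f (x + t *\<^sub>R a + t *\<^sub>R b) - f (x + t *\<^sub>R a) - f (x + t *\<^sub>R b) + f x - t\<^sup>2 * (D b \<bullet> a)\<bar>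
      \<le> t\<^sup>2 * (\<epsilon> * ((2 * norm a + norm b) * norm a))"
proof -
  obtain r where r: "0 < r" "ball x r \<subseteq> \<Omega>" using \<Omega> open_contains_ball by blast
  have lin: "linear D" using hess has_derivative_linear by blast
  obtain d where d: "0 < d" "\<And>y. norm (y - x) < d \<Longrightarrow> norm (G y - G x - D (y - x)) \<le> \<epsilon> * norm (y - x)"
    using hess \<epsilon> unfolding has_derivative_at_alt by blast
  define m where "m = norm a + norm b + 1"
  have m: "0 < m" by (simp add: m_def add_nonneg_pos)
  show ?thesis
  proof (intro exI[of _ "min r d / m"] conjI allI impI)
    show "0 < min r d / m" using r d m by simp
    fix t :: real assume t: "0 < t" "t < min r d / m"
    have tm: "t * m < r" "t * m < d" using t m by (simp_all add: field_simps)
    have small: "norm (s *\<^sub>R a + q *\<^sub>R b) < r" "norm (s *\<^sub>R a + q *\<^sub>R b) < d"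
      if "0 \<le> s" "s \<le> t" "0 \<le> q" "q \<le> t" for s q
    proof -
      have "norm (s *\<^sub>R a + q *\<^sub>R b) \<le> s * norm a + q * norm b"
        using norm_triangle_ineq[of "s *\<^sub>R a" "q *\<^sub>R b"] that by simp
      also have "\<dots> \<le> t * norm a + t * norm b" using that by (intro add_mono mult_right_mono) auto
      also have "\<dots> \<le> t * m" using t by (simp add: m_def algebra_simps)
      finally show "norm (s *\<^sub>R a + q *\<^sub>R b) < r" "norm (s *\<^sub>R a + q *\<^sub>R b) < d" using tm by linarith+
    qed
    have in\<Omega>: "x + (s *\<^sub>R a + q *\<^sub>R b) \<in> \<Omega>" if "0 \<le> s" "s \<le> t" "0 \<le> q" "q \<le> t" for s q
    proof -
      have "dist x (x + w) = norm w" for w by (simp add: dist_norm)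
      then have "dist x (x + (s *\<^sub>R a + q *\<^sub>R b)) < r" using small(1)[OF that] by simp
      then show ?thesis using r(2) by auto
    qed
    \<comment> \<open>The increment of f by \<open>t *\<^sub>R b\<close> as a function of the
      displacement along \<open>a\<close>; \<open>h t - h 0\<close> is the second
      difference.\<close>
    define h where "h s = f (x + t *\<^sub>R b + s *\<^sub>R a) - f (x + s *\<^sub>R a)" for s
    have hd: "(h has_real_derivative (G (x + t *\<^sub>R b + s *\<^sub>R a) \<bullet> a - G (x + s *\<^sub>R a) \<bullet> a)) (at s)" if s: "0 \<le> s" "s \<le> t" for s
      unfolding h_def[abs_def]
      using in\<Omega>[of s t] in\<Omega>[of s 0] s t
      by (intro DERIV_diff gderiv_along grad) (auto simp: algebra_simps)
    obtain s where s: "0 < s" "s < t" "h t - h 0 = (t - 0) * (G (x + t *\<^sub>R b + s *\<^sub>R a) \<bullet> a - G (x + s *\<^sub>R a) \<bullet> a)"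
      using MVT2[of 0 t h "\<lambda>s. G (x + t *\<^sub>R b + s *\<^sub>R a) \<bullet> a - G (x + s *\<^sub>R a) \<bullet> a"] hd t by auto
    define e1 where "e1 = G (x + t *\<^sub>R b + s *\<^sub>R a) - G x - D (s *\<^sub>R a + t *\<^sub>R b)"
    define e2 where "e2 = G (x + s *\<^sub>R a) - G x - D (s *\<^sub>R a)"
    have n1: "norm e1 \<le> \<epsilon> * (t * (norm a + norm b))"
    proof -
      have "norm e1 \<le> \<epsilon> * norm (s *\<^sub>R a + t *\<^sub>R b)"
        using d(2)[of "x + t *\<^sub>R b + s *\<^sub>R a"] small(2)[of s t] s t by (simp add: e1_def algebra_simps)
      also have "norm (s *\<^sub>R a + t *\<^sub>R b) \<le> s * norm a + t * norm b"
        using norm_triangle_ineq[of "s *\<^sub>R a" "t *\<^sub>R b"] s t by simp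
      also have "\<dots> \<le> t * (norm a + norm b)" using s t by (simp add: algebra_simps mult_right_mono)
      finally show ?thesis using \<epsilon> by simp
    qed
    have n2: "norm e2 \<le> \<epsilon> * (t * norm a)"
    proof -
      have "norm e2 \<le> \<epsilon> * norm (s *\<^sub>R a)"
        using d(2)[of "x + s *\<^sub>R a"] small(2)[of s 0] s t by (simp add: e2_def)
      also have "norm (s *\<^sub>R a) \<le> t * norm a" using s by (simp add: mult_right_mono)
      finally show ?thesis using \<epsilon> by simp
    qed
    have "D (s *\<^sub>R a + t *\<^sub>R b) - D (s *\<^sub>R a) = t *\<^sub>R D b"
      using lin by (simp add: linear_add linear_cmul)
    then have eq: "G (x + t *\<^sub>R b + s *\<^sub>R a) - G (x + s *\<^sub>R a) = t *\<^sub>R D b + (e1 - e2)"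
      by (simp add: e1_def e2_def algebra_simps)
    have "h t - h 0 = t * ((t *\<^sub>R D b + (e1 - e2)) \<bullet> a)"
      unfolding s(3) by (simp flip: eq inner_diff_left)
    then have "f (x + t *\<^sub>R a + t *\<^sub>R b) - f (x + t *\<^sub>R a) - f (x + t *\<^sub>R b) + f x - t\<^sup>2 * (D b \<bullet> a) = t * ((e1 - e2) \<bullet> a)"
      by (simp add: h_def inner_add_left algebra_simps power2_eq_square)
    also have "\<bar>t * ((e1 - e2) \<bullet> a)\<bar> \<le> t * ((\<epsilon> * (t * (norm a + norm b)) + \<epsilon> * (t * norm a)) * norm a)"
    proof -
      have "norm (e1 - e2) \<le> \<epsilon> * (t * (norm a + norm b)) + \<epsilon> * (t * norm a)"
        using norm_triangle_ineq4[of e1 e2] n1 n2 by linarith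
      then have "\<bar>(e1 - e2) \<bullet> a\<bar> \<le> (\<epsilon> * (t * (norm a + norm b)) + \<epsilon> * (t * norm a)) * norm a"
        by (meson Cauchy_Schwarz_ineq2 mult_right_mono norm_ge_zero order_trans)
      then show ?thesis using t by (simp only: abs_mult abs_of_pos mult_left_mono less_imp_le)
    qed
    also have "\<dots> = t\<^sup>2 * (\<epsilon> * ((2 * norm a + norm b) * norm a))"
      by (simp add: algebra_simps power2_eq_square)
    finally show "\<bar>f (x + t *\<^sub>R a + t *\<^sub>R b) - f (x + t *\<^sub>R a) - f (x + t *\<^sub>R b) + f x - t\<^sup>2 * (D b \<bullet> a)\<bar>
      \<le> t\<^sup>2 * (\<epsilon> * ((2 * norm a + norm b) * norm a))" .
  qed
qed

text \<open>The mixed second difference is unchanged when \<open>a\<close> and \<open>b\<close> are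
  exchanged, while \<open>second_difference\<close> approximates it by both inner products.\<close>

lemma symmetric_hessian:
  fixes f :: "'a::euclidean_space \<Rightarrow> real"
  assumes "open \<Omega>" "x \<in> \<Omega>" "\<And>y. y \<in> \<Omega> \<Longrightarrow> GDERIV f y :> G y" "(G has_derivative D) (at x)"
  shows "D a \<bullet> b = D b \<bullet> a"
proof -
  define c where "c = (2 * norm a + norm b) * norm a + (2 * norm b + norm a) * norm b"
  have c: "0 \<le> c" by (simp add: c_def)
  have "\<bar>D a \<bullet> b - D b \<bullet> a\<bar> \<le> 0 + e" if e: "0 < e" for e
  proof -
    define \<epsilon> where "\<epsilon> = e / (c + 1)"
    have \<epsilon>: "0 < \<epsilon>" using e c by (simp add: \<epsilon>_def)
    obtain d1 where d1: "0 < d1" "\<And>t. 0 < t \<Longrightarrow> t < d1 \<Longrightarrow>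
      \<bar>f (x + t *\<^sub>R a + t *\<^sub>R b) - f (x + t *\<^sub>R a) - f (x + t *\<^sub>R b) + f x - t\<^sup>2 * (D b \<bullet> a)\<bar>
      \<le> t\<^sup>2 * (\<epsilon> * ((2 * norm a + norm b) * norm a))"
      using second_difference[OF assms \<epsilon>, of a b] by blast
    obtain d2 where d2: "0 < d2" "\<And>t. 0 < t \<Longrightarrow> t < d2 \<Longrightarrow>
      \<bar>f (x + t *\<^sub>R b + t *\<^sub>R a) - f (x + t *\<^sub>R b) - f (x + t *\<^sub>R a) + f x - t\<^sup>2 * (D a \<bullet> b)\<bar>
      \<le> t\<^sup>2 * (\<epsilon> * ((2 * norm b + norm a) * norm b))"
      using second_difference[OF assms \<epsilon>, of b a] by blast
    define t where "t = min d1 d2 / 2"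
    have t: "0 < t" "t < d1" "t < d2" using d1(1) d2(1) by (auto simp: t_def min_def)
    have sw: "x + t *\<^sub>R b + t *\<^sub>R a = x + t *\<^sub>R a + t *\<^sub>R b" by simp
    have "\<bar>t\<^sup>2 * (D a \<bullet> b) - t\<^sup>2 * (D b \<bullet> a)\<bar> \<le> t\<^sup>2 * (\<epsilon> * ((2 * norm a + norm b) * norm a)) + t\<^sup>2 * (\<epsilon> * ((2 * norm b + norm a) * norm b))"
      using d1(2)[OF t(1,2)] d2(2)[OF t(1,3)] unfolding sw by linarith
    also have "\<dots> = t\<^sup>2 * (\<epsilon> * c)" by (simp add: c_def distrib_left)
    finally have "t\<^sup>2 * \<bar>D a \<bullet> b - D b \<bullet> a\<bar> \<le> t\<^sup>2 * (\<epsilon> * c)"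
      by (simp add: abs_mult flip: right_diff_distrib)
    then have "\<bar>D a \<bullet> b - D b \<bullet> a\<bar> \<le> \<epsilon> * c" using t(1) by simp
    also have "\<dots> \<le> e" using e c by (simp add: \<epsilon>_def field_simps)
    finally show ?thesis by simp
  qed
  then have "\<bar>D a \<bullet> b - D b \<bullet> a\<bar> \<le> 0" by (rule field_le_epsilon)
  then show ?thesis by simp
qed

section \<open>From partial derivatives to gradients and boundary charts\<close>

definition vgrad :: "(real^'n::finite \<Rightarrow> real) \<Rightarrow> real^'n \<Rightarrow> real^'n" where
  "vgrad f x = (\<chi> i. partial i f x)"

text \<open>\<open>partial\<close> is a \<open>deriv\<close> and would be arbitrary where no
  derivative exists; the total differentiability built into \<open>Ck_on\<close> makes it the
  genuine component of the gradient.\<close>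

lemma Ck_on_gderiv:
  assumes "Ck_on (Suc 0) U f"
  shows "x \<in> U \<Longrightarrow> GDERIV f x :> vgrad f x" and "continuous_on U (vgrad f)"
proof -
  show "continuous_on U (vgrad f)"
    unfolding vgrad_def[abs_def] using assms by (intro continuous_on_vec_lambda) simp
  assume x: "x \<in> U"
  then obtain f' where f': "(f has_derivative f') (at x)" using assms by (auto simp: differentiable_def)
  then have lin: "linear f'" by (rule has_derivative_linear)
  have part: "partial i f x = f' (axis i 1)" for i
  proof -
    have 1: "((\<lambda>t. x + t *\<^sub>R axis i 1) has_derivative (\<lambda>h. h *\<^sub>R axis i 1)) (at 0)"
      by (auto intro!: derivative_eq_intros)
    have "((\<lambda>t. f (x + t *\<^sub>R axis i 1)) has_derivative (\<lambda>h. f' (h *\<^sub>R axis i 1))) (at 0)"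
      using has_derivative_compose[OF 1, of f f'] f' by simp
    then have "((\<lambda>t. f (x + t *\<^sub>R axis i 1)) has_real_derivative f' (axis i 1)) (at 0)"
      using lin by (simp add: has_field_derivative_def linear_cmul mult_commute_abs)
    then show ?thesis unfolding partial_def by (rule DERIV_imp_deriv)
  qed
  have "f' h = h \<bullet> vgrad f x" for h
  proof -
    have "f' h = f' (\<Sum>i\<in>UNIV. h $ i *\<^sub>R axis i 1)"
      using basis_expansion[of h] by (simp add: scalar_mult_eq_scaleR)
    also have "\<dots> = (\<Sum>i\<in>UNIV. h $ i * f' (axis i 1))"
      using lin by (simp add: linear_sum linear_cmul)
    finally show ?thesis by (simp add: inner_vec_def vgrad_def part)
  qed
  then have "f' = (\<lambda>h. h \<bullet> vgrad f x)" by blast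
  then show "GDERIV f x :> vgrad f x" using f' by (simp add: gderiv_def)
qed

lemma sum_Basis_vec: "(\<Sum>b\<in>(Basis :: (real^'n::finite) set). g b) = (\<Sum>i\<in>UNIV. g (axis i 1))"
proof -
  have B: "(Basis :: (real^'n) set) = range (\<lambda>i. axis i 1)" by (auto simp: Basis_vec_def)
  have inj: "inj (\<lambda>i::'n. axis i (1::real))" by (auto simp: inj_def axis_eq_axis)
  show ?thesis unfolding B sum.reindex[OF inj] by simp
qed

lemma holder_vgrad_uniformly_continuous:
  fixes v :: "real^'n::finite \<Rightarrow> real"
  assumes \<beta>: "0 < \<beta>" and h: "\<And>i. holder_on \<beta> \<Omega> (partial i v)"
  shows "uniformly_continuous_on \<Omega> (vgrad v)"
proof -
  have "\<exists>C. \<forall>i. \<forall>x\<in>\<Omega>. \<forall>y\<in>\<Omega>. \<bar>partial i v x - partial i v y\<bar> \<le> C i * dist x y powr \<beta>"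
    using h unfolding holder_on_def by metis
  then obtain C where C: "\<And>i x y. x \<in> \<Omega> \<Longrightarrow> y \<in> \<Omega> \<Longrightarrow> \<bar>partial i v x - partial i v y\<bar> \<le> C i * dist x y powr \<beta>"
    by blast
  \<comment> \<open>The constants of \<open>holder_on\<close> carry no sign, hence the absolute
    values; the added 1 allows division by \<open>B\<close>.\<close>
  define B where "B = (\<Sum>i\<in>UNIV. \<bar>C i\<bar>) + 1"
  have B: "0 < B" by (simp add: B_def sum_nonneg add_nonneg_pos)
  show ?thesis
    unfolding uniformly_continuous_on_def
  proof (intro allI impI)
    fix e :: real assume e: "0 < e"
    show "\<exists>d>0. \<forall>x\<in>\<Omega>. \<forall>x'\<in>\<Omega>. dist x' x < d \<longrightarrow> dist (vgrad v x') (vgrad v x) < e"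
    proof (intro exI[of _ "(e / B) powr (1 / \<beta>)"] conjI ballI impI)
      show "0 < (e / B) powr (1 / \<beta>)" using e B by simp
      fix x y assume xy: "x \<in> \<Omega>" "y \<in> \<Omega>" "dist y x < (e / B) powr (1 / \<beta>)"
      have "dist y x powr \<beta> < ((e / B) powr (1 / \<beta>)) powr \<beta>"
        using xy(3) \<beta> by (intro powr_less_mono2) auto
      also have "\<dots> = e / B" using \<beta> e B by (simp add: powr_powr)
      finally have d: "dist y x powr \<beta> < e / B" .
      have "dist (vgrad v y) (vgrad v x) \<le> (\<Sum>i\<in>UNIV. \<bar>partial i v y - partial i v x\<bar>)"
        using norm_le_l1_cart[of "vgrad v y - vgrad v x"] by (simp add: dist_norm vgrad_def)
      also have "\<dots> \<le> (\<Sum>i\<in>UNIV. \<bar>C i\<bar> * dist y x powr \<beta>)"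
      proof (rule sum_mono)
        fix i
        have "C i * dist y x powr \<beta> \<le> \<bar>C i\<bar> * dist y x powr \<beta>" by (intro mult_right_mono) auto
        then show "\<bar>partial i v y - partial i v x\<bar> \<le> \<bar>C i\<bar> * dist y x powr \<beta>" using C[OF xy(2,1), of i] by linarith
      qed
      also have "\<dots> \<le> B * dist y x powr \<beta>"
        by (simp add: B_def distrib_right flip: sum_distrib_right)
      also have "\<dots> < e" using d B by (simp add: field_simps)
      finally show "dist (vgrad v y) (vgrad v x) < e" .
    qed
  qed
qed

text \<open>Unfolding \<open>Ck_on 2\<close> makes each partial derivative totally differentiable,
  and these derivatives are the rows of the Hessian. Its symmetry comes from
  \<open>symmetric_hessian\<close>, and the Hoelder bounds on first derivatives give the uniform
  continuity of the gradient.\<close>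

lemma semilinear_classical:
  fixes v :: "real^'n::finite \<Rightarrow> real"
  assumes \<Omega>: "open \<Omega>" "bounded \<Omega>" and \<beta>: "0 < \<beta>" and reg: "C2_holder \<beta> \<Omega> v"
    and bdry: "\<And>x. x \<in> frontier \<Omega> \<Longrightarrow> v x = 0" and \<mu>: "0 < \<mu>" and p: "1 < p"
    and pde: "\<And>x. x \<in> \<Omega> \<Longrightarrow> - laplacian v x = \<mu> * pospart (v x - 1) powr p"
  shows "semilinear \<Omega> v (vgrad v) (\<lambda>x h. \<chi> i. h \<bullet> vgrad (partial i v) x) p \<mu>"
proof -
  let ?D = "\<lambda>x h. \<chi> i. h \<bullet> vgrad (partial i v) x"
  have Ck: "Ck_on (Suc (Suc 0)) \<Omega> v" using reg by (simp add: C2_holder_def numeral_2_eq_2)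
  then have Ck1: "Ck_on (Suc 0) \<Omega> (partial i v)" for i by simp
  have "continuous_on \<Omega> (partial i v)" for i
    using Ck_on_gderiv(1)[OF Ck1] gderiv_continuous by (intro continuous_at_imp_continuous_on) blast
  then have Ck1v: "Ck_on (Suc 0) \<Omega> v" using Ck by simp
  have grad: "GDERIV v x :> vgrad v x" if "x \<in> \<Omega>" for x by (rule Ck_on_gderiv(1)[OF Ck1v that])
  have hess: "(vgrad v has_derivative ?D x) (at x)" if "x \<in> \<Omega>" for x
  proof (subst has_derivative_componentwise_within, intro ballI)
    fix b :: "real^'n" assume "b \<in> Basis"
    then obtain i where b: "b = axis i 1" by (auto simp: Basis_vec_def)
    show "((\<lambda>x. vgrad v x \<bullet> b) has_derivative (\<lambda>h. ?D x h \<bullet> b)) (at x)"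
      using Ck_on_gderiv(1)[OF Ck1 that, of i] unfolding gderiv_def b by (simp add: inner_axis vgrad_def)
  qed
  have C2: "C2_fun \<Omega> v (vgrad v) ?D"
  proof
    show "continuous_on \<Omega> (\<lambda>x. ?D x h)" for h
      by (intro continuous_on_vec_lambda continuous_on_inner continuous_on_const Ck_on_gderiv(2)[OF Ck1])
  qed (use grad hess in auto)
  show ?thesis
  proof (intro semilinear.intro semilinear_axioms.intro C2 \<Omega> \<mu> p)
    show "continuous_on (closure \<Omega>) v" using reg by (simp add: C2_holder_def)
    show "v x = 0" if "x \<in> frontier \<Omega>" for x using bdry[OF that] .
    show "uniformly_continuous_on \<Omega> (vgrad v)"
      using reg \<beta> by (intro holder_vgrad_uniformly_continuous) (auto simp: C2_holder_def)
    show "?D x a \<bullet> b = ?D x b \<bullet> a" if "x \<in> \<Omega>" for x a b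
      using symmetric_hessian[OF \<Omega>(1) that grad hess[OF that]] .
    show "- C2_fun.lap ?D x = \<mu> * pospart (v x - 1) powr p" if "x \<in> \<Omega>" for x
      unfolding C2_fun.lap_def[OF C2] sum_Basis_vec
      using pde[OF that] by (simp add: inner_axis inner_axis' laplacian_def vgrad_def)
  qed
qed

text \<open>A nonvanishing partial derivative of the defining function at z singles out a coordinate
  direction \<open>e\<close> pointing into the domain. Continuity of the gradient extends the
  monotonicity to a cone around \<open>e\<close> and to a ball around z, so no flattening of the
  boundary is performed.\<close>

lemma boundary_chart:
  fixes \<Omega> :: "(real^'n::finite) set"
  assumes "smooth_boundary \<Omega>" "z \<in> frontier \<Omega>"
  obtains r \<phi> n n0 e b c where "0 < r" "\<And>x. x \<in> ball z r \<Longrightarrow> GDERIV \<phi> x :> n x" "continuous_on (ball z r) n"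
    "\<And>x. x \<in> ball z r \<Longrightarrow> norm (n x) \<le> n0" "\<And>x. x \<in> ball z r \<Longrightarrow> x \<in> \<Omega> \<longleftrightarrow> 0 < \<phi> x"
    "norm e = 1" "0 < b" "0 < c" "\<And>x e'. x \<in> ball z r \<Longrightarrow> norm (e' - e) \<le> c \<Longrightarrow> b \<le> n x \<bullet> e'"
proof -
  obtain r0 \<psi> where r0: "0 < r0" and sm: "smooth_on (ball z r0) \<psi>"
    and nz: "\<forall>x\<in>ball z r0. \<exists>i. partial i \<psi> x \<noteq> 0" and dom: "\<Omega> \<inter> ball z r0 = {x \<in> ball z r0. \<psi> x < 0}"
    using assms unfolding smooth_boundary_def by blast
  have Ck: "Ck_on (Suc 0) (ball z r0) \<psi>" using sm by (simp add: smooth_on_def)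
  define n where "n x = - vgrad \<psi> x" for x
  have gd: "GDERIV (\<lambda>x. - \<psi> x) x :> n x" if "x \<in> ball z r0" for x
    unfolding n_def by (intro GDERIV_minus Ck_on_gderiv(1)[OF Ck that])
  have nc: "continuous_on (ball z r0) n"
    unfolding n_def by (intro continuous_intros Ck_on_gderiv(2)[OF Ck])
  obtain i where i: "partial i \<psi> z \<noteq> 0" using nz r0 by force
  define e where "e = - sgn (partial i \<psi> z) *\<^sub>R axis i (1::real)"
  \<comment> \<open>The slope along \<open>e\<close> at z is \<open>4 * b\<close>. Moving from z to
    x costs at most \<open>2 * b\<close>, since \<open>norm e' \<le> 2\<close>, and tilting
    \<open>e\<close> to \<open>e'\<close> costs at most \<open>b\<close> by the choice of
    \<open>c\<close>; \<open>b\<close> remains.\<close>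
  define b where "b = \<bar>partial i \<psi> z\<bar> / 4"
  have b: "0 < b" using i by (simp add: b_def)
  have e: "norm e = 1" using i by (simp add: e_def norm_axis_1 abs_sgn_eq)
  have ne: "n z \<bullet> e = 4 * b"
    using i by (simp add: n_def e_def b_def inner_axis vgrad_def abs_sgn[symmetric] mult.commute)
  define c where "c = min 1 (b / (norm (n z) + 1))"
  have c: "0 < c" "c \<le> 1" "c * norm (n z) \<le> b"
  proof -
    show "0 < c" "c \<le> 1" using b by (simp_all add: c_def add_nonneg_pos)
    have "c * norm (n z) \<le> b / (norm (n z) + 1) * (norm (n z) + 1)"
      using b by (intro mult_mono) (auto simp: c_def)
    also have "\<dots> = b" using norm_ge_zero[of "n z"] by (simp add: add_nonneg_eq_0_iff)
    finally show "c * norm (n z) \<le> b" .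
  qed
  have "isCont n z"
    using nc r0 by (simp add: continuous_on_eq_continuous_at)
  then obtain r' where r': "0 < r'" "\<And>x. dist x z < r' \<Longrightarrow> dist (n x) (n z) < b"
    unfolding continuous_at_eps_delta using b by blast
  define r where "r = min r0 r'"
  have sub: "ball z r \<subseteq> ball z r0" by (auto simp: r_def)
  have close: "norm (n x - n z) < b" if "x \<in> ball z r" for x
    using r'(2)[of x] that by (simp add: r_def dist_norm norm_minus_commute)
  show ?thesis
  proof
    show "0 < r" using r0 r' by (simp add: r_def)
    show "GDERIV (\<lambda>x. - \<psi> x) x :> n x" if "x \<in> ball z r" for x using gd that sub by blast
    show "continuous_on (ball z r) n" using nc sub by (rule continuous_on_subset)
    show "norm (n x) \<le> norm (n z) + b" if "x \<in> ball z r" for x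
      using close[OF that] norm_triangle_ineq2[of "n x" "n z"] by linarith
    show "x \<in> \<Omega> \<longleftrightarrow> 0 < - \<psi> x" if "x \<in> ball z r" for x
    proof -
      have "x \<in> ball z r0" using that sub by blast
      moreover have "x \<in> \<Omega> \<inter> ball z r0 \<longleftrightarrow> x \<in> {x \<in> ball z r0. \<psi> x < 0}" by (simp only: dom)
      ultimately show ?thesis by (simp only: Int_iff mem_Collect_eq) simp
    qed
    show "norm e = 1" "0 < b" "0 < c" by fact+
    show "b \<le> n x \<bullet> e'" if x: "x \<in> ball z r" and e': "norm (e' - e) \<le> c" for x e'
    proof -
      have "norm e' \<le> 2" using norm_triangle_ineq2[of e' e] e e' c by linarith
      then have "norm (n x - n z) * norm e' \<le> b * 2" using close[OF x] b by (intro mult_mono) auto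
      then have 1: "- (2 * b) \<le> (n x - n z) \<bullet> e'"
        using Cauchy_Schwarz_ineq2[of "n x - n z" e'] by linarith
      have "norm (n z) * norm (e' - e) \<le> norm (n z) * c" using e' by (intro mult_left_mono) auto
      then have 2: "- b \<le> n z \<bullet> (e' - e)"
        using Cauchy_Schwarz_ineq2[of "n z" "e' - e"] c(3) by (simp add: mult.commute)
      show ?thesis using 1 2 ne by (simp add: inner_diff_left inner_diff_right)
    qed
  qed
qed

section \<open>Passage from the uniform exclusion to the sequence\<close>

theorem theorem1p2:
  fixes \<Omega> :: "(real^'n::finite) set"
    and p :: real
    and alpha lam \<mu> :: "nat \<Rightarrow> real"
    and v :: "nat \<Rightarrow> real^'n \<Rightarrow> real"
  assumes dim: "CARD('n) \<ge> 3"
    and open_\<Omega>: "open \<Omega>" and bdd_\<Omega>: "bounded \<Omega>" and smooth_\<Omega>: "smooth_boundary \<Omega>"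
    and p_gt: "p > 1" and p_lt: "p < real CARD('n) / (real CARD('n) - 2)"
    and lam_pos: "\<forall>n. lam n > 0"
    and reg: "\<forall>n. \<exists>\<beta>. 0 < \<beta> \<and> \<beta> < 1 \<and> C2_holder \<beta> \<Omega> (v n)"
    and mu_def: "\<forall>n. \<mu> n = lam n * \<bar>alpha n\<bar> powr (p - 1)"
    and pde: "\<forall>n. \<forall>x\<in>\<Omega>. - laplacian (v n) x = \<mu> n * pospart (v n x - 1) powr p"
    and bdry: "\<forall>n. \<forall>x\<in>frontier \<Omega>. v n x = 0"
    and mu_lim: "filterlim \<mu> at_top sequentially"
    and norm: "\<forall>n. integral \<Omega> (\<lambda>x. \<bar>alpha n\<bar> powr p * pospart (v n x - 1) powr p) = 1"
    and C0: "\<exists>C0>0. \<forall>n. \<mu> n powr (real CARD('n) / 2) *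
               integral \<Omega> (\<lambda>x. pospart (v n x - 1) powr p) \<le> C0"
    and alt: "convex \<Omega> \<or> (\<exists>C1>0. \<forall>n. \<mu> n powr (real CARD('n) / 2) *
               integral \<Omega> (\<lambda>x. pospart (v n x - 1) powr (p + 1)) \<le> C1)"
  shows "spike_set \<Omega> p \<mu> v \<subseteq> \<Omega>"
proof
  fix z assume z: "z \<in> spike_set \<Omega> p \<mu> v"
  then obtain x \<sigma> where zc: "z \<in> closure \<Omega>" and x\<Omega>: "\<And>n. x n \<in> \<Omega>" and xz: "x \<longlonglongrightarrow> z" and \<sigma>: "0 < \<sigma>"
    and big: "\<And>n. 1 + \<sigma> \<le> v n (x n)"
    and far: "(\<lambda>n. 1 / sqrt (\<mu> n)) \<in> o(\<lambda>n. infdist (x n) (frontier \<Omega>))"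
    unfolding spike_set_def by blast
  show "z \<in> \<Omega>"
  proof (rule ccontr)
    assume "z \<notin> \<Omega>"
    then have zf: "z \<in> frontier \<Omega>" using zc open_\<Omega> by (simp add: frontier_def interior_open)
    have D: "DIM(real^'n) = CARD('n)" by simp
    have N: "2 < DIM(real^'n)" using dim by simp
    have p': "p * (real DIM(real^'n) - 2) < real DIM(real^'n)"
      using p_lt dim by (simp add: field_simps)
    obtain C0 where C0_pos: "0 < C0" and C0_le: "\<And>n. \<mu> n powr (real CARD('n) / 2) * integral \<Omega> (\<lambda>x. pospart (v n x - 1) powr p) \<le> C0"
      using C0 by blast
    obtain r \<phi> n0 nb e b c where chart: "0 < r" "\<And>x. x \<in> ball z r \<Longrightarrow> GDERIV \<phi> x :> n0 x" "continuous_on (ball z r) n0"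
      "\<And>x. x \<in> ball z r \<Longrightarrow> norm (n0 x) \<le> nb" "\<And>x. x \<in> ball z r \<Longrightarrow> x \<in> \<Omega> \<longleftrightarrow> 0 < \<phi> x"
      "norm e = 1" "0 < b" "0 < c" "\<And>x e'. x \<in> ball z r \<Longrightarrow> norm (e' - e) \<le> c \<Longrightarrow> b \<le> n0 x \<bullet> e'"
      using boundary_chart[OF smooth_\<Omega> zf] by metis
    obtain \<rho> \<Lambda> where \<rho>: "0 < \<rho>" and \<Lambda>: "0 < \<Lambda>" and no_spike: "\<And>u G D \<mu> \<epsilon> x. semilinear \<Omega> u G D p \<mu> \<Longrightarrow> 0 < \<epsilon> \<Longrightarrow> \<mu> * \<epsilon>\<^sup>2 = 1 \<Longrightarrow>
       integral \<Omega> (semilinear.f u p \<mu>) \<le> C0 * \<epsilon> ^ (DIM(real^'n) - 2) \<Longrightarrow> x \<in> \<Omega> \<Longrightarrow> 1 < u x \<Longrightarrow>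
       dist x z < \<rho> \<Longrightarrow> \<not> \<Lambda> * \<epsilon> \<le> infdist x (frontier \<Omega>)"
      using no_boundary_spike[OF N p_gt p' C0_pos open_\<Omega> zf chart] by blast
    have "eventually (\<lambda>n. 1 \<le> \<mu> n) sequentially"
      using mu_lim by (simp add: filterlim_at_top)
    moreover have "eventually (\<lambda>n. dist (x n) z < \<rho>) sequentially"
      using xz \<rho> by (rule tendstoD)
    \<comment> \<open>The small-o condition is used with the single constant
      \<open>1 / \<Lambda>\<close>: eventually the distance to the frontier is at least
      \<open>\<Lambda>\<close> times \<epsilon>.\<close>
    moreover have "eventually (\<lambda>n. norm (1 / sqrt (\<mu> n)) \<le> 1 / \<Lambda> * norm (infdist (x n) (frontier \<Omega>))) sequentially"
      using far by (rule landau_o.smallD) (use \<Lambda> in simp)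
    ultimately have "eventually (\<lambda>n. False) sequentially"
    proof eventually_elim
      case (elim n)
      define \<epsilon> where "\<epsilon> = 1 / sqrt (\<mu> n)"
      have \<mu>: "0 < \<mu> n" using elim(1) by simp
      have \<epsilon>: "0 < \<epsilon>" "\<mu> n * \<epsilon>\<^sup>2 = 1" using \<mu> by (simp_all add: \<epsilon>_def power_divide)
      obtain \<beta> where \<beta>: "0 < \<beta>" "C2_holder \<beta> \<Omega> (v n)" using reg by blast
      have sl: "semilinear \<Omega> (v n) (vgrad (v n)) (\<lambda>x h. \<chi> i. h \<bullet> vgrad (partial i (v n)) x) p (\<mu> n)"
        by (rule semilinear_classical[OF open_\<Omega> bdd_\<Omega> \<beta> _ \<mu> p_gt]) (use bdry pde in auto)
      have mass: "integral \<Omega> (semilinear.f (v n) p (\<mu> n)) \<le> C0 * \<epsilon> ^ (DIM(real^'n) - 2)"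
      proof -
        define J where "J = integral \<Omega> (\<lambda>x. pospart (v n x - 1) powr p)"
        have "integral \<Omega> (semilinear.f (v n) p (\<mu> n)) = \<mu> n * J"
          unfolding semilinear.f_def[OF sl, abs_def] J_def by (rule integral_mult_right)
        \<comment> \<open>Splitting off the power N/2 of \<open>\<mu> n\<close> leaves the power 1 -
          N/2, which is \<open>\<epsilon> ^ (N - 2)\<close>: the mass bound in the scaling of the
          preceding estimates.\<close>
        also have "\<dots> = (\<mu> n powr (real CARD('n) / 2) * J) * \<mu> n powr (1 - real CARD('n) / 2)"
          using \<mu> by (simp add: powr_diff)
        also have "\<dots> \<le> C0 * \<mu> n powr (1 - real CARD('n) / 2)"
          using C0_le[of n] by (intro mult_right_mono) (auto simp: J_def)
        also have "\<mu> n powr (1 - real CARD('n) / 2) = \<epsilon> ^ (CARD('n) - 2)"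
        proof -
          have "\<epsilon> = \<mu> n powr (- 1 / 2)"
            using \<mu> by (simp add: \<epsilon>_def powr_half_sqrt powr_minus_divide)
          moreover have "\<epsilon> ^ (CARD('n) - 2) = \<epsilon> powr real (CARD('n) - 2)"
            using \<epsilon>(1) by (simp add: powr_realpow)
          ultimately have "\<epsilon> ^ (CARD('n) - 2) = \<mu> n powr (- 1 / 2 * real (CARD('n) - 2))"
            by (simp only: powr_powr)
          also have "- 1 / 2 * real (CARD('n) - 2) = 1 - real CARD('n) / 2"
            using dim by (simp add: of_nat_diff field_simps)
          finally show ?thesis by simp
        qed
        finally show ?thesis unfolding D .
      qed
      have "\<Lambda> * \<epsilon> \<le> infdist (x n) (frontier \<Omega>)"
        using elim(3) \<Lambda> \<mu> by (simp add: \<epsilon>_def field_simps infdist_nonneg)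
      moreover have "1 < v n (x n)" using big[of n] \<sigma> by linarith
      ultimately show False using no_spike[OF sl \<epsilon> mass x\<Omega>] elim(2) by blast
    qed
    then show False by simp
  qed
qed

end
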